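(* Let $H$ be a complex separable infinite-dimensional Hilbert space. If $A,B$ are compact operators on $H$ such that $A-B\in\mathcal{L}_1$, then $|A|-|B|\in(\mathcal{L}_{1,\infty})_0$.
   Context: For a compact operator $A$ on $H$, $\{\mu(k,A)\}_{k\ge 0}$ denotes the sequence of singular numbers of $A$ (in decreasing order, with multiplicity). $\mathcal{L}_1$ is the trace class, i.e. the compact operators $A$ with $\|A\|_1:=\sum_{k\ge 0}\mu(k,A)<\infty$. $(\mathcal{L}_{1,\infty})_0$ is the set of compact operators $A$ on $H$ with $k\mu(k,A)\to 0$ as $k\to\infty$. $|A|=(A^*A)^{1/2}$. *)

theory Defs
  imports "HOL-Analysis.Analysis"
begin

class scaleC = scaleR +
  fixes scaleC :: "complex \<Rightarrow> 'a \<Rightarrow> 'a" (infixr "*\<^sub>C" 75)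
  assumes scaleR_scaleC: "r *\<^sub>R x = complex_of_real r *\<^sub>C x"

class complex_vector = scaleC + real_vector +
  assumes scaleC_add_right: "a *\<^sub>C (x + y) = a *\<^sub>C x + a *\<^sub>C y"
    and scaleC_add_left: "(a + b) *\<^sub>C x = a *\<^sub>C x + b *\<^sub>C x"
    and scaleC_scaleC: "a *\<^sub>C b *\<^sub>C x = (a * b) *\<^sub>C x"
    and scaleC_one: "1 *\<^sub>C x = x"

global_interpretation complex_vector:
  vector_space "scaleC :: complex \<Rightarrow> 'a \<Rightarrow> 'a::complex_vector"
  defines cspan = complex_vector.span
    and cdependent = complex_vector.dependent
    and cextend_basis = complex_vector.extend_basis
    and cdim = complex_vector.dim
  by unfold_locales
    (simp_all add: scaleC_add_right scaleC_add_left scaleC_scaleC scaleC_one)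

abbreviation clinear :: "('a::complex_vector \<Rightarrow> 'b::complex_vector) \<Rightarrow> bool"
  where "clinear \<equiv> Vector_Spaces.linear scaleC scaleC"

text \<open>The inner product is linear in its first argument.  The norm, the topology and the real
  inner product are the ones determined by \<open>cinner\<close>: the norm of \<open>real_inner\<close> is
  \<open>sqrt (inner x x)\<close>, and \<open>inner\<close> is forced to be \<open>Re (cinner x y)\<close>.  Positive definiteness of
  \<open>cinner\<close> is therefore inherited from \<open>real_inner\<close>; see \<open>cinner_self\<close> below.\<close>

class complex_inner = complex_vector + real_inner +
  fixes cinner :: "'a \<Rightarrow> 'a \<Rightarrow> complex"
  assumes cinner_commute: "cinner x y = cnj (cinner y x)"
    and cinner_add_left: "cinner (x + y) z = cinner x z + cinner y z"
    and cinner_scaleC_left: "cinner (a *\<^sub>C x) y = a * cinner x y"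
    and inner_eq_Re_cinner: "inner x y = Re (cinner x y)"

class chilbert_space = complex_inner + complete_space

lemma cinner_self: "cinner x x = complex_of_real ((norm x)\<^sup>2)"
proof -
  have "Im (cinner x x) = 0"
    using arg_cong [OF cinner_commute [of x x], of Im] by simp
  then show ?thesis
    by (simp add: complex_eq_iff power2_norm_eq_inner inner_eq_Re_cinner)
qed

definition bounded_clinear :: "('a::complex_inner \<Rightarrow> 'b::complex_inner) \<Rightarrow> bool"
  where "bounded_clinear T \<longleftrightarrow> clinear T \<and> bounded_linear T"

definition compact_operator :: "('a::complex_inner \<Rightarrow> 'b::complex_inner) \<Rightarrow> bool"
  where "compact_operator T \<longleftrightarrow> clinear T \<and> (\<forall>S. bounded S \<longrightarrow> compact (closure (T ` S)))"

definition cadjoint :: "('a::complex_inner \<Rightarrow> 'b::complex_inner) \<Rightarrow> 'b \<Rightarrow> 'a"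
  where "cadjoint T = (THE T'. \<forall>x y. cinner (T x) y = cinner x (T' y))"

definition positive_operator :: "('a::complex_inner \<Rightarrow> 'a) \<Rightarrow> bool"
  where "positive_operator T \<longleftrightarrow> bounded_clinear T \<and> (\<forall>x. cinner (T x) x \<in> \<real>\<^sub>\<ge>\<^sub>0)"

text \<open>The square root is meaningful only for a positive operator \<open>P\<close> on a Hilbert space, where it
  exists and is unique.\<close>

definition sqrt_operator :: "('a::complex_inner \<Rightarrow> 'a) \<Rightarrow> 'a \<Rightarrow> 'a"
  where "sqrt_operator P = (THE T. positive_operator T \<and> T \<circ> T = P)"

definition abs_operator :: "('a::complex_inner \<Rightarrow> 'a) \<Rightarrow> 'a \<Rightarrow> 'a"
  where "abs_operator T = sqrt_operator (cadjoint T \<circ> T)"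

definition eigenspace :: "('a::complex_vector \<Rightarrow> 'a) \<Rightarrow> complex \<Rightarrow> 'a set"
  where "eigenspace T c = {x. T x = c *\<^sub>C x}"

text \<open>For compact \<open>T\<close>, the singular numbers are the eigenvalues of \<open>|T|\<close> in decreasing order and
  counted with multiplicity: the sequence is nonnegative and decreasing, and every \<open>r > 0\<close> occurs
  in it exactly as many times as the dimension of the corresponding eigenspace of \<open>|T|\<close> (never, if
  \<open>r\<close> is not an eigenvalue).  For \<open>T\<close> of finite rank this forces the sequence to end in zeros.
  Finiteness is required explicitly because \<open>card\<close> of an infinite set is 0.\<close>

definition singular_numbers :: "('a::complex_inner \<Rightarrow> 'a) \<Rightarrow> nat \<Rightarrow> real"
  where "singular_numbers T = (THE s. decseq s \<and> (\<forall>k. 0 \<le> s k) \<and>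
    (\<forall>r>0. finite {k. s k = r} \<and>
      card {k. s k = r} = cdim (eigenspace (abs_operator T) (complex_of_real r))))"

abbreviation singular_number :: "nat \<Rightarrow> ('a::complex_inner \<Rightarrow> 'a) \<Rightarrow> real" ("\<mu>")
  where "\<mu> k T \<equiv> singular_numbers T k"

definition trace_class :: "('a::complex_inner \<Rightarrow> 'a) set"
  where "trace_class = {T. compact_operator T \<and> summable (\<lambda>k. \<mu> k T)}"

definition weak_trace_class_0 :: "('a::complex_inner \<Rightarrow> 'a) set"
  where "weak_trace_class_0 =
    {T. compact_operator T \<and> (\<lambda>k. real k * \<mu> k T) \<longlonglongrightarrow> 0}"

definition infinite_dimensional :: "'a::complex_vector itself \<Rightarrow> bool"
  where "infinite_dimensional _ \<longleftrightarrow> \<not> (\<exists>S::'a set. finite S \<and> cspan S = UNIV)"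

end

theory Submission
  imports Defs "Jordan_Normal_Form.Determinant"
begin

text \<open>Write \<open>S = A - B\<close> and \<open>T = |A| - |B|\<close>.  Let \<open>w\<close> run through an orthonormal basis of eigenvectors of
\<open>|A|\<close>, with \<open>|A| w = l w\<close> and \<open>A w = l u\<close>, and let \<open>v\<close> run through one of \<open>|B|\<close>, with \<open>|B| v = m v\<close> and
\<open>B v = m z\<close>.  The identity \<open>|A| T + T |B| = A\<^sup>* A - B\<^sup>* B = A\<^sup>* S + S\<^sup>* B\<close> reads, in matrix entries,
\<open>(l + m) \<langle>T v, w\<rangle> = l \<langle>S v, u\<rangle> + m \<langle>z, S w\<rangle>\<close>.  Hence \<open>T = (E + F) / 2 + Y / 2\<close>, where
\<open>E = (\<langle>S v, u\<rangle>)\<close> and \<open>F = (\<langle>z, S w\<rangle>)\<close> are matrices of trace class operators, and \<open>Y\<close> arises from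
\<open>E - F\<close> by multiplying each entry by \<open>(l - m) / (l + m)\<close>.  So the theorem says that this
Schur multiplier sends the trace class to operators with \<open>\<mu>(k) = o(1/k)\<close>.

The heart of the matter is a weak type estimate for the multiplier, proved with determinants of
finite matrices.  Let \<open>D\<close> be positive semidefinite, let \<open>L\<close> be diagonal with entries \<open>l\<^sub>i > 0\<close>, and put
\<open>X\<^sub>i\<^sub>j = D\<^sub>i\<^sub>j / (l\<^sub>i + l\<^sub>j)\<close>.  Then \<open>D = L X + X L\<close>, and \<open>Y = L X - X L\<close> is the Schur multiple of \<open>D\<close>.
Since \<open>Y\<close> is skew-adjoint, \<open>1 + Y\<close> has real part \<open>1\<close>, and adding the positive matrix \<open>D\<close> to it can
only increase the modulus of the determinant.  But \<open>1 + Y + D = 1 + 2 L X\<close> is similar to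
\<open>1 + 2 L\<^sup>\<onehalf> X L\<^sup>\<onehalf>\<close>, where the second summand is positive of trace \<open>tr D\<close>.  Therefore
\<open>\<Prod> (1 + \<mu>(k, Y)\<^sup>2)\<^sup>\<onehalf> = |det (1 + Y)| \<le> det (1 + 2 L X) \<le> exp (tr D)\<close>.
After scaling this bounds the number of singular values of \<open>Y\<close> above \<open>\<tau>\<close> by \<open>3 tr D / \<tau>\<close>.  These
are \<open>schur_opdet_bound\<close>, \<open>schur_singular_bound\<close> and \<open>schur_singular_value_le\<close>; a trace class matrix
that is not positive is a difference of two positive ones in a twice larger space
(\<open>block_small_off_few\<close>).

For the little o, fix \<open>\<epsilon> > 0\<close>.  Up to finitely many rows, \<open>E\<close> and \<open>F\<close> have nuclear norm at most
\<open>2 \<epsilon>\<close> each, and the \<open>R\<close> exceptional rows of \<open>T\<close> form an operator of rank at most \<open>R\<close>.  Hence the number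
\<open>N\<close> of singular values of \<open>T\<close> that are at least \<open>t\<close> satisfies \<open>N t \<le> R t + 56 \<epsilon>\<close>
(\<open>singular_value_count\<close>), and \<open>t\<close> tends to \<open>0\<close> while \<open>R\<close> depends on \<open>\<epsilon>\<close> alone.

The remaining sections supply Hilbert space theory: adjoints, orthonormal systems of
singular vectors of compact operators, existence and uniqueness of \<open>|A|\<close>, and the identification of
the singular numbers with \<open>\<parallel>T e\<^sub>k\<parallel>\<close> for such a system \<open>e\<close>.\<close>

section \<open>Determinants of finite matrices\<close>

text \<open>The determinant of the \<open>n\<close> by \<open>n\<close> matrix with entries \<open>M i j\<close>; entries as a plain function keep the
matrix type out of the analytic arguments.\<close>

definition fdet :: "nat \<Rightarrow> (nat \<Rightarrow> nat \<Rightarrow> complex) \<Rightarrow> complex"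
  where "fdet n M = Determinant.det (mat n n (\<lambda>(i, j). M i j))"

lemma fdet_cong: "(\<And>i j. i < n \<Longrightarrow> j < n \<Longrightarrow> M i j = M' i j) \<Longrightarrow> fdet n M = fdet n M'"
  unfolding fdet_def by (rule arg_cong[where f = Determinant.det]) auto

lemma fdet_mult: "fdet n (\<lambda>i j. \<Sum>k<n. M i k * M' k j) = fdet n M * fdet n M'"
proof -
  have "mat n n (\<lambda>(i, j). \<Sum>k<n. M i k * M' k j) =
      mat n n (\<lambda>(i, j). M i j) * mat n n (\<lambda>(i, j). M' i j)"
    by (rule eq_matI) (auto simp: scalar_prod_def atLeast0LessThan)
  then show ?thesis
    unfolding fdet_def by (simp add: det_mult[of _ n])
qed

lemma fdet_one: "fdet n (\<lambda>i j. if i = j then 1 else 0) = 1"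
proof -
  have "mat n n (\<lambda>(i, j). if i = j then 1 else 0) = (1\<^sub>m n :: complex mat)"
    by (rule eq_matI) auto
  then show ?thesis unfolding fdet_def by simp
qed

lemma fdet_adjoint: "fdet n (\<lambda>i j. cnj (M j i)) = cnj (fdet n M)"
proof -
  interpret cnj: comm_ring_hom cnj by unfold_locales auto
  have "mat n n (\<lambda>(i, j). cnj (M j i)) = map_mat cnj (transpose_mat (mat n n (\<lambda>(i, j). M i j)))"
    by (rule eq_matI) auto
  then show ?thesis unfolding fdet_def by (simp add: det_transpose[of _ n])
qed

text \<open>The block matrix \<open>[1, - v\<^sup>T; u, 1]\<close> factors into block triangular matrices in two ways, with
diagonal blocks \<open>1, 1 + u v\<^sup>T\<close> and \<open>1 + v\<^sup>T u, 1\<close> respectively.\<close>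

lemma fdet_one_plus_rank_one:
  "fdet n (\<lambda>i j. (if i = j then 1 else 0) + u i * v j) = 1 + (\<Sum>i<n. u i * v i)"
proof -
  let ?U = "mat n 1 (\<lambda>(i, j). u i)" and ?V = "mat 1 n (\<lambda>(i, j). v j)"
  let ?I = "1\<^sub>m n :: complex mat" and ?J = "1\<^sub>m 1 :: complex mat"
  have VU: "?V * ?U = mat 1 1 (\<lambda>_. \<Sum>i<n. u i * v i)"
    by (rule eq_matI) (auto simp: scalar_prod_def atLeast0LessThan mult.commute)
  have UV: "?I + ?U * ?V = mat n n (\<lambda>(i, j). (if i = j then 1 else 0) + u i * v j)"
    by (rule eq_matI) (auto simp: scalar_prod_def)
  let ?M = "four_block_mat ?J (- ?V) ?U ?I"
  have 1: "?M = four_block_mat ?J (0\<^sub>m 1 n) ?U ?I * four_block_mat ?J (- ?V) (0\<^sub>m n 1) (?I + ?U * ?V)"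
    by (subst mult_four_block_mat[of _ 1 1 _ n _ n _ _ 1 _ n]) (auto intro!: arg_cong2[where f="four_block_mat ?J"] eq_matI simp: scalar_prod_def)
  have 2: "?M = four_block_mat (?J + ?V * ?U) (- ?V) (0\<^sub>m n 1) ?I * four_block_mat ?J (0\<^sub>m 1 n) ?U ?I"
    by (subst mult_four_block_mat[of _ 1 1 _ n _ n _ _ 1 _ n]) (auto intro!: arg_cong2[where f="\<lambda>x y. four_block_mat x y _ _"] eq_matI simp: scalar_prod_def)
  have d1: "Determinant.det (four_block_mat ?J (0\<^sub>m 1 n) ?U ?I) = 1"
    by (subst det_four_block_mat_upper_right_zero[of _ 1 _ n]) auto
  have c: "four_block_mat ?J (0\<^sub>m 1 n) ?U ?I \<in> carrier_mat (1 + n) (1 + n)"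
    by (intro four_block_carrier_mat) auto
  have c1: "four_block_mat ?J (- ?V) (0\<^sub>m n 1) (?I + ?U * ?V) \<in> carrier_mat (1 + n) (1 + n)"
    by (intro four_block_carrier_mat) auto
  have c2: "four_block_mat (?J + ?V * ?U) (- ?V) (0\<^sub>m n 1) ?I \<in> carrier_mat (1 + n) (1 + n)"
    by (intro four_block_carrier_mat) auto
  have "Determinant.det ?M = Determinant.det (?I + ?U * ?V)"
    unfolding 1 det_mult[OF c c1] d1
    by (subst det_four_block_mat_lower_left_zero[of _ 1 _ n]) auto
  moreover have "Determinant.det ?M = Determinant.det (?J + ?V * ?U)"
    unfolding 2 det_mult[OF c2 c] d1
    by (subst det_four_block_mat_lower_left_zero[of _ 1 _ n]) auto
  moreover have "Determinant.det (?J + ?V * ?U) = 1 + (\<Sum>i<n. u i * v i)"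
    unfolding VU by (subst det_single) auto
  ultimately show ?thesis unfolding fdet_def UV by simp
qed

section \<open>Complex inner product spaces and compact operators\<close>

lemma cinner_add_right: "cinner x (y + z) = cinner x y + cinner x (z :: 'a::complex_inner)"
  by (metis cinner_commute cinner_add_left complex_cnj_add)

lemma cinner_scaleC_right: "cinner x (a *\<^sub>C y) = cnj a * cinner x (y :: 'a::complex_inner)"
  by (metis cinner_commute cinner_scaleC_left complex_cnj_mult)

lemma scaleC_minus_one: "(-1) *\<^sub>C x = - (x :: 'a::complex_vector)"
  by (metis complex_vector.scale_minus_left scaleC_one)

lemma cinner_minus_left: "cinner (- x) y = - cinner x (y :: 'a::complex_inner)"
  by (metis cinner_scaleC_left mult_minus1 scaleC_minus_one)

lemma cinner_minus_right: "cinner x (- y) = - cinner x (y :: 'a::complex_inner)"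
  by (metis cinner_commute cinner_minus_left complex_cnj_minus)

lemma cinner_diff_left: "cinner (x - y) z = cinner x z - cinner y (z :: 'a::complex_inner)"
  by (metis cinner_add_left cinner_minus_left add_uminus_conv_diff)

lemma cinner_diff_right: "cinner x (y - z) = cinner x y - cinner x (z :: 'a::complex_inner)"
  by (metis cinner_add_right cinner_minus_right add_uminus_conv_diff)

lemma cinner_zero_left [simp]: "cinner 0 (x :: 'a::complex_inner) = 0"
  using cinner_diff_left[of 0 0 x] by simp

lemma cinner_zero_right [simp]: "cinner x (0 :: 'a::complex_inner) = 0"
  using cinner_diff_right[of x 0 0] by simp

lemma cinner_sum_left: "cinner (\<Sum>i\<in>I. f i) x = (\<Sum>i\<in>I. cinner (f i) (x :: 'a::complex_inner))"
  by (induction I rule: infinite_finite_induct) (auto simp: cinner_add_left)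

lemma cinner_sum_right: "cinner x (\<Sum>i\<in>I. f i) = (\<Sum>i\<in>I. cinner (x :: 'a::complex_inner) (f i))"
  by (induction I rule: infinite_finite_induct) (auto simp: cinner_add_right)

lemma cinner_scaleR_left: "cinner (r *\<^sub>R x) y = of_real r * cinner x (y :: 'a::complex_inner)"
  by (simp add: scaleR_scaleC cinner_scaleC_left)

lemma cinner_scaleR_right: "cinner x (r *\<^sub>R y) = of_real r * cinner x (y :: 'a::complex_inner)"
  by (simp add: scaleR_scaleC cinner_scaleC_right)

lemmas cinner_simps = cinner_add_left cinner_add_right cinner_diff_left cinner_diff_right
  cinner_scaleC_left cinner_scaleC_right cinner_scaleR_left cinner_scaleR_right
  cinner_minus_left cinner_minus_right

lemma norm_eq_Re_cinner: "(norm (x :: 'a::complex_inner))\<^sup>2 = Re (cinner x x)"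
  by (simp add: cinner_self)

lemma norm_scaleC [simp]: "norm (a *\<^sub>C x) = cmod a * norm (x :: 'a::complex_inner)"
proof -
  have "cinner (a *\<^sub>C x) (a *\<^sub>C x) = a * cnj a * cinner x x"
    by (simp add: cinner_simps)
  also have "\<dots> = of_real ((cmod a * norm x)\<^sup>2)"
    by (simp add: cinner_self power_mult_distrib complex_norm_square[symmetric])
  finally have "(norm (a *\<^sub>C x))\<^sup>2 = (cmod a * norm x)\<^sup>2"
    by (metis cinner_self of_real_eq_iff)
  then show ?thesis by simp
qed

lemma cinner_eq_zero_self: "cinner x x = 0 \<longleftrightarrow> (x :: 'a::complex_inner) = 0"
  by (simp add: cinner_self)

text \<open>Rotating \<open>x\<close> by a unimodular scalar makes \<open>cinner x y\<close> real, which reduces the complex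
Cauchy-Schwarz inequality to the real one.\<close>

lemma cmod_cinner_le: "cmod (cinner x y) \<le> norm x * norm (y :: 'a::complex_inner)"
proof -
  define z where "z = cinner x y"
  define u where "u = cnj (sgn z)"
  have 1: "u * z = of_real (cmod z)"
  proof (cases "z = 0")
    case False
    have "u * z = z * cnj z / cmod z" by (simp add: u_def sgn_eq)
    also have "\<dots> = of_real (cmod z)"
      unfolding complex_norm_square[symmetric] using False by (simp add: power2_eq_square)
    finally show ?thesis .
  qed simp
  have 2: "cmod u \<le> 1" by (simp add: u_def norm_sgn)
  have "cmod z = Re (cinner (u *\<^sub>C x) y)"
    unfolding cinner_scaleC_left z_def[symmetric] 1 by simp
  also have "\<dots> \<le> norm (u *\<^sub>C x) * norm y"
    by (metis inner_eq_Re_cinner norm_cauchy_schwarz)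
  also have "\<dots> \<le> norm x * norm y"
    using 2 by (intro mult_right_mono) (auto intro: mult_left_le_one_le)
  finally show ?thesis by (simp add: z_def)
qed

lemma bounded_linear_cinner_left: "bounded_linear (\<lambda>x. cinner x (y :: 'a::complex_inner))"
  by (rule bounded_linear_intro[of _ "norm y"])
     (auto simp: cinner_simps cmod_cinner_le scaleR_conv_of_real)

lemma bounded_linear_cinner_right: "bounded_linear (\<lambda>x. cinner (y :: 'a::complex_inner) x)"
  by (rule bounded_linear_intro[of _ "norm y"])
     (auto simp: cinner_simps cmod_cinner_le scaleR_conv_of_real intro: order_trans[OF cmod_cinner_le] simp: mult.commute)

lemma tendsto_cinner_left: "(f \<longlongrightarrow> l) F \<Longrightarrow> ((\<lambda>x. cinner (f x) (y :: 'a::complex_inner)) \<longlongrightarrow> cinner l y) F"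
  by (rule bounded_linear.tendsto[OF bounded_linear_cinner_left])

lemma tendsto_cinner_right: "(f \<longlongrightarrow> l) F \<Longrightarrow> ((\<lambda>x. cinner (y :: 'a::complex_inner) (f x)) \<longlongrightarrow> cinner y l) F"
  by (rule bounded_linear.tendsto[OF bounded_linear_cinner_right])

lemma cinner_ext: "(\<And>z. cinner x z = cinner y z) \<Longrightarrow> x = (y :: 'a::complex_inner)"
  by (metis cinner_diff_left cinner_eq_zero_self diff_self eq_iff_diff_eq_0)

text \<open>Families rather than sets, because both sequences of singular vectors and sets of eigenvectors
(as the family \<open>\<lambda>w. w\<close>) occur.\<close>

definition orthonormal :: "'i set \<Rightarrow> ('i \<Rightarrow> 'a::complex_inner) \<Rightarrow> bool"
  where "orthonormal I e \<longleftrightarrow> (\<forall>i\<in>I. \<forall>j\<in>I. cinner (e i) (e j) = (if i = j then 1 else 0))"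

lemma orthonormal_subset: "orthonormal I e \<Longrightarrow> J \<subseteq> I \<Longrightarrow> orthonormal J e"
  unfolding orthonormal_def by blast

lemma orthonormalD: "orthonormal I e \<Longrightarrow> i \<in> I \<Longrightarrow> j \<in> I \<Longrightarrow> cinner (e i) (e j) = (if i = j then 1 else 0)"
  unfolding orthonormal_def by blast

lemma orthonormal_norm: "orthonormal I e \<Longrightarrow> i \<in> I \<Longrightarrow> norm (e i) = 1"
  using cinner_self[of "e i"] orthonormalD[of I e i i]
  by (metis norm_ge_zero of_real_eq_1_iff power2_eq_1_iff neg_0_le_iff_le not_one_le_zero)

lemma cinner_orthonormal_sum:
  assumes "orthonormal I e" "finite J" "J \<subseteq> I" "i \<in> I"
  shows "cinner (\<Sum>j\<in>J. c j *\<^sub>C e j) (e i) = (if i \<in> J then c i else 0)"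
proof -
  have "cinner (\<Sum>j\<in>J. c j *\<^sub>C e j) (e i) = (\<Sum>j\<in>J. if j = i then c j else 0)"
    unfolding cinner_sum_left
    by (rule sum.cong) (use assms in \<open>auto simp: cinner_simps orthonormalD[OF assms(1)] subset_iff\<close>)
  then show ?thesis using assms(2) by (simp add: sum.delta)
qed

lemma norm_orthonormal_sum:
  assumes "orthonormal I e" "finite I"
  shows "(norm (\<Sum>i\<in>I. c i *\<^sub>C e i))\<^sup>2 = (\<Sum>i\<in>I. (cmod (c i))\<^sup>2)"
proof -
  have "cinner (\<Sum>i\<in>I. c i *\<^sub>C e i) (\<Sum>i\<in>I. c i *\<^sub>C e i) = (\<Sum>i\<in>I. of_real ((cmod (c i))\<^sup>2))"
    unfolding cinner_sum_right
    by (rule sum.cong)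
       (simp_all add: cinner_scaleC_right cinner_orthonormal_sum[OF assms(1) assms(2) order_refl]
        complex_norm_square[symmetric] mult.commute[of "cnj _"])
  then show ?thesis unfolding norm_eq_Re_cinner by simp
qed

lemma norm_minus_orthonormal_expansion:
  assumes "orthonormal I e" "finite I"
  shows "(norm (x - (\<Sum>i\<in>I. cinner x (e i) *\<^sub>C e i)))\<^sup>2 = (norm x)\<^sup>2 - (\<Sum>i\<in>I. (cmod (cinner x (e i)))\<^sup>2)"
proof -
  define y where "y = (\<Sum>i\<in>I. cinner x (e i) *\<^sub>C e i)"
  have xy: "cinner x y = of_real (\<Sum>i\<in>I. (cmod (cinner x (e i)))\<^sup>2)"
    unfolding y_def cinner_sum_right of_real_sum
    by (rule sum.cong) (simp_all add: cinner_simps complex_norm_square[symmetric] mult.commute[of "cnj _"])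
  have "cinner y x = cnj (cinner x y)" by (rule cinner_commute)
  then have yx: "cinner y x = of_real (\<Sum>i\<in>I. (cmod (cinner x (e i)))\<^sup>2)" unfolding xy by simp
  have yy: "(norm y)\<^sup>2 = (\<Sum>i\<in>I. (cmod (cinner x (e i)))\<^sup>2)"
    unfolding y_def by (rule norm_orthonormal_sum[OF assms])
  have "(norm (x - y))\<^sup>2 = (norm x)\<^sup>2 - (\<Sum>i\<in>I. (cmod (cinner x (e i)))\<^sup>2)"
    unfolding norm_eq_Re_cinner[of "x - y"] cinner_diff_left cinner_diff_right xy yx
    unfolding cinner_self yy by simp
  then show ?thesis by (simp add: y_def)
qed

lemma bessel:
  assumes "orthonormal I e" "finite I"
  shows "(\<Sum>i\<in>I. (cmod (cinner x (e i)))\<^sup>2) \<le> (norm x)\<^sup>2"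
  using norm_minus_orthonormal_expansion[OF assms, of x] zero_le_power2[of "norm (x - (\<Sum>i\<in>I. cinner x (e i) *\<^sub>C e i))"]
  by linarith

lemma orthonormal_expansion_orth:
  assumes "orthonormal I e" "finite I" "i \<in> I"
  shows "cinner (x - (\<Sum>i\<in>I. cinner x (e i) *\<^sub>C e i)) (e i) = 0"
  by (simp add: cinner_diff_left cinner_orthonormal_sum[OF assms(1,2) order_refl assms(3)] assms)

lemma bounded_clinearD:
  assumes "bounded_clinear T"
  shows "T (x + y) = T x + T y" "T (a *\<^sub>C x) = a *\<^sub>C T x" "T (x - y) = T x - T y" "T 0 = 0"
    "T (- x) = - T x" "T (r *\<^sub>R x) = r *\<^sub>R T x"
    "bounded_linear T"
    "T (\<Sum>i\<in>I. f i) = (\<Sum>i\<in>I. T (f i))"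
proof -
  interpret T: Vector_Spaces.linear scaleC scaleC T using assms by (simp add: bounded_clinear_def)
  show "T (x + y) = T x + T y" "T (a *\<^sub>C x) = a *\<^sub>C T x" "T (x - y) = T x - T y" "T 0 = 0" "T (- x) = - T x"
    "T (\<Sum>i\<in>I. f i) = (\<Sum>i\<in>I. T (f i))"
    by (auto simp: T.add T.scale T.diff T.neg T.sum)
  show "T (r *\<^sub>R x) = r *\<^sub>R T x" by (simp add: scaleR_scaleC T.scale)
  show "bounded_linear T" using assms by (simp add: bounded_clinear_def)
qed

lemma clinear_iff: "clinear T \<longleftrightarrow> (\<forall>x y. T (x + y) = T x + T y) \<and> (\<forall>a x. T (a *\<^sub>C x) = a *\<^sub>C T x)"
  by (simp add: Vector_Spaces.linear_iff complex_vector.vector_space_axioms)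

lemma bounded_clinearI:
  assumes "\<And>x y. T (x + y) = T x + T y" "\<And>a x. T (a *\<^sub>C x) = a *\<^sub>C T x" "\<And>x. norm (T x) \<le> K * norm x"
  shows "bounded_clinear T"
  unfolding bounded_clinear_def
proof
  show "clinear T" using assms by (simp add: clinear_iff)
  show "bounded_linear T"
    by (rule bounded_linear_intro[of _ K]) (use assms in \<open>auto simp: scaleR_scaleC mult.commute\<close>)
qed

lemma bounded_clinear_bound:
  assumes "bounded_clinear T"
  obtains K where "K > 0" "\<And>x. norm (T x) \<le> K * norm x"
  using bounded_linear.pos_bounded[OF bounded_clinearD(7)[OF assms]] by (auto simp: mult.commute)

lemma compact_operator_bounded_clinear:
  fixes T :: "'a::complex_inner \<Rightarrow> 'b::complex_inner"
  assumes "compact_operator T" shows "bounded_clinear T"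
proof -
  have lin: "clinear T" using assms by (simp add: compact_operator_def)
  then have T: "T (x + y) = T x + T y" "T (a *\<^sub>C x) = a *\<^sub>C T x" for x y a by (auto simp: clinear_iff)
  have "compact (closure (T ` cball 0 1))" using assms by (simp add: compact_operator_def)
  then have "bounded (T ` cball 0 1)"
    by (rule bounded_subset[OF compact_imp_bounded closure_subset])
  then obtain K where "\<forall>y \<in> T ` cball 0 1. norm y \<le> K"
    unfolding bounded_iff ..
  then have K: "norm x \<le> 1 \<Longrightarrow> norm (T x) \<le> K" for x by simp
  have "norm (T x) \<le> K * norm x" for x
  proof (cases "x = 0")
    case True
    then show ?thesis using T(2)[of 0 0] by simp
  next
    case False
    have "norm (T ((1 / norm x) *\<^sub>R x)) \<le> K" by (rule K) simp
    moreover have "T ((1 / norm x) *\<^sub>R x) = of_real (1 / norm x) *\<^sub>C T x"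
      unfolding scaleR_scaleC T(2) ..
    ultimately show ?thesis using False by (simp add: field_simps norm_divide)
  qed
  then show ?thesis using T by (intro bounded_clinearI[of _ K])
qed

lemma compact_operator_subseq:
  fixes T :: "'a::complex_inner \<Rightarrow> 'b::complex_inner"
  assumes "compact_operator T" "\<And>n. norm (x n) \<le> K"
  obtains r l where "strict_mono (r :: nat \<Rightarrow> nat)" "(\<lambda>n. T (x (r n))) \<longlonglongrightarrow> l"
proof -
  have "bounded (range x)" using assms(2) by (auto simp: bounded_iff)
  then have "compact (closure (T ` range x))" using assms(1) by (simp add: compact_operator_def)
  moreover have "\<forall>n. T (x n) \<in> closure (T ` range x)"
    using closure_subset[of "T ` range x"] by auto
  ultimately have "\<exists>l\<in>closure (T ` range x). \<exists>r. strict_mono r \<and> ((\<lambda>n. T (x n)) \<circ> r) \<longlonglongrightarrow> l"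
    unfolding compact_def by simp
  then show ?thesis using that by (auto simp: o_def)
qed

text \<open>A sequence in the closure of \<open>T ` S\<close> is followed by images of points of \<open>S\<close> up to an error that tends
to zero, so it is enough to extract subsequences from sequences of images.\<close>

lemma compact_operatorI:
  fixes T :: "'a::complex_inner \<Rightarrow> 'b::complex_inner"
  assumes "clinear T"
    and sub: "\<And>x K. (\<And>n. norm (x n) \<le> K) \<Longrightarrow> \<exists>r l. strict_mono (r :: nat \<Rightarrow> nat) \<and> (\<lambda>n. T (x (r n))) \<longlonglongrightarrow> l"
  shows "compact_operator T"
  unfolding compact_operator_def
proof (intro conjI allI impI)
  show "clinear T" by fact
  fix S :: "'a set" assume "bounded S"
  then obtain K where K: "\<And>x. x \<in> S \<Longrightarrow> norm x \<le> K" by (auto simp: bounded_iff)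
  show "compact (closure (T ` S))"
    unfolding compact_def
  proof (intro allI impI)
    fix y :: "nat \<Rightarrow> 'b" assume y: "\<forall>n. y n \<in> closure (T ` S)"
    have ex: "\<exists>x. x \<in> S \<and> dist (T x) (y n) < inverse (real (Suc n))" for n
    proof -
      have "\<exists>z\<in>T ` S. dist z (y n) < inverse (real (Suc n))"
        using y by (simp only: closure_approachable inverse_positive_iff_positive of_nat_0_less_iff zero_less_Suc)
      then show ?thesis by blast
    qed
    from choice[OF allI[OF ex]] obtain x
      where "\<forall>n. x n \<in> S \<and> dist (T (x n)) (y n) < inverse (real (Suc n))" ..
    then have x: "x n \<in> S" "dist (T (x n)) (y n) < inverse (real (Suc n))" for n by simp_all
    obtain r l where r: "strict_mono (r :: nat \<Rightarrow> nat)" and l: "(\<lambda>n. T (x (r n))) \<longlonglongrightarrow> l"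
      using sub[of x K, OF K[OF x(1)]] by blast
    have "(\<lambda>n. dist (T (x n)) (y n)) \<longlonglongrightarrow> 0"
      by (rule tendsto_sandwich[OF _ _ tendsto_const LIMSEQ_inverse_real_of_nat])
         (intro always_eventually allI zero_le_dist less_imp_le x(2))+
    then have "((\<lambda>n. dist (T (x n)) (y n)) \<circ> r) \<longlonglongrightarrow> 0" using r by (rule LIMSEQ_subseq_LIMSEQ)
    then have "(\<lambda>n. T (x (r n)) - y (r n)) \<longlonglongrightarrow> 0"
      by (intro tendsto_norm_zero_cancel[of "\<lambda>n. T (x (r n)) - y (r n)"]) (simp add: dist_norm o_def)
    then have "(\<lambda>n. T (x (r n)) - (T (x (r n)) - y (r n))) \<longlonglongrightarrow> l - 0"
      using l by (intro tendsto_diff)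
    then have "(y \<circ> r) \<longlonglongrightarrow> l" by (simp add: o_def)
    moreover from this have "l \<in> closure (T ` S)"
      by (intro closed_sequentially[OF closed_closure, of "y \<circ> r" "T ` S" l]) (simp_all only: o_apply y)
    ultimately show "\<exists>l\<in>closure (T ` S). \<exists>r. strict_mono r \<and> (y \<circ> r) \<longlonglongrightarrow> l"
      using r by (intro bexI[of _ l] exI[of _ r]) simp_all
  qed
qed

section \<open>Adjoints, and vectors at which the norm is attained\<close>

text \<open>A sequence in \<open>M\<close> that minimises the distance to \<open>x\<close> is Cauchy by the parallelogram law, and
minimality of its limit forces orthogonality: subtracting the component along a unit vector of \<open>M\<close>
would bring \<open>x\<close> closer to \<open>M\<close>.\<close>

lemma closed_subspace_projection:
  fixes M :: "'a::chilbert_space set"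
  assumes sub: "complex_vector.subspace M" and cl: "closed M"
  obtains m where "m \<in> M" "\<And>u. u \<in> M \<Longrightarrow> cinner (x - m) u = 0"
proof -
  have M0: "0 \<in> M" and Madd: "\<And>u v. u \<in> M \<Longrightarrow> v \<in> M \<Longrightarrow> u + v \<in> M"
    and Msc: "\<And>c u. u \<in> M \<Longrightarrow> c *\<^sub>C u \<in> M"
    using sub by (auto simp: complex_vector.subspace_def)
  define d where "d = Inf ((\<lambda>m. norm (x - m)) ` M)"
  have bdd: "bdd_below ((\<lambda>m. norm (x - m)) ` M)" by (intro bdd_belowI[of _ 0]) auto
  have d_le: "d \<le> norm (x - u)" if "u \<in> M" for u
    unfolding d_def by (rule cInf_lower[OF _ bdd]) (use that in auto)
  have d0: "0 \<le> d"
    unfolding d_def by (rule cInf_greatest) (use M0 in auto)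
  have "\<exists>u. u \<in> M \<and> norm (x - u) < d + inverse (real (Suc n))" for n
  proof -
    have "d < d + inverse (real (Suc n))" by simp
    then show ?thesis
      using cInf_lessD[of "(\<lambda>m. norm (x - m)) ` M" "d + inverse (real (Suc n))"] M0
      by (auto simp: d_def)
  qed
  then have "\<forall>n. \<exists>u. u \<in> M \<and> norm (x - u) < d + inverse (real (Suc n))" ..
  from choice[OF this] obtain m where "\<forall>n. m n \<in> M \<and> norm (x - m n) < d + inverse (real (Suc n))" ..
  then have m: "m n \<in> M" "norm (x - m n) \<le> d + inverse (real (Suc n))" for n by (simp_all add: less_imp_le)
  have lim: "(\<lambda>n. norm (x - m n)) \<longlonglongrightarrow> d"
  proof (rule tendsto_sandwich[OF _ _ tendsto_const])
    show "(\<lambda>n. d + inverse (real (Suc n))) \<longlonglongrightarrow> d"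
      using tendsto_add[OF tendsto_const[of d] LIMSEQ_inverse_real_of_nat] by simp
  qed (intro always_eventually allI d_le m)+
  have par: "(norm (m i - m j))\<^sup>2 \<le> 2 * ((norm (x - m i))\<^sup>2 - d\<^sup>2) + 2 * ((norm (x - m j))\<^sup>2 - d\<^sup>2)" for i j
  proof -
    let ?h = "(1/2 :: complex) *\<^sub>C (m i + m j)"
    have h: "?h \<in> M" by (intro Msc Madd m)
    have heq: "?h = (1/2 :: real) *\<^sub>R (m i + m j)" by (simp add: scaleR_scaleC)
    have "d\<^sup>2 \<le> (norm (x - ?h))\<^sup>2" by (intro power_mono d_le h d0)
    moreover have "(norm (m i - m j))\<^sup>2 + 4 * (norm (x - ?h))\<^sup>2 = 2 * (norm (x - m i))\<^sup>2 + 2 * (norm (x - m j))\<^sup>2"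
      unfolding heq power2_norm_eq_inner
      by (simp add: inner_diff_left inner_diff_right inner_add_left inner_add_right inner_commute algebra_simps)
    ultimately show ?thesis by simp
  qed
  have "Cauchy m"
  proof (rule CauchyI)
    fix e :: real assume e: "e > 0"
    have "(\<lambda>n. (norm (x - m n))\<^sup>2 - d\<^sup>2) \<longlonglongrightarrow> d\<^sup>2 - d\<^sup>2" by (intro tendsto_intros lim)
    then have "\<forall>\<^sub>F n in sequentially. (norm (x - m n))\<^sup>2 - d\<^sup>2 < e\<^sup>2 / 4"
      by (rule order_tendstoD(2)) (use e in simp)
    then obtain N where N: "\<And>n. n \<ge> N \<Longrightarrow> (norm (x - m n))\<^sup>2 - d\<^sup>2 < e\<^sup>2 / 4"
      by (auto simp: eventually_sequentially)
    have "norm (m i - m j) < e" if "i \<ge> N" "j \<ge> N" for i j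
    proof -
      have "(norm (m i - m j))\<^sup>2 < e\<^sup>2" using par[of i j] N[OF that(1)] N[OF that(2)] by simp
      then show ?thesis using e by (simp add: power_less_imp_less_base)
    qed
    then show "\<exists>N. \<forall>i\<ge>N. \<forall>j\<ge>N. norm (m i - m j) < e" by blast
  qed
  then obtain l where l: "m \<longlonglongrightarrow> l" by (auto simp: Cauchy_convergent_iff convergent_def)
  have lM: "l \<in> M" by (rule closed_sequentially[OF cl _ l]) (rule m)
  have nl: "norm (x - l) = d"
    by (rule LIMSEQ_unique[OF _ lim]) (intro tendsto_intros l)
  show ?thesis
  proof (rule that[OF lM])
    fix u assume u: "u \<in> M"
    show "cinner (x - l) u = 0"
    proof (cases "u = 0")
      case False
      define e where "e = inverse (complex_of_real (norm u)) *\<^sub>C u"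
      have eM: "e \<in> M" unfolding e_def by (intro Msc u)
      have ne: "norm e = 1" using False by (simp add: e_def norm_inverse)
      then have on: "orthonormal {()} (\<lambda>_. e)" by (simp add: orthonormal_def cinner_self)
      have "l + cinner (x - l) e *\<^sub>C e \<in> M" by (intro Madd lM Msc eM)
      then have "d \<le> norm (x - l - cinner (x - l) e *\<^sub>C e)" using d_le by (simp add: diff_diff_eq)
      then have "d\<^sup>2 \<le> (norm (x - l - cinner (x - l) e *\<^sub>C e))\<^sup>2" using d0 by (intro power_mono) auto
      also have "\<dots> = d\<^sup>2 - (cmod (cinner (x - l) e))\<^sup>2"
        using norm_minus_orthonormal_expansion[OF on, of "x - l"] by (simp add: nl)
      finally have "cinner (x - l) e = 0" by simp
      then show ?thesis using False by (simp add: e_def cinner_simps)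
    qed simp
  qed
qed

text \<open>A vector orthogonal to the kernel represents the functional, up to a scalar.\<close>

lemma riesz_representation:
  fixes f :: "'a::chilbert_space \<Rightarrow> complex"
  assumes add: "\<And>x y. f (x + y) = f x + f y" and sc: "\<And>c x. f (c *\<^sub>C x) = c * f x"
    and bd: "\<And>x. cmod (f x) \<le> K * norm x"
  obtains y where "\<And>x. f x = cinner x y"
proof (cases "\<forall>x. f x = 0")
  case True
  then show ?thesis using that[of 0] by simp
next
  case False
  then obtain x0 where x0: "f x0 \<noteq> 0" by blast
  have diff: "f (x - y) = f x - f y" for x y
    using add[of "x - y" y] by simp
  have bl: "bounded_linear f"
    by (rule bounded_linear_intro[of _ K])
       (auto simp: add scaleR_scaleC sc scaleR_conv_of_real mult.commute bd)
  have f0: "f 0 = 0" using sc[of 0 0] by simp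
  let ?M = "{x. f x = 0}"
  have "complex_vector.subspace ?M" by (auto simp: complex_vector.subspace_def add sc f0)
  moreover have "closed ?M"
    by (intro closed_Collect_eq continuous_intros linear_continuous_on bl)
  ultimately obtain m where m: "f m = 0" "\<And>u. f u = 0 \<Longrightarrow> cinner (x0 - m) u = 0"
    using closed_subspace_projection[of ?M x0] by auto
  define w where "w = x0 - m"
  have fw: "f w \<noteq> 0" using x0 m(1) by (simp add: w_def diff)
  then have w0: "w \<noteq> 0" using f0 by auto
  define y where "y = (cnj (f w) / of_real ((norm w)\<^sup>2)) *\<^sub>C w"
  have "f x = cinner x y" for x
  proof -
    have "f (x - (f x / f w) *\<^sub>C w) = 0" using fw by (simp add: diff sc)
    then have "cinner w (x - (f x / f w) *\<^sub>C w) = 0" using m(2) by (simp add: w_def)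
    then have "cinner (x - (f x / f w) *\<^sub>C w) w = 0" by (metis cinner_commute complex_cnj_zero)
    then have "cinner x w = (f x / f w) * of_real ((norm w)\<^sup>2)"
      by (simp add: cinner_simps cinner_self)
    then show ?thesis using fw w0 by (simp add: y_def cinner_simps)
  qed
  then show ?thesis by (rule that)
qed

lemma cinner_cadjoint:
  fixes T :: "'a::chilbert_space \<Rightarrow> 'b::complex_inner"
  assumes T: "bounded_clinear T"
  shows "cinner (T x) y = cinner x (cadjoint T y)"
proof -
  obtain K where K: "K > 0" "\<And>x. norm (T x) \<le> K * norm x" using bounded_clinear_bound[OF T] by blast
  have "\<exists>z. \<forall>x. cinner (T x) y = cinner x z" for y
  proof -
    have bd: "cmod (cinner (T x) y) \<le> (K * norm y) * norm x" for x
    proof -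
      have "cmod (cinner (T x) y) \<le> norm (T x) * norm y" by (rule cmod_cinner_le)
      also have "\<dots> \<le> K * norm x * norm y" by (intro mult_right_mono K) auto
      finally show ?thesis by (simp add: mult_ac)
    qed
    show ?thesis
      by (rule riesz_representation[of "\<lambda>x. cinner (T x) y", OF _ _ bd])
         (auto simp: bounded_clinearD[OF T] cinner_simps)
  qed
  then have "\<forall>y. \<exists>z. \<forall>x. cinner (T x) y = cinner x z" ..
  from choice[OF this] obtain T' where T': "\<forall>y x. cinner (T x) y = cinner x (T' y)" ..
  have "\<forall>x y. cinner (T x) y = cinner x (cadjoint T y)"
    unfolding cadjoint_def
  proof (rule theI[of _ T'])
    show "\<forall>x y. cinner (T x) y = cinner x (T' y)" using T' by simp
    fix S assume S: "\<forall>x y. cinner (T x) y = cinner x (S y)"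
    show "S = T'"
    proof
      fix y show "S y = T' y"
      proof (rule cinner_ext)
        fix z
        have "cinner z (S y) = cinner z (T' y)" using S T' by metis
        then show "cinner (S y) z = cinner (T' y) z" by (simp only: cinner_commute[of _ z])
      qed
    qed
  qed
  then show ?thesis by blast
qed

lemma cinner_cadjoint':
  fixes T :: "'a::chilbert_space \<Rightarrow> 'b::complex_inner"
  assumes T: "bounded_clinear T"
  shows "cinner (cadjoint T y) x = cinner y (T x)"
  by (metis cinner_cadjoint[OF T] cinner_commute)

lemma bounded_clinear_cadjoint:
  fixes T :: "'a::chilbert_space \<Rightarrow> 'b::complex_inner"
  assumes T: "bounded_clinear T"
  shows "bounded_clinear (cadjoint T)"
proof -
  obtain K where K: "K > 0" "\<And>x. norm (T x) \<le> K * norm x" using bounded_clinear_bound[OF T] by blast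
  show ?thesis
  proof (rule bounded_clinearI[of _ K])
    fix x
    show "norm (cadjoint T x) \<le> K * norm x"
    proof (cases "cadjoint T x = 0")
      case False
      have "(norm (cadjoint T x))\<^sup>2 = Re (cinner x (T (cadjoint T x)))"
        by (simp add: norm_eq_Re_cinner cinner_cadjoint'[OF T])
      also have "\<dots> \<le> norm x * norm (T (cadjoint T x))"
        using complex_Re_le_cmod cmod_cinner_le order_trans by blast
      also have "\<dots> \<le> norm x * (K * norm (cadjoint T x))" by (intro mult_left_mono K) auto
      finally show ?thesis using False by (simp add: power2_eq_square mult_ac)
    qed (use K in simp)
  qed (rule cinner_ext, simp add: cinner_simps cinner_cadjoint'[OF T])+
qed

text \<open>Let \<open>s\<close> be the norm of \<open>T\<close> on \<open>N\<close> and \<open>x\<^sub>n\<close> unit vectors of \<open>N\<close> with \<open>\<parallel>T x\<^sub>n\<parallel> \<rightarrow> s\<close>.  Since \<open>N\<close> is invariant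
under \<open>T\<^sup>* T\<close>, one has \<open>\<parallel>T\<^sup>* T x\<^sub>n\<parallel> \<le> s \<parallel>T x\<^sub>n\<parallel>\<close>, whence \<open>T\<^sup>* T x\<^sub>n - s\<^sup>2 x\<^sub>n \<rightarrow> 0\<close>.  Along a subsequence
\<open>T x\<^sub>n\<close> converges, hence so does \<open>x\<^sub>n\<close>, and its limit is the maximiser.\<close>

lemma compact_operator_attains_norm:
  fixes T :: "'a::chilbert_space \<Rightarrow> 'b::complex_inner"
  assumes comp: "compact_operator T"
    and sub: "complex_vector.subspace N" and cl: "closed N" and nz: "N \<noteq> {0}"
    and inv: "\<And>x. x \<in> N \<Longrightarrow> cadjoint T (T x) \<in> N"
  obtains e where "e \<in> N" "norm e = 1" "cadjoint T (T e) = (norm (T e))\<^sup>2 *\<^sub>R e"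
    "\<forall>x\<in>N. norm (T x) \<le> norm (T e) * norm x"
proof -
  have T: "bounded_clinear T" by (rule compact_operator_bounded_clinear[OF comp])
  obtain K where K: "K > 0" "\<And>x. norm (T x) \<le> K * norm x" using bounded_clinear_bound[OF T] by blast
  have N0: "0 \<in> N" and Nsc: "\<And>c u. u \<in> N \<Longrightarrow> c *\<^sub>C u \<in> N"
    using sub by (auto simp: complex_vector.subspace_def)
  define U where "U = {x \<in> N. norm x = 1}"
  have unit: "(1 / norm x) *\<^sub>R x \<in> U" if "x \<in> N" "x \<noteq> 0" for x
  proof -
    have "(1 / norm x) *\<^sub>R x \<in> N" unfolding scaleR_scaleC by (intro Nsc that)
    then show ?thesis using that by (simp add: U_def)
  qed
  obtain x1 where "x1 \<in> N" "x1 \<noteq> 0" using nz N0 by blast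
  then have Une: "U \<noteq> {}" using unit by blast
  define s where "s = Sup ((\<lambda>x. norm (T x)) ` U)"
  have bdd: "bdd_above ((\<lambda>x. norm (T x)) ` U)"
    using K(2) by (intro bdd_aboveI2[of _ _ K]) (metis (mono_tags, lifting) U_def mem_Collect_eq mult.right_neutral)
  have le1: "norm (T x) \<le> s" if "x \<in> U" for x
    unfolding s_def by (rule cSup_upper[OF _ bdd]) (use that in auto)
  have le: "norm (T x) \<le> s * norm x" if "x \<in> N" for x
  proof (cases "x = 0")
    case True then show ?thesis by (simp add: bounded_clinearD(4)[OF T])
  next
    case False
    have "norm (T ((1 / norm x) *\<^sub>R x)) \<le> s" by (intro le1 unit that False)
    then show ?thesis using False unfolding bounded_clinearD(6)[OF T] by (simp add: field_simps)
  qed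
  have s0: "s \<ge> 0" using le1 Une by (meson ex_in_conv norm_ge_zero order_trans)
  have "\<exists>x. x \<in> U \<and> s - inverse (real (Suc n)) < norm (T x)" for n
  proof -
    have "s - inverse (real (Suc n)) < s" by simp
    then show ?thesis
      using less_cSupE[of "s - inverse (real (Suc n))" "(\<lambda>x. norm (T x)) ` U"] Une
      by (auto simp: s_def)
  qed
  then have "\<forall>n. \<exists>x. x \<in> U \<and> s - inverse (real (Suc n)) < norm (T x)" ..
  from choice[OF this] obtain x where x': "\<forall>n. x n \<in> U \<and> s - inverse (real (Suc n)) < norm (T (x n))" ..
  then have x: "x n \<in> N" "norm (x n) = 1" "x n \<in> U" "s - inverse (real (Suc n)) \<le> norm (T (x n))" for n
    by (auto simp: U_def less_imp_le)
  have lim: "(\<lambda>n. norm (T (x n))) \<longlonglongrightarrow> s"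
  proof (rule tendsto_sandwich[OF _ _ _ tendsto_const])
    show "(\<lambda>n. s - inverse (real (Suc n))) \<longlonglongrightarrow> s"
      using tendsto_diff[OF tendsto_const[of s] LIMSEQ_inverse_real_of_nat] by simp
  qed (intro always_eventually allI le1 x)+
  show ?thesis
  proof (cases "s = 0")
    case True
    have "T (x 0) = 0" using le[OF x(1)[of 0]] True by simp
    then show ?thesis
      by (intro that[OF x(1,2)[of 0]])
         (use le True in \<open>simp_all add: bounded_clinearD(4)[OF bounded_clinear_cadjoint[OF T]]\<close>)
  next
    case False
    then have s: "s > 0" using s0 by simp
    let ?S = "cadjoint T"
    have S: "bounded_clinear ?S" by (rule bounded_clinear_cadjoint[OF T])
    obtain r l where r: "strict_mono r" and l: "(\<lambda>n. T (x (r n))) \<longlonglongrightarrow> l"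
      by (rule compact_operator_subseq[OF comp, of x 1]) (use x(2) in auto)
    have res: "(norm (?S (T (x n)) - s\<^sup>2 *\<^sub>R x n))\<^sup>2 \<le> s\<^sup>2 * (s\<^sup>2 - (norm (T (x n)))\<^sup>2)" for n
    proof -
      let ?y = "?S (T (x n))"
      have yx: "cinner ?y (x n) = of_real ((norm (T (x n)))\<^sup>2)"
        by (simp add: cinner_cadjoint'[OF T] cinner_self)
      then have xy: "cinner (x n) ?y = of_real ((norm (T (x n)))\<^sup>2)"
        by (metis cinner_commute complex_cnj_complex_of_real)
      have "(norm ?y)\<^sup>2 = Re (cinner (T (x n)) (T ?y))"
        by (simp add: norm_eq_Re_cinner cinner_cadjoint'[OF T])
      also have "\<dots> \<le> norm (T (x n)) * norm (T ?y)"
        using complex_Re_le_cmod cmod_cinner_le order_trans by blast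
      also have "\<dots> \<le> norm (T (x n)) * (s * norm ?y)" by (intro mult_left_mono le inv x) auto
      finally have "norm ?y \<le> s * norm (T (x n))"
        using s0 by (cases "?y = 0") (auto simp: power2_eq_square mult_ac)
      then have "(norm ?y)\<^sup>2 \<le> s\<^sup>2 * (norm (T (x n)))\<^sup>2"
        by (metis norm_ge_zero power_mono power_mult_distrib)
      moreover have "(norm (?y - s\<^sup>2 *\<^sub>R x n))\<^sup>2 = (norm ?y)\<^sup>2 - 2 * s\<^sup>2 * (norm (T (x n)))\<^sup>2 + s\<^sup>2 * s\<^sup>2"
        unfolding norm_eq_Re_cinner[of "_ - _"] cinner_diff_left cinner_diff_right cinner_scaleR_left cinner_scaleR_right xy yx
        unfolding cinner_self x(2) by (simp add: algebra_simps)
      ultimately show ?thesis by (simp add: algebra_simps)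
    qed
    have "(\<lambda>n. s\<^sup>2 * (s\<^sup>2 - (norm (T (x n)))\<^sup>2)) \<longlonglongrightarrow> s\<^sup>2 * (s\<^sup>2 - s\<^sup>2)" by (intro tendsto_intros lim)
    then have "(\<lambda>n. (norm (?S (T (x n)) - s\<^sup>2 *\<^sub>R x n))\<^sup>2) \<longlonglongrightarrow> 0"
      by (intro tendsto_sandwich[OF always_eventually[OF allI[OF zero_le_power2]] always_eventually[OF allI[OF res]] tendsto_const])
         simp
    then have "(\<lambda>n. norm (?S (T (x n)) - s\<^sup>2 *\<^sub>R x n)) \<longlonglongrightarrow> 0"
      using tendsto_real_sqrt[of "\<lambda>n. (norm (?S (T (x n)) - s\<^sup>2 *\<^sub>R x n))\<^sup>2" 0] by simp
    then have "(\<lambda>n. ?S (T (x n)) - s\<^sup>2 *\<^sub>R x n) \<longlonglongrightarrow> 0" by (rule tendsto_norm_zero_cancel)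
    from LIMSEQ_subseq_LIMSEQ[OF this r]
    have R: "(\<lambda>n. ?S (T (x (r n))) - s\<^sup>2 *\<^sub>R x (r n)) \<longlonglongrightarrow> 0" by (simp add: o_def)
    have Sl: "(\<lambda>n. ?S (T (x (r n)))) \<longlonglongrightarrow> ?S l"
      by (rule bounded_linear.tendsto[OF bounded_clinearD(7)[OF S] l])
    define e where "e = (1 / s\<^sup>2) *\<^sub>R ?S l"
    have "(\<lambda>n. (1 / s\<^sup>2) *\<^sub>R (?S (T (x (r n))) - (?S (T (x (r n))) - s\<^sup>2 *\<^sub>R x (r n)))) \<longlonglongrightarrow> (1 / s\<^sup>2) *\<^sub>R (?S l - 0)"
      by (intro tendsto_intros Sl R)
    then have xe: "(\<lambda>n. x (r n)) \<longlonglongrightarrow> e" using s by (simp add: e_def)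
    have eN: "e \<in> N" by (rule closed_sequentially[OF cl _ xe]) (rule x)
    have ne: "norm e = 1" using tendsto_norm[OF xe] by (simp add: x(2) LIMSEQ_const_iff)
    have Te: "(\<lambda>n. T (x (r n))) \<longlonglongrightarrow> T e"
      by (rule bounded_linear.tendsto[OF bounded_clinearD(7)[OF T] xe])
    have nTe: "norm (T e) = s"
      by (rule LIMSEQ_unique[OF tendsto_norm[OF Te]])
         (use LIMSEQ_subseq_LIMSEQ[OF lim r] in \<open>simp add: o_def\<close>)
    have "T e = l" by (rule LIMSEQ_unique[OF Te l])
    then have Sle: "?S (T e) = ?S l" by simp
    have "s\<^sup>2 *\<^sub>R e = ?S l" unfolding e_def using s by simp
    then have STe: "?S (T e) = (norm (T e))\<^sup>2 *\<^sub>R e" by (simp only: Sle nTe)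
    have leTe: "norm (T x) \<le> norm (T e) * norm x" if "x \<in> N" for x
      unfolding nTe by (rule le[OF that])
    show ?thesis by (rule that[OF eN ne STe]) (simp add: leTe)
  qed
qed

section \<open>Singular vectors and the absolute value\<close>

instance chilbert_space \<subseteq> banach ..

text \<open>Right singular vectors in order of decreasing singular value: the \<open>n\<close>-th vector maximises \<open>\<parallel>T x\<parallel>\<close> among
the unit vectors orthogonal to its predecessors.  In an infinite-dimensional space the sequence
never stops; when \<open>T\<close> has finite rank it ends with vectors in the kernel, and when \<open>T\<close> has infinite rank
it does not contain the kernel of \<open>T\<close> at all.\<close>

definition svd_basis :: "('a::complex_inner \<Rightarrow> 'b::complex_inner) \<Rightarrow> (nat \<Rightarrow> 'a) \<Rightarrow> bool"
  where "svd_basis T e \<longleftrightarrow> orthonormal UNIV e \<and>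
    (\<forall>k. cadjoint T (T (e k)) = (norm (T (e k)))\<^sup>2 *\<^sub>R e k) \<and>
    (\<forall>n x. (\<forall>k<n. cinner x (e k) = 0) \<longrightarrow> norm (T x) \<le> norm (T (e n)) * norm x)"

lemma subspace_orthogonal: "complex_vector.subspace {x. \<forall>y\<in>Y. cinner x (y :: 'a::complex_inner) = 0}"
  by (auto simp: complex_vector.subspace_def cinner_simps)

lemma closed_orthogonal: "closed {x. \<forall>y\<in>Y. cinner x (y :: 'a::complex_inner) = 0}"
proof -
  have "{x. \<forall>y\<in>Y. cinner x y = 0} = (\<Inter>y\<in>Y. {x. cinner x y = 0})" by auto
  also have "closed \<dots>"
    by (intro closed_INT ballI closed_Collect_eq continuous_intros linear_continuous_on bounded_linear_cinner_left)
  finally show ?thesis .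
qed

lemma orthogonal_vector_exists:
  assumes "infinite_dimensional TYPE('a::complex_inner)" "orthonormal {..<n} (e :: nat \<Rightarrow> 'a)"
  obtains x where "x \<noteq> 0" "\<And>k. k < n \<Longrightarrow> cinner x (e k) = 0"
proof -
  have "cspan (e ` {..<n}) \<noteq> UNIV"
    using assms(1) by (metis infinite_dimensional_def finite_imageI finite_lessThan)
  then obtain x where x: "x \<notin> cspan (e ` {..<n})" by blast
  let ?p = "\<Sum>i<n. cinner x (e i) *\<^sub>C e i"
  have "?p \<in> cspan (e ` {..<n})"
    by (intro complex_vector.span_sum complex_vector.span_scale complex_vector.span_base imageI)
  then have "x - ?p \<noteq> 0" using x by auto
  moreover have "cinner (x - ?p) (e k) = 0" if "k < n" for k
    by (rule orthonormal_expansion_orth[OF assms(2)]) (use that in auto)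
  ultimately show ?thesis by (rule that)
qed

lemma svd_basis_exists:
  fixes T :: "'a::chilbert_space \<Rightarrow> 'b::complex_inner"
  assumes comp: "compact_operator T" and inf: "infinite_dimensional TYPE('a)"
  obtains e where "svd_basis T e"
proof -
  have T: "bounded_clinear T" by (rule compact_operator_bounded_clinear[OF comp])
  define P where "P f n v \<longleftrightarrow> (\<forall>k<n. cinner v (f k) = 0) \<and> norm v = 1 \<and>
      cadjoint T (T v) = (norm (T v))\<^sup>2 *\<^sub>R v \<and>
      (\<forall>x. (\<forall>k<n. cinner x (f k) = 0) \<longrightarrow> norm (T x) \<le> norm (T v) * norm x)"
    for f :: "nat \<Rightarrow> 'a" and n :: nat and v :: 'a
  have orth: "orthonormal {..<n} f" if "\<And>k. k < n \<Longrightarrow> P f k (f k)" for f n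
    unfolding orthonormal_def
  proof (intro ballI)
    fix i j assume ij: "i \<in> {..<n}" "j \<in> {..<n}"
    consider "i = j" | "j < i" | "i < j" by linarith
    then show "cinner (f i) (f j) = (if i = j then 1 else 0)"
    proof cases
      case 1
      then show ?thesis using that[of i] ij by (simp add: P_def cinner_self)
    next
      case 2
      then show ?thesis using that[of i] ij by (simp add: P_def)
    next
      case 3
      then have "cinner (f j) (f i) = 0" using that[of j] ij by (simp add: P_def)
      then show ?thesis using 3 by (simp add: cinner_commute[of "f i"])
    qed
  qed
  have "\<exists>f. \<forall>n. P f n (f n)"
  proof (rule dependent_wellorder_choice)
    show "P f n v = P g n v" if "\<And>k. k < n \<Longrightarrow> f k = g k" for v f g n
      using that by (simp add: P_def)
    fix n f assume hyp: "\<And>k. k < n \<Longrightarrow> P f k (f k)"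
    have on: "orthonormal {..<n} f" by (rule orth[OF hyp])
    let ?N = "{x. \<forall>y\<in>f ` {..<n}. cinner x y = 0}"
    have ne: "?N \<noteq> {0}"
    proof -
      obtain x where "x \<noteq> 0" "\<And>k. k < n \<Longrightarrow> cinner x (f k) = 0"
        by (rule orthogonal_vector_exists[OF inf on]) blast
      then have "x \<in> ?N" "x \<noteq> 0" by auto
      then show ?thesis by blast
    qed
    have inv: "cadjoint T (T x) \<in> ?N" if "x \<in> ?N" for x
    proof -
      have "cinner (cadjoint T (T x)) (f k) = 0" if "k < n" for k
      proof -
        have "cinner (cadjoint T (T x)) (f k) = cinner x (cadjoint T (T (f k)))"
          by (simp add: cinner_cadjoint[OF T] cinner_cadjoint'[OF T])
        also have "\<dots> = of_real ((norm (T (f k)))\<^sup>2) * cinner x (f k)"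
          using hyp[OF that] by (simp add: P_def cinner_scaleR_right)
        finally show ?thesis using \<open>x \<in> ?N\<close> that by simp
      qed
      then show ?thesis by auto
    qed
    obtain e where e: "e \<in> ?N" "norm e = 1" "cadjoint T (T e) = (norm (T e))\<^sup>2 *\<^sub>R e"
        "\<forall>x\<in>?N. norm (T x) \<le> norm (T e) * norm x"
      by (rule compact_operator_attains_norm[OF comp subspace_orthogonal closed_orthogonal ne inv])
    have "P f n e" unfolding P_def
    proof (intro conjI allI impI e(2,3))
      show "cinner e (f k) = 0" if "k < n" for k using e(1) that by simp
      show "norm (T x) \<le> norm (T e) * norm x" if "\<forall>k<n. cinner x (f k) = 0" for x
        by (rule e(4)[rule_format]) (use that in simp)
    qed
    then show "\<exists>v. P f n v" ..
  qed
  then obtain f where f: "\<And>n. P f n (f n)" by blast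
  have "orthonormal UNIV f"
    unfolding orthonormal_def
  proof (intro ballI)
    fix i j
    show "cinner (f i) (f j) = (if i = j then 1 else 0)"
      by (rule orthonormalD[OF orth[of "Suc (i + j)"]]) (simp_all add: f)
  qed
  then have "svd_basis T f" using f by (simp add: svd_basis_def P_def)
  then show ?thesis by (rule that)
qed

context
  fixes T :: "'a::chilbert_space \<Rightarrow> 'b::complex_inner" and e :: "nat \<Rightarrow> 'a"
  assumes comp: "compact_operator T" and svd: "svd_basis T e"
begin

lemma svd_bounded: "bounded_clinear T" by (rule compact_operator_bounded_clinear[OF comp])

lemma svd_orthonormal: "orthonormal I e"
  using svd orthonormal_subset[of UNIV e I] by (simp add: svd_basis_def)

lemma svd_le: "(\<And>k. k < n \<Longrightarrow> cinner x (e k) = 0) \<Longrightarrow> norm (T x) \<le> norm (T (e n)) * norm x"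
  using svd by (simp add: svd_basis_def)

lemma svd_eigen: "cadjoint T (T (e k)) = (norm (T (e k)))\<^sup>2 *\<^sub>R e k"
  using svd by (simp add: svd_basis_def)

lemma svd_cinner_image: "cinner (T (e i)) (T (e j)) = (if i = j then of_real ((norm (T (e i)))\<^sup>2) else 0)"
proof (cases "i = j")
  case False
  have "cinner (T (e i)) (T (e j)) = cinner (cadjoint T (T (e i))) (e j)"
    by (simp add: cinner_cadjoint'[OF svd_bounded])
  also have "\<dots> = 0"
    unfolding svd_eigen cinner_scaleR_left using False
    by (simp add: orthonormalD[OF svd_orthonormal[of UNIV]])
  finally show ?thesis using False by simp
qed (simp add: cinner_self)

lemma svd_decseq: "decseq (\<lambda>k. norm (T (e k)))"
proof (rule decseq_SucI)
  fix n
  have "norm (T (e (Suc n))) \<le> norm (T (e n)) * norm (e (Suc n))"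
    by (rule svd_le) (simp add: orthonormalD[OF svd_orthonormal[of UNIV]])
  then show "norm (T (e (Suc n))) \<le> norm (T (e n))"
    by (simp add: orthonormal_norm[OF svd_orthonormal[of UNIV]])
qed

text \<open>The images \<open>T (e k)\<close> are pairwise orthogonal, so a limit \<open>L > 0\<close> of their norms would keep them at
distance at least \<open>L\<close> from one another, against compactness.\<close>

lemma svd_tendsto_0: "(\<lambda>k. norm (T (e k))) \<longlonglongrightarrow> 0"
proof -
  obtain L where L: "(\<lambda>k. norm (T (e k))) \<longlonglongrightarrow> L" "\<And>k. L \<le> norm (T (e k))"
    by (rule decseq_convergent[OF svd_decseq, of 0]) auto
  obtain r l where r: "strict_mono (r :: nat \<Rightarrow> nat)" and l: "(\<lambda>n. T (e (r n))) \<longlonglongrightarrow> l"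
    by (rule compact_operator_subseq[OF comp, of e 1])
       (auto simp: orthonormal_norm[OF svd_orthonormal[of UNIV]])
  have "(\<lambda>n. T (e (r n)) - T (e (r (Suc n)))) \<longlonglongrightarrow> l - l"
    by (intro tendsto_diff l LIMSEQ_Suc[of "\<lambda>n. T (e (r n))"])
  then have lim: "(\<lambda>n. norm (T (e (r n)) - T (e (r (Suc n))))) \<longlonglongrightarrow> 0" by (simp add: tendsto_norm_zero)
  have "L \<le> norm (T (e (r n)) - T (e (r (Suc n))))" for n
  proof -
    have ne: "r n \<noteq> r (Suc n)" using r by (metis lessI less_irrefl strict_mono_less)
    have "(norm (T (e (r n)) - T (e (r (Suc n)))))\<^sup>2 = (norm (T (e (r n))))\<^sup>2 + (norm (T (e (r (Suc n)))))\<^sup>2"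
      unfolding norm_eq_Re_cinner[of "_ - _"] cinner_diff_left cinner_diff_right svd_cinner_image
      using ne by simp
    then have "(norm (T (e (r n))))\<^sup>2 \<le> (norm (T (e (r n)) - T (e (r (Suc n)))))\<^sup>2" by simp
    then have "norm (T (e (r n))) \<le> norm (T (e (r n)) - T (e (r (Suc n))))"
      by (rule power2_le_imp_le) simp
    then show ?thesis using L(2)[of "r n"] by linarith
  qed
  then have "L \<le> 0" by (intro LIMSEQ_le_const[OF lim]) blast
  moreover have "0 \<le> L" by (rule LIMSEQ_le_const[OF L(1)]) simp
  ultimately show ?thesis using L(1) by simp
qed

lemma svd_remainder:
  "norm (T (x - (\<Sum>k<n. cinner x (e k) *\<^sub>C e k))) \<le> norm (T (e n)) * norm x"
proof -
  let ?y = "x - (\<Sum>k<n. cinner x (e k) *\<^sub>C e k)"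
  have "norm (T ?y) \<le> norm (T (e n)) * norm ?y"
    by (rule svd_le, rule orthonormal_expansion_orth[OF svd_orthonormal]) auto
  moreover have "norm ?y \<le> norm x"
  proof (rule power2_le_imp_le)
    show "(norm ?y)\<^sup>2 \<le> (norm x)\<^sup>2"
      unfolding norm_minus_orthonormal_expansion[OF svd_orthonormal finite_lessThan]
      by (simp add: sum_nonneg)
  qed simp
  ultimately show ?thesis by (meson mult_left_mono norm_ge_zero order_trans)
qed

lemma svd_remainder_tendsto:
  "(\<lambda>n. norm (T (x - (\<Sum>k<n. cinner x (e k) *\<^sub>C e k)))) \<longlonglongrightarrow> 0"
proof (rule tendsto_sandwich[OF always_eventually[OF allI[OF norm_ge_zero]] always_eventually[OF allI[OF svd_remainder]] tendsto_const])
  show "(\<lambda>n. norm (T (e n)) * norm x) \<longlonglongrightarrow> 0" by (intro tendsto_mult_left_zero svd_tendsto_0)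
qed

text \<open>The partial sums of \<open>\<Sum> cinner x (e k) e k\<close> need not converge to \<open>x\<close>, but \<open>T\<close> does not see the
difference in the limit.\<close>

lemma svd_expansion:
  "(\<lambda>n. \<Sum>k<n. cinner x (e k) *\<^sub>C T (e k)) \<longlonglongrightarrow> T x"
proof -
  have "(\<lambda>n. T (x - (\<Sum>k<n. cinner x (e k) *\<^sub>C e k))) \<longlonglongrightarrow> 0"
    by (rule tendsto_norm_zero_cancel[OF svd_remainder_tendsto])
  then have "(\<lambda>n. T x - T (x - (\<Sum>k<n. cinner x (e k) *\<^sub>C e k))) \<longlonglongrightarrow> T x - 0"
    by (intro tendsto_diff tendsto_const)
  then show ?thesis by (simp add: bounded_clinearD[OF svd_bounded])
qed

end

text \<open>Polarisation: the form is real at \<open>x + y\<close> and at \<open>x + \<i> y\<close>.\<close>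

lemma positive_operator_hermitian:
  assumes "positive_operator (P :: 'a::complex_inner \<Rightarrow> 'a)"
  shows "cinner (P x) y = cinner x (P y)"
proof -
  have P: "bounded_clinear P" and "\<And>x. cinner (P x) x \<in> \<real>\<^sub>\<ge>\<^sub>0" using assms by (auto simp: positive_operator_def)
  then have re: "Im (cinner (P x) x) = 0" for x by (simp add: complex_nonneg_Reals_iff)
  have 1: "Im (cinner (P x) y) = - Im (cinner (P y) x)"
    using re[of "x + y"] re[of x] re[of y] by (simp add: bounded_clinearD[OF P] cinner_simps)
  have "Im (cinner (P (x + \<i> *\<^sub>C y)) (x + \<i> *\<^sub>C y)) = 0" by (rule re)
  then have 2: "Re (cinner (P x) y) = Re (cinner (P y) x)"
    using re[of x] re[of y] by (simp add: bounded_clinearD[OF P] cinner_simps)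
  have "cinner (P x) y = cnj (cinner (P y) x)" using 1 2 by (simp add: complex_eq_iff)
  then show ?thesis by (metis cinner_commute)
qed

lemma positive_operator_Re_nonneg:
  "positive_operator P \<Longrightarrow> 0 \<le> Re (cinner (P x) x)"
  by (simp add: positive_operator_def complex_nonneg_Reals_iff)

text \<open>On \<open>v = P w - l w\<close> the operator \<open>P\<close> acts as \<open>- l\<close>, which positivity forbids unless \<open>l = 0\<close> or \<open>v = 0\<close>.\<close>

lemma positive_sqrt_eigenvector:
  fixes P :: "'a::complex_inner \<Rightarrow> 'a"
  assumes P: "positive_operator P" and PP: "P (P w) = l\<^sup>2 *\<^sub>R w" and l: "l \<ge> 0"
  shows "P w = l *\<^sub>R w"
proof (cases "l = 0")
  case True
  have "cinner (P w) (P w) = cinner w (P (P w))" by (rule positive_operator_hermitian[OF P])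
  then show ?thesis using True PP by (simp add: cinner_eq_zero_self)
next
  case False
  have lin: "bounded_clinear P" using P by (simp add: positive_operator_def)
  define v where "v = P w - l *\<^sub>R w"
  have "P v = - (l *\<^sub>R v)"
    by (simp add: v_def bounded_clinearD[OF lin] PP scaleR_diff_right power2_eq_square)
  then have "0 \<le> - (l * (norm v)\<^sup>2)"
    using positive_operator_Re_nonneg[OF P, of v] by (simp add: cinner_simps cinner_self)
  then have "v = 0" using l False by (simp add: mult_le_0_iff)
  then show ?thesis by (simp add: v_def)
qed

lemma positive_sqrt_norm:
  fixes P :: "'a::chilbert_space \<Rightarrow> 'a"
  assumes P: "positive_operator P" and T: "bounded_clinear T" and PP: "P \<circ> P = cadjoint T \<circ> T"
  shows "norm (P x) = norm (T x)"
proof -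
  have "cinner (P x) (P x) = cinner (P (P x)) x" by (simp add: positive_operator_hermitian[OF P])
  also have "\<dots> = cinner (T x) (T x)" using fun_cong[OF PP, of x] by (simp add: cinner_cadjoint'[OF T])
  finally have "(norm (P x))\<^sup>2 = (norm (T x))\<^sup>2" by (simp add: norm_eq_Re_cinner)
  then show ?thesis by simp
qed

text \<open>This determines \<open>P\<close>, which gives the uniqueness of the positive square root.  The reason is that
\<open>\<parallel>P x\<parallel> = \<parallel>T x\<parallel>\<close>, so that \<open>P\<close> and \<open>T\<close> neglect the same remainders.\<close>

lemma svd_positive_sqrt_expansion:
  fixes T :: "'a::chilbert_space \<Rightarrow> 'a"
  assumes comp: "compact_operator T" and svd: "svd_basis T e"
    and P: "positive_operator P" and PP: "P \<circ> P = cadjoint T \<circ> T"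
  shows "(\<lambda>n. \<Sum>k<n. cinner x (e k) *\<^sub>C norm (T (e k)) *\<^sub>R e k) \<longlonglongrightarrow> P x"
proof -
  have T: "bounded_clinear T" by (rule compact_operator_bounded_clinear[OF comp])
  have lin: "bounded_clinear P" using P by (simp add: positive_operator_def)
  have "P (P (e k)) = (norm (T (e k)))\<^sup>2 *\<^sub>R e k" for k
    using fun_cong[OF PP, of "e k"] svd_eigen[OF comp svd, of k] by simp
  then have Pe: "P (e k) = norm (T (e k)) *\<^sub>R e k" for k
    by (rule positive_sqrt_eigenvector[OF P]) simp
  have "(\<lambda>n. P (x - (\<Sum>k<n. cinner x (e k) *\<^sub>C e k))) \<longlonglongrightarrow> 0"
    by (rule tendsto_norm_zero_cancel)
       (use svd_remainder_tendsto[OF comp svd] in \<open>simp add: positive_sqrt_norm[OF P T PP]\<close>)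
  then have "(\<lambda>n. P x - P (x - (\<Sum>k<n. cinner x (e k) *\<^sub>C e k))) \<longlonglongrightarrow> P x - 0"
    by (intro tendsto_diff tendsto_const)
  then show ?thesis by (simp add: bounded_clinearD[OF lin] Pe)
qed

text \<open>The square root is the diagonal operator with eigenvalue \<open>\<parallel>T (e k)\<parallel>\<close> at \<open>e k\<close>, extended by zero.\<close>

lemma positive_sqrt_exists:
  fixes T :: "'a::chilbert_space \<Rightarrow> 'a"
  assumes comp: "compact_operator T" and svd: "svd_basis T e"
  obtains P where "positive_operator P" "P \<circ> P = cadjoint T \<circ> T"
proof -
  have T: "bounded_clinear T" by (rule compact_operator_bounded_clinear[OF comp])
  define s where "s k = norm (T (e k))" for k
  define f where "f x k = (cinner x (e k) * of_real (s k)) *\<^sub>C e k" for x k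
  have s0: "s k \<ge> 0" for k by (simp add: s_def)
  have dec: "s n \<le> s m" if "m \<le> n" for m n
    using svd_decseq[OF comp svd] that by (simp add: s_def decseq_def)
  have part: "norm (sum (f x) {m..<n}) \<le> s m * norm x" for x m n
  proof (rule power2_le_imp_le)
    have "(norm (sum (f x) {m..<n}))\<^sup>2 = (\<Sum>k\<in>{m..<n}. (cmod (cinner x (e k) * of_real (s k)))\<^sup>2)"
      unfolding f_def by (rule norm_orthonormal_sum[OF svd_orthonormal[OF comp svd]]) simp
    also have "\<dots> \<le> (\<Sum>k\<in>{m..<n}. (s m)\<^sup>2 * (cmod (cinner x (e k)))\<^sup>2)"
    proof (rule sum_mono)
      fix k assume "k \<in> {m..<n}"
      then have "(s k)\<^sup>2 \<le> (s m)\<^sup>2" using dec s0 by (intro power_mono) auto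
      then show "(cmod (cinner x (e k) * of_real (s k)))\<^sup>2 \<le> (s m)\<^sup>2 * (cmod (cinner x (e k)))\<^sup>2"
        using s0[of k] by (simp add: norm_mult power_mult_distrib mult.commute mult_right_mono)
    qed
    also have "\<dots> \<le> (s m)\<^sup>2 * (norm x)\<^sup>2"
      unfolding sum_distrib_left[symmetric]
      by (intro mult_left_mono bessel[OF svd_orthonormal[OF comp svd]]) auto
    finally show "(norm (sum (f x) {m..<n}))\<^sup>2 \<le> (s m * norm x)\<^sup>2" by (simp add: power_mult_distrib)
  qed (simp add: s0)
  have sm: "summable (f x)" for x
    unfolding summable_Cauchy
  proof (intro allI impI)
    fix \<epsilon> :: real assume "\<epsilon> > 0"
    moreover have "(\<lambda>k. s k * norm x) \<longlonglongrightarrow> 0"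
      unfolding s_def by (intro tendsto_mult_left_zero svd_tendsto_0[OF comp svd])
    ultimately have "\<forall>\<^sub>F k in sequentially. s k * norm x < \<epsilon>" by (intro order_tendstoD(2))
    then obtain N where "\<And>k. k \<ge> N \<Longrightarrow> s k * norm x < \<epsilon>" by (auto simp: eventually_sequentially)
    then show "\<exists>N. \<forall>m\<ge>N. \<forall>n. norm (sum (f x) {m..<n}) < \<epsilon>" using part le_less_trans by blast
  qed
  define Q where "Q x = suminf (f x)" for x
  have Qlim: "(\<lambda>n. \<Sum>k<n. f x k) \<longlonglongrightarrow> Q x" for x
    unfolding Q_def by (rule summable_LIMSEQ[OF sm])
  have Q: "bounded_clinear Q"
  proof (rule bounded_clinearI[of _ "s 0"])
    fix x y :: 'a and a :: complex
    have "f (x + y) = (\<lambda>k. f x k + f y k)"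
      by (simp add: f_def fun_eq_iff cinner_simps distrib_right scaleC_add_left)
    then show "Q (x + y) = Q x + Q y" by (simp add: Q_def suminf_add[OF sm sm])
    have sc: "bounded_linear (\<lambda>z :: 'a. a *\<^sub>C z)"
      by (rule bounded_linear_intro[of _ "cmod a"])
         (auto simp: scaleC_add_right scaleR_scaleC scaleC_scaleC mult.commute)
    have "f (a *\<^sub>C x) = (\<lambda>k. a *\<^sub>C f x k)"
      by (simp add: f_def fun_eq_iff cinner_simps scaleC_scaleC mult_ac)
    then show "Q (a *\<^sub>C x) = a *\<^sub>C Q x"
      by (simp add: Q_def bounded_linear.suminf[OF sc sm])
    show "norm (Q x) \<le> s 0 * norm x"
    proof (rule LIMSEQ_le_const2[OF tendsto_norm[OF Qlim]])
      show "\<exists>N. \<forall>n\<ge>N. norm (\<Sum>k<n. f x k) \<le> s 0 * norm x"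
        using part[of x 0] by (auto simp: atLeast0LessThan)
    qed
  qed
  have Qe: "Q (e i) = s i *\<^sub>R e i" for i
  proof (rule LIMSEQ_unique[OF Qlim])
    have "(\<Sum>k<n. f (e i) k) = s i *\<^sub>R e i" if "i < n" for n
    proof -
      have "(\<Sum>k<n. f (e i) k) = (\<Sum>k<n. if k = i then s i *\<^sub>R e i else 0)"
        by (rule sum.cong) (auto simp: f_def orthonormalD[OF svd_orthonormal[OF comp svd, of UNIV]] scaleR_scaleC)
      then show ?thesis using that by simp
    qed
    then show "(\<lambda>n. \<Sum>k<n. f (e i) k) \<longlonglongrightarrow> s i *\<^sub>R e i"
      by (intro tendsto_eventually eventually_sequentiallyI[of "Suc i"]) simp
  qed
  have pos: "positive_operator Q"
    unfolding positive_operator_def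
  proof (intro conjI allI Q)
    fix x
    have "cinner (\<Sum>k<n. f x k) x = of_real (\<Sum>k<n. s k * (cmod (cinner x (e k)))\<^sup>2)" for n
    proof -
      have "cinner (f x k) x = of_real (s k * (cmod (cinner x (e k)))\<^sup>2)" for k
      proof -
        have "cinner (f x k) x = of_real (s k) * (cinner x (e k) * cnj (cinner x (e k)))"
          by (simp add: f_def cinner_simps cinner_commute[of "e k" x])
        then show ?thesis by (simp add: complex_norm_square[symmetric])
      qed
      then show ?thesis by (simp add: cinner_sum_left)
    qed
    then have "(\<lambda>n. of_real (\<Sum>k<n. s k * (cmod (cinner x (e k)))\<^sup>2)) \<longlonglongrightarrow> cinner (Q x) x"
      using tendsto_cinner_left[OF Qlim, of x x] by simp
    then show "cinner (Q x) x \<in> \<real>\<^sub>\<ge>\<^sub>0"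
      by (rule closed_sequentially[OF closed_nonneg_Reals_complex, rotated])
         (simp only: nonneg_Reals_of_real_iff, simp add: sum_nonneg s0)
  qed
  have "Q \<circ> Q = cadjoint T \<circ> T"
  proof
    fix x
    have "(\<lambda>n. Q (\<Sum>k<n. f x k)) \<longlonglongrightarrow> Q (Q x)"
      by (rule bounded_linear.tendsto[OF bounded_clinearD(7)[OF Q] Qlim])
    moreover have "Q (\<Sum>k<n. f x k) = cadjoint T (\<Sum>k<n. cinner x (e k) *\<^sub>C T (e k))" for n
      by (simp add: f_def bounded_clinearD[OF Q] bounded_clinearD[OF bounded_clinear_cadjoint[OF T]] Qe
          svd_eigen[OF comp svd] scaleR_scaleC scaleC_scaleC power2_eq_square mult_ac flip: s_def)
    moreover have "(\<lambda>n. cadjoint T (\<Sum>k<n. cinner x (e k) *\<^sub>C T (e k))) \<longlonglongrightarrow> cadjoint T (T x)"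
      by (rule bounded_linear.tendsto[OF bounded_clinearD(7)[OF bounded_clinear_cadjoint[OF T]] svd_expansion[OF comp svd]])
    ultimately show "(Q \<circ> Q) x = (cadjoint T \<circ> T) x" using LIMSEQ_unique by fastforce
  qed
  with pos show ?thesis by (rule that)
qed

lemma abs_operator:
  fixes T :: "'a::chilbert_space \<Rightarrow> 'a"
  assumes comp: "compact_operator T" and inf: "infinite_dimensional TYPE('a)"
  shows "positive_operator (abs_operator T)" "abs_operator T \<circ> abs_operator T = cadjoint T \<circ> T"
proof -
  obtain e where svd: "svd_basis T e" by (rule svd_basis_exists[OF comp inf])
  obtain P where P: "positive_operator P" "P \<circ> P = cadjoint T \<circ> T" by (rule positive_sqrt_exists[OF comp svd])
  have "positive_operator (abs_operator T) \<and> abs_operator T \<circ> abs_operator T = cadjoint T \<circ> T"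
    unfolding abs_operator_def sqrt_operator_def
  proof (rule theI[of _ P])
    fix Q assume "positive_operator Q \<and> Q \<circ> Q = cadjoint T \<circ> T"
    then show "Q = P"
      using svd_positive_sqrt_expansion[OF comp svd, of Q] svd_positive_sqrt_expansion[OF comp svd P]
      by (intro ext) (blast intro: LIMSEQ_unique)
  qed (use P in simp)
  then show "positive_operator (abs_operator T)" "abs_operator T \<circ> abs_operator T = cadjoint T \<circ> T" by auto
qed

section \<open>Singular numbers and eigenbases\<close>

text \<open>A finite downward closed set of natural numbers is an initial segment; applied to the indices at
which a decreasing sequence exceeds a given level.\<close>

lemma downset_card_iff:
  fixes A :: "nat set"
  assumes "finite A" "\<And>j k. j \<le> k \<Longrightarrow> k \<in> A \<Longrightarrow> j \<in> A"
  shows "k \<in> A \<longleftrightarrow> k < card A"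
proof
  assume "k \<in> A"
  then have "{..k} \<subseteq> A" using assms(2) by auto
  then have "card {..k} \<le> card A" by (rule card_mono[OF assms(1)])
  then show "k < card A" by simp
next
  assume k: "k < card A"
  show "k \<in> A"
  proof (rule ccontr)
    assume "k \<notin> A"
    then have "A \<subseteq> {..<k}" using assms(2) by (metis lessThan_iff not_le subsetI)
    then have "card A \<le> card {..<k}" by (rule card_mono[rotated]) simp
    with k show False by simp
  qed
qed

text \<open>Counting multiplicities above a level \<open>r > 0\<close> shows that both sequences exceed \<open>r\<close> equally often.
The terms of \<open>s'\<close> above \<open>r\<close> are values of \<open>s\<close>, so there are finitely many of them and \<open>s'\<close> tends to zero too.\<close>

lemma decseq_eq_if_card_eq:
  fixes s s' :: "nat \<Rightarrow> real"
  assumes s: "decseq s" "\<And>k. 0 \<le> s k" "s \<longlonglongrightarrow> 0"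
    and s': "decseq s'" "\<And>k. 0 \<le> s' k"
    and card: "\<And>r. r > 0 \<Longrightarrow> finite {k. s' k = r}" "\<And>r. r > 0 \<Longrightarrow> card {k. s' k = r} = card {k. s k = r}"
  shows "s' = s"
proof -
  have fin: "finite {k. r \<le> s k}" if "r > 0" for r
  proof -
    have "\<forall>\<^sub>F k in sequentially. s k < r" by (rule order_tendstoD(2)[OF s(3) that])
    then obtain N where "\<And>k. k \<ge> N \<Longrightarrow> s k < r" by (auto simp: eventually_sequentially)
    then have "{k. r \<le> s k} \<subseteq> {..<N}" by (metis (mono_tags, lifting) lessThan_iff mem_Collect_eq not_le subsetI)
    then show ?thesis by (rule finite_subset) simp
  qed
  have eq: "r \<le> s' k \<longleftrightarrow> r \<le> s k" if r: "r > 0" for r k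
  proof -
    define V where "V = s ` {k. r \<le> s k}"
    have V: "finite V" "\<And>v. v \<in> V \<Longrightarrow> r \<le> v" using fin[OF r] by (auto simp: V_def)
    have un: "{k. r \<le> s k} = (\<Union>v\<in>V. {k. s k = v})" by (auto simp: V_def)
    have un': "{k. r \<le> s' k} = (\<Union>v\<in>V. {k. s' k = v})"
    proof (intro equalityI subsetI)
      fix k assume "k \<in> {k. r \<le> s' k}"
      then have k: "r \<le> s' k" by simp
      then have "card {j. s' j = s' k} \<noteq> 0" using card(1)[of "s' k"] r by (auto simp: card_eq_0_iff)
      then have "card {j. s j = s' k} \<noteq> 0" using card(2)[of "s' k"] k r by simp
      then obtain j where "s j = s' k" by (metis (mono_tags) card.empty Collect_empty_eq)
      then have "s' k \<in> V" using k by (metis (mono_tags, lifting) V_def image_eqI mem_Collect_eq)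
      then show "k \<in> (\<Union>v\<in>V. {k. s' k = v})" by blast
    qed (use V(2) in auto)
    have fin': "finite {k. r \<le> s' k}" unfolding un' using V r by (intro finite_UN_I card(1)) (auto dest: V(2))
    have "card {k. r \<le> s' k} = (\<Sum>v\<in>V. card {k. s' k = v})"
      unfolding un' by (rule card_UN_disjoint) (use V r card(1) in \<open>auto, meson dual_order.strict_trans1\<close>)
    also have "\<dots> = (\<Sum>v\<in>V. card {k. s k = v})"
      by (rule sum.cong) (use V(2) r card(2) in \<open>auto, meson dual_order.strict_trans1\<close>)
    also have "\<dots> = card {k. r \<le> s k}"
      unfolding un
    proof (rule card_UN_disjoint[symmetric])
      show "\<forall>v\<in>V. finite {k. s k = v}"
        using V(2) by (intro ballI finite_subset[OF _ fin[OF r]]) auto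
    qed (use V in auto)
    finally have c: "card {k. r \<le> s' k} = card {k. r \<le> s k}" .
    have "k \<in> {k. r \<le> s' k} \<longleftrightarrow> k < card {k. r \<le> s' k}"
      by (rule downset_card_iff[OF fin']) (use s'(1) in \<open>auto simp: decseq_def intro: order_trans\<close>)
    moreover have "k \<in> {k. r \<le> s k} \<longleftrightarrow> k < card {k. r \<le> s k}"
      by (rule downset_card_iff[OF fin[OF r]]) (use s(1) in \<open>auto simp: decseq_def intro: order_trans\<close>)
    ultimately show ?thesis using c by simp
  qed
  show ?thesis
  proof
    fix k
    show "s' k = s k"
    proof (rule antisym)
      show "s' k \<le> s k" using eq[of "s' k" k] s(2)[of k] by (cases "s' k > 0") auto
      show "s k \<le> s' k" using eq[of "s k" k] s'(2)[of k] by (cases "s k > 0") auto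
    qed
  qed
qed

lemma orthonormal_card_cdim:
  assumes on: "orthonormal I e" and fin: "finite I"
  shows "cdim (cspan (e ` I)) = card I"
proof -
  have inj: "inj_on e I"
    by (intro inj_onI) (metis orthonormalD[OF on] zero_neq_one)
  have "\<not> cdependent (e ` I)"
  proof (rule complex_vector.independent_if_scalars_zero)
    fix f x assume sum: "(\<Sum>x\<in>e ` I. f x *\<^sub>C x) = 0" and "x \<in> e ` I"
    then obtain i where i: "i \<in> I" "x = e i" by blast
    have "(\<Sum>i\<in>I. f (e i) *\<^sub>C e i) = 0" using sum by (simp add: sum.reindex[OF inj])
    then have "cinner (\<Sum>i\<in>I. f (e i) *\<^sub>C e i) (e i) = 0" by simp
    then show "f x = 0" using cinner_orthonormal_sum[OF on fin order_refl i(1), of "\<lambda>i. f (e i)"] i by simp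
  qed (use fin in simp)
  then show ?thesis by (simp add: complex_vector.dim_span complex_vector.dim_eq_card_independent card_image[OF inj])
qed

text \<open>The eigenspace of \<open>|T|\<close> for \<open>r > 0\<close> is spanned by the \<open>e k\<close> with \<open>\<parallel>T (e k)\<parallel> = r\<close>, because an
eigenvector that is orthogonal to all \<open>e k\<close> is annihilated by \<open>|T|\<close>.\<close>

lemma singular_numbers_eq:
  fixes T :: "'a::chilbert_space \<Rightarrow> 'a"
  assumes comp: "compact_operator T" and inf: "infinite_dimensional TYPE('a)" and svd: "svd_basis T e"
  shows "singular_numbers T = (\<lambda>k. norm (T (e k)))"
proof -
  define s where "s k = norm (T (e k))" for k
  note on = svd_orthonormal[OF comp svd]
  have T: "bounded_clinear T" by (rule compact_operator_bounded_clinear[OF comp])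
  let ?A = "abs_operator T"
  note A = abs_operator[OF comp inf]
  have Alin: "bounded_clinear ?A" using A(1) by (simp add: positive_operator_def)
  have "?A (?A (e k)) = (s k)\<^sup>2 *\<^sub>R e k" for k
    using fun_cong[OF A(2), of "e k"] svd_eigen[OF comp svd, of k] by (simp add: s_def)
  then have Ae: "?A (e k) = s k *\<^sub>R e k" for k
    by (rule positive_sqrt_eigenvector[OF A(1)]) (simp add: s_def)
  have dec: "decseq s" using svd_decseq[OF comp svd] by (simp add: s_def[abs_def])
  have lim: "s \<longlonglongrightarrow> 0" using svd_tendsto_0[OF comp svd] by (simp add: s_def[abs_def])
  have s0: "0 \<le> s k" for k by (simp add: s_def)
  have count: "finite {k. s k = r} \<and> card {k. s k = r} = cdim (eigenspace ?A (complex_of_real r))" if r: "r > 0" for r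
  proof -
    have "\<forall>\<^sub>F k in sequentially. s k < r" by (rule order_tendstoD(2)[OF lim r])
    then obtain N where N: "\<And>k. k \<ge> N \<Longrightarrow> s k < r" by (auto simp: eventually_sequentially)
    let ?I = "{k. s k = r}"
    have "?I \<subseteq> {..<N}" using N by (metis (mono_tags, lifting) lessThan_iff mem_Collect_eq not_le less_irrefl subsetI)
    then have fin: "finite ?I" by (rule finite_subset) simp
    have "eigenspace ?A (complex_of_real r) = cspan (e ` ?I)"
    proof
      show "cspan (e ` ?I) \<subseteq> eigenspace ?A (complex_of_real r)"
      proof (rule complex_vector.span_minimal)
        show "e ` ?I \<subseteq> eigenspace ?A (complex_of_real r)" by (auto simp: eigenspace_def Ae scaleR_scaleC)
        show "complex_vector.subspace (eigenspace ?A (complex_of_real r))"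
          by (auto simp: complex_vector.subspace_def eigenspace_def bounded_clinearD[OF Alin] scaleC_add_right scaleC_scaleC mult.commute)
      qed
      show "eigenspace ?A (complex_of_real r) \<subseteq> cspan (e ` ?I)"
      proof
        fix x assume "x \<in> eigenspace ?A (complex_of_real r)"
        then have Ax: "?A x = r *\<^sub>R x" by (simp add: eigenspace_def scaleR_scaleC)
        have x0: "cinner x (e k) = 0" if "s k \<noteq> r" for k
        proof -
          have "of_real r * cinner x (e k) = cinner (?A x) (e k)" by (simp add: Ax cinner_scaleR_left)
          also have "\<dots> = of_real (s k) * cinner x (e k)"
            by (simp add: positive_operator_hermitian[OF A(1)] Ae cinner_scaleR_right)
          finally show ?thesis using that by simp
        qed
        define p where "p = (\<Sum>k\<in>?I. cinner x (e k) *\<^sub>C e k)"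
        have orth: "cinner (x - p) (e k) = 0" for k
        proof (cases "k \<in> ?I")
          case True
          show ?thesis unfolding p_def by (rule orthonormal_expansion_orth[OF on fin True])
        next
          case False
          then show ?thesis
            using cinner_orthonormal_sum[OF on[of UNIV] fin, of k "\<lambda>k. cinner x (e k)"] x0[of k]
            by (simp add: p_def cinner_diff_left)
        qed
        have le: "norm (T (x - p)) \<le> s n * norm (x - p)" for n
          unfolding s_def by (rule svd_le[OF comp svd orth])
        have "norm (T (x - p)) \<le> 0"
          by (rule LIMSEQ_le_const[OF tendsto_mult_left_zero[OF lim]]) (use le in blast)
        then have "norm (?A (x - p)) = 0" by (simp add: positive_sqrt_norm[OF A(1) T A(2)])
        moreover have "?A (x - p) = r *\<^sub>R (x - p)"
          by (simp add: bounded_clinearD[OF Alin] Ax p_def Ae scaleR_diff_right scaleR_sum_right)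
             (rule sum.cong, simp_all add: scaleR_scaleC scaleC_scaleC mult.commute)
        ultimately have "x = p" using r by simp
        moreover have "p \<in> cspan (e ` ?I)" unfolding p_def
          by (intro complex_vector.span_sum complex_vector.span_scale complex_vector.span_base imageI)
        ultimately show "x \<in> cspan (e ` ?I)" by (simp only:)
      qed
    qed
    then show ?thesis using fin orthonormal_card_cdim[OF on fin] by simp
  qed
  have "singular_numbers T = s"
    unfolding singular_numbers_def
  proof (rule the_equality)
    show "decseq s \<and> (\<forall>k. 0 \<le> s k) \<and>
        (\<forall>r>0. finite {k. s k = r} \<and> card {k. s k = r} = cdim (eigenspace (abs_operator T) (complex_of_real r)))"
      using dec s0 count by blast
    fix s' :: "nat \<Rightarrow> real"
    assume s': "decseq s' \<and> (\<forall>k. 0 \<le> s' k) \<and>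
        (\<forall>r>0. finite {k. s' k = r} \<and> card {k. s' k = r} = cdim (eigenspace (abs_operator T) (complex_of_real r)))"
    show "s' = s"
      by (rule decseq_eq_if_card_eq[OF dec s0 lim]) (use s' count in simp_all)
  qed
  then show ?thesis by (simp add: s_def[abs_def])
qed

text \<open>A maximal orthonormal set of eigenvectors of \<open>T\<^sup>* T\<close>: its orthogonal complement is invariant and, if it
were nonzero, would contain a further eigenvector.  Unlike \<open>svd_basis\<close>, it also exhausts the kernel.\<close>

lemma abs_eigenbasis_exists:
  fixes T :: "'a::chilbert_space \<Rightarrow> 'a"
  assumes comp: "compact_operator T"
  obtains W where "orthonormal W (\<lambda>w. w)"
    "\<And>w. w \<in> W \<Longrightarrow> cadjoint T (T w) = (norm (T w))\<^sup>2 *\<^sub>R w"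
    "\<And>x. (\<And>w. w \<in> W \<Longrightarrow> cinner x w = 0) \<Longrightarrow> x = 0"
proof -
  have T: "bounded_clinear T" by (rule compact_operator_bounded_clinear[OF comp])
  define G where "G = {W. orthonormal W (\<lambda>w. w) \<and> (\<forall>w\<in>W. cadjoint T (T w) = (norm (T w))\<^sup>2 *\<^sub>R w)}"
  have "\<exists>M\<in>G. \<forall>X\<in>G. M \<subseteq> X \<longrightarrow> X = M"
  proof (rule subset_Zorn')
    fix C assume C: "subset.chain G C"
    have "orthonormal (\<Union>C) (\<lambda>w. w)"
      unfolding orthonormal_def
    proof (intro ballI)
      fix v w assume "v \<in> \<Union>C" "w \<in> \<Union>C"
      then obtain V W where VW: "v \<in> V" "V \<in> C" "w \<in> W" "W \<in> C" by blast
      then have "V \<subseteq> W \<or> W \<subseteq> V" using C by (auto simp: subset.chain_def subset_chain_def)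
      then obtain X where "v \<in> X" "w \<in> X" "X \<in> C" using VW by blast
      then show "cinner v w = (if v = w then 1 else 0)"
        using C orthonormalD[of X "\<lambda>w. w" v w] by (auto simp: subset_chain_def G_def)
    qed
    then show "\<Union>C \<in> G" using C by (auto simp: G_def subset_chain_def)
  qed
  then obtain W where W: "W \<in> G" and max: "\<And>X. X \<in> G \<Longrightarrow> W \<subseteq> X \<Longrightarrow> X = W" by blast
  have on: "orthonormal W (\<lambda>w. w)" and eig: "\<And>w. w \<in> W \<Longrightarrow> cadjoint T (T w) = (norm (T w))\<^sup>2 *\<^sub>R w"
    using W by (auto simp: G_def)
  let ?N = "{x. \<forall>y\<in>W. cinner x y = 0}"
  have inv: "cadjoint T (T x) \<in> ?N" if "x \<in> ?N" for x
  proof -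
    have "cinner (cadjoint T (T x)) w = 0" if "w \<in> W" for w
    proof -
      have "cinner (cadjoint T (T x)) w = cinner x (cadjoint T (T w))"
        by (simp add: cinner_cadjoint[OF T] cinner_cadjoint'[OF T])
      also have "\<dots> = of_real ((norm (T w))\<^sup>2) * cinner x w"
        by (simp add: eig[OF that] cinner_scaleR_right)
      finally show ?thesis using \<open>x \<in> ?N\<close> that by simp
    qed
    then show ?thesis by simp
  qed
  have N: "?N = {0}"
  proof (rule ccontr)
    assume ne: "?N \<noteq> {0}"
    obtain e where e: "e \<in> ?N" "norm e = 1" "cadjoint T (T e) = (norm (T e))\<^sup>2 *\<^sub>R e"
        "\<forall>x\<in>?N. norm (T x) \<le> norm (T e) * norm x"
      by (rule compact_operator_attains_norm[OF comp subspace_orthogonal closed_orthogonal ne inv])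
    have we: "cinner e w = 0" "cinner w e = 0" if "w \<in> W" for w
      using e(1) that cinner_commute[of w e] by auto
    have ee: "cinner e e = 1" using e(2) by (simp add: cinner_self)
    have eW: "e \<notin> W" using we ee by auto
    have "orthonormal (insert e W) (\<lambda>w. w)"
      using eW we ee orthonormalD[OF on] by (auto simp: orthonormal_def)
    then have "insert e W \<in> G" using eig e(3) by (auto simp: G_def)
    then have "insert e W = W" using max by blast
    then show False using eW by blast
  qed
  show ?thesis
  proof (rule that[OF on eig])
    fix x assume "\<And>w. w \<in> W \<Longrightarrow> cinner x w = 0"
    then have "x \<in> ?N" by simp
    then show "x = 0" unfolding N by simp
  qed
qed

text \<open>The span of a total orthonormal set is dense, and orthogonal projections are best approximations.
The estimate holds for all larger finite sets as well, so that finitely many vectors can be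
approximated simultaneously.\<close>

lemma total_orthonormal_approx:
  fixes x :: "'a::chilbert_space"
  assumes on: "orthonormal W (\<lambda>w. w)" and tot: "\<And>x. (\<And>w. w \<in> W \<Longrightarrow> cinner x w = 0) \<Longrightarrow> x = 0"
    and \<epsilon>: "\<epsilon> > 0"
  obtains F where "finite F" "F \<subseteq> W"
    "\<And>G. finite G \<Longrightarrow> F \<subseteq> G \<Longrightarrow> G \<subseteq> W \<Longrightarrow> norm (x - (\<Sum>w\<in>G. cinner x w *\<^sub>C w)) < \<epsilon>"
proof -
  let ?M = "closure (cspan W)"
  have clM: "closed ?M" by simp
  have sub: "complex_vector.subspace ?M"
    unfolding complex_vector.subspace_def
  proof (intro conjI ballI allI)
    show "0 \<in> ?M" using closure_subset complex_vector.span_zero by blast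
    fix x assume "x \<in> ?M"
    then obtain f where f': "\<forall>n. f n \<in> cspan W" and f2: "f \<longlonglongrightarrow> x"
      unfolding closure_sequential by (elim exE conjE)
    then have f: "f n \<in> cspan W" "f \<longlonglongrightarrow> x" for n by simp_all
    show "c *\<^sub>C x \<in> ?M" for c
    proof -
      have sc: "bounded_linear (\<lambda>z :: 'a. c *\<^sub>C z)"
        by (rule bounded_linear_intro[of _ "cmod c"])
           (auto simp: scaleC_add_right scaleR_scaleC scaleC_scaleC mult.commute)
      have "(\<lambda>n. c *\<^sub>C f n) \<longlonglongrightarrow> c *\<^sub>C x" by (rule bounded_linear.tendsto[OF sc f(2)])
      then show ?thesis unfolding closure_sequential
        by (intro exI[of _ "\<lambda>n. c *\<^sub>C f n"]) (simp add: f(1) complex_vector.span_scale)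
    qed
    fix y assume "y \<in> ?M"
    then obtain g where g': "\<forall>n. g n \<in> cspan W" and g2: "g \<longlonglongrightarrow> y"
      unfolding closure_sequential by (elim exE conjE)
    then have g: "g n \<in> cspan W" "g \<longlonglongrightarrow> y" for n by simp_all
    have "(\<lambda>n. f n + g n) \<longlonglongrightarrow> x + y" by (intro tendsto_add f g)
    then show "x + y \<in> ?M" unfolding closure_sequential
      by (intro exI[of _ "\<lambda>n. f n + g n"]) (simp add: f(1) g(1) complex_vector.span_add)
  qed
  obtain m where m: "m \<in> ?M" "\<And>u. u \<in> ?M \<Longrightarrow> cinner (x - m) u = 0"
    using closed_subspace_projection[OF sub clM, of x] by metis
  have "x - m = 0"
  proof (rule tot)
    fix w assume "w \<in> W"
    then have "w \<in> ?M" using closure_subset complex_vector.span_base by blast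
    then show "cinner (x - m) w = 0" by (rule m(2))
  qed
  then have "x \<in> ?M" using m(1) by simp
  then obtain y where y: "y \<in> cspan W" "dist y x < \<epsilon>" using \<epsilon> by (auto simp: closure_approachable)
  then have "\<exists>F c. y = (\<Sum>w\<in>F. c w *\<^sub>C w) \<and> finite F \<and> F \<subseteq> W"
    unfolding complex_vector.span_explicit by (simp add: conj_commute)
  then obtain F where "\<exists>c. y = (\<Sum>w\<in>F. c w *\<^sub>C w) \<and> finite F \<and> F \<subseteq> W" ..
  then obtain c where "y = (\<Sum>w\<in>F. c w *\<^sub>C w) \<and> finite F \<and> F \<subseteq> W" ..
  then have F: "finite F" "F \<subseteq> W" "y = (\<Sum>w\<in>F. c w *\<^sub>C w)" by simp_all
  show ?thesis
  proof (rule that[OF F(1,2)])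
    fix G assume G: "finite G" "F \<subseteq> G" "G \<subseteq> W"
    note onG = orthonormal_subset[OF on G(3)]
    let ?p = "\<Sum>w\<in>G. cinner x w *\<^sub>C w"
    define d where "d w = (if w \<in> F then c w else 0)" for w
    have "(\<Sum>w\<in>F. c w *\<^sub>C w) = (\<Sum>w\<in>F. d w *\<^sub>C w)"
      by (rule sum.cong) (simp_all add: d_def)
    also have "\<dots> = (\<Sum>w\<in>G. d w *\<^sub>C w)"
      by (rule sum.mono_neutral_left[OF G(1,2)]) (simp add: d_def)
    finally have yG: "y = (\<Sum>w\<in>G. d w *\<^sub>C w)" by (simp only: F(3))
    have yw: "cinner y w = d w" if "w \<in> G" for w
      using cinner_orthonormal_sum[OF onG G(1) order_refl that, of d] that by (simp only: yG if_True)
    have "(\<Sum>w\<in>G. cinner (x - y) w *\<^sub>C w) = (\<Sum>w\<in>G. cinner x w *\<^sub>C w - d w *\<^sub>C w)"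
      by (rule sum.cong) (simp_all only: cinner_diff_left yw complex_vector.scale_left_diff_distrib)
    also have "\<dots> = ?p - y" by (simp only: sum_subtractf yG)
    finally have "x - ?p = (x - y) - (\<Sum>w\<in>G. cinner (x - y) w *\<^sub>C w)" by (simp only: diff_diff_eq2 diff_add_cancel)
    also have "norm \<dots> \<le> norm (x - y)"
    proof (rule power2_le_imp_le)
      show "(norm (x - y - (\<Sum>w\<in>G. cinner (x - y) w *\<^sub>C w)))\<^sup>2 \<le> (norm (x - y))\<^sup>2"
        unfolding norm_minus_orthonormal_expansion[OF onG G(1)] by (simp add: sum_nonneg)
    qed simp
    also have "\<dots> < \<epsilon>" using y(2) by (simp add: dist_norm norm_minus_commute)
    finally show "norm (x - ?p) < \<epsilon>" .
  qed
qed

section \<open>Determinants of operators on a finite-dimensional subspace\<close>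

text \<open>For an orthonormal family \<open>\<phi>\<close> this is the span of its first \<open>n\<close> members, given by the expansion
that the computations with matrix entries use.\<close>

definition coord_span :: "(nat \<Rightarrow> 'a::complex_inner) \<Rightarrow> nat \<Rightarrow> 'a set"
  where "coord_span \<phi> n = {x. x = (\<Sum>k<n. cinner x (\<phi> k) *\<^sub>C \<phi> k)}"

text \<open>The determinant of the compression of \<open>L\<close> to the span of \<open>\<phi>\<close>.  Working with operators on the
ambient Hilbert space makes orthogonality and the singular vectors above available for matrices.\<close>

definition opdet :: "(nat \<Rightarrow> 'a::complex_inner) \<Rightarrow> nat \<Rightarrow> ('a \<Rightarrow> 'a) \<Rightarrow> complex"
  where "opdet \<phi> n L = fdet n (\<lambda>i j. cinner (L (\<phi> j)) (\<phi> i))"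

text \<open>Real part at least the identity, on the span of \<open>\<phi>\<close>.\<close>

definition accretive :: "(nat \<Rightarrow> 'a::complex_inner) \<Rightarrow> nat \<Rightarrow> ('a \<Rightarrow> 'a) \<Rightarrow> bool"
  where "accretive \<phi> n L \<longleftrightarrow> clinear L \<and>
    (\<forall>x\<in>coord_span \<phi> n. L x \<in> coord_span \<phi> n \<and> (norm x)\<^sup>2 \<le> Re (cinner (L x) x))"

lemma clinear_sum: "clinear T \<Longrightarrow> T (\<Sum>i\<in>I. f i) = (\<Sum>i\<in>I. T (f i))"
  by (metis Vector_Spaces.linear.axioms(1) module_hom.sum Vector_Spaces.linear_def)

lemma clinearD: "clinear T \<Longrightarrow> T (x + y) = T x + T y" "clinear T \<Longrightarrow> T (a *\<^sub>C x) = a *\<^sub>C T x"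
  by (auto simp: clinear_iff)

lemma bounded_clinear_clinear: "bounded_clinear T \<Longrightarrow> clinear T"
  by (simp add: bounded_clinear_def)

text \<open>Conjugation by the diagonal matrix with entries \<open>r i\<close>.\<close>

lemma fdet_similar:
  assumes r: "\<And>i. i < n \<Longrightarrow> r i \<noteq> 0"
  shows "fdet n (\<lambda>i j. r i * M i j / r j) = fdet n M"
proof -
  define R where "R i j = (if i = j then r i else 0)" for i j :: nat
  define R' where "R' i j = (if i = j then 1 / r i else 0)" for i j :: nat
  have 1: "fdet n R * fdet n R' = 1"
  proof -
    have "fdet n R * fdet n R' = fdet n (\<lambda>i j. \<Sum>k<n. R i k * R' k j)" by (rule fdet_mult[symmetric])
    also have "\<dots> = fdet n (\<lambda>i j. if i = j then 1 else 0)"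
    proof (rule fdet_cong)
      fix i j assume "i < n" "j < n"
      have "(\<Sum>k<n. R i k * R' k j) = (\<Sum>k<n. if k = i then R' i j * r i else 0)"
        by (rule sum.cong) (auto simp: R_def)
      then show "(\<Sum>k<n. R i k * R' k j) = (if i = j then 1 else 0)"
        using \<open>i < n\<close> r by (simp add: R'_def)
    qed
    finally show ?thesis by (simp add: fdet_one)
  qed
  have "fdet n (\<lambda>i j. r i * M i j / r j) = fdet n (\<lambda>i j. \<Sum>k<n. R i k * (\<Sum>l<n. M k l * R' l j))"
  proof (rule fdet_cong)
    fix i j assume ij: "i < n" "j < n"
    have a: "(\<Sum>l<n. M k l * R' l j) = M k j / r j" for k
    proof -
      have "(\<Sum>l<n. M k l * R' l j) = (\<Sum>l<n. if l = j then M k j / r j else 0)"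
        by (rule sum.cong) (auto simp: R'_def)
      then show ?thesis using ij by simp
    qed
    have "(\<Sum>k<n. R i k * (M k j / r j)) = (\<Sum>k<n. if k = i then r i * (M i j / r j) else 0)"
      by (rule sum.cong) (auto simp: R_def)
    then show "r i * M i j / r j = (\<Sum>k<n. R i k * (\<Sum>l<n. M k l * R' l j))"
      using ij by (simp add: a)
  qed
  also have "\<dots> = fdet n R * (fdet n M * fdet n R')" unfolding fdet_mult ..
  finally show ?thesis using 1 by (simp add: mult_ac)
qed

context
  fixes \<phi> :: "nat \<Rightarrow> 'a::complex_inner" and n :: nat
  assumes on: "orthonormal {..<n} \<phi>"
begin

lemma coord_spanD: "x \<in> coord_span \<phi> n \<Longrightarrow> (\<Sum>k<n. cinner x (\<phi> k) *\<^sub>C \<phi> k) = x"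
  by (simp add: coord_span_def)

lemma coord_span_sum: "(\<Sum>k<n. c k *\<^sub>C \<phi> k) \<in> coord_span \<phi> n"
proof -
  have "cinner (\<Sum>k<n. c k *\<^sub>C \<phi> k) (\<phi> i) = c i" if "i < n" for i
    using cinner_orthonormal_sum[OF on finite_lessThan order_refl, of i c] that by simp
  then show ?thesis by (simp add: coord_span_def)
qed

lemma subspace_coord_span: "complex_vector.subspace (coord_span \<phi> n)"
  unfolding complex_vector.subspace_def
proof (intro conjI ballI allI)
  show "0 \<in> coord_span \<phi> n" by (simp add: coord_span_def)
  fix x assume x: "x \<in> coord_span \<phi> n"
  have "(\<Sum>k<n. cinner (c *\<^sub>C x) (\<phi> k) *\<^sub>C \<phi> k) = c *\<^sub>C (\<Sum>k<n. cinner x (\<phi> k) *\<^sub>C \<phi> k)" for c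
    by (simp add: cinner_scaleC_left scaleC_scaleC complex_vector.scale_sum_right)
  then show "c *\<^sub>C x \<in> coord_span \<phi> n" for c
    using coord_spanD[OF x] by (simp add: coord_span_def)
  fix y assume y: "y \<in> coord_span \<phi> n"
  have "(\<Sum>k<n. cinner (x + y) (\<phi> k) *\<^sub>C \<phi> k) = x + y"
    by (simp only: cinner_add_left scaleC_add_left sum.distrib coord_spanD[OF x] coord_spanD[OF y])
  then show "x + y \<in> coord_span \<phi> n" by (simp add: coord_span_def)
qed

lemmas coord_span_add = complex_vector.subspace_add[OF subspace_coord_span]
  and coord_span_scale = complex_vector.subspace_scale[OF subspace_coord_span]
  and coord_span_0 = complex_vector.subspace_0[OF subspace_coord_span]

lemma coord_span_base: "i < n \<Longrightarrow> \<phi> i \<in> coord_span \<phi> n"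
proof -
  assume i: "i < n"
  have "(\<Sum>k<n. (if k = i then 1 else 0) *\<^sub>C \<phi> k) = (\<Sum>k<n. if k = i then \<phi> i else 0)"
    by (rule sum.cong) (auto simp: scaleC_one)
  then show ?thesis using coord_span_sum[of "\<lambda>k. if k = i then 1 else 0"] i by simp
qed

lemma coord_span_parseval: "x \<in> coord_span \<phi> n \<Longrightarrow> (\<Sum>i<n. (cmod (cinner x (\<phi> i)))\<^sup>2) = (norm x)\<^sup>2"
  using norm_orthonormal_sum[OF on finite_lessThan, of "\<lambda>i. cinner x (\<phi> i)"] coord_spanD[of x] by simp

lemma opdet_comp:
  assumes L: "clinear L" and M: "\<And>x. x \<in> coord_span \<phi> n \<Longrightarrow> M x \<in> coord_span \<phi> n"
  shows "opdet \<phi> n (\<lambda>x. L (M x)) = opdet \<phi> n L * opdet \<phi> n M"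
  unfolding opdet_def fdet_mult[symmetric]
proof (rule fdet_cong)
  fix i j assume "i < n" "j < n"
  have "L (M (\<phi> j)) = L (\<Sum>k<n. cinner (M (\<phi> j)) (\<phi> k) *\<^sub>C \<phi> k)"
    using coord_spanD[OF M[OF coord_span_base[OF \<open>j < n\<close>]]] by simp
  also have "\<dots> = (\<Sum>k<n. cinner (M (\<phi> j)) (\<phi> k) *\<^sub>C L (\<phi> k))"
    by (simp add: clinear_sum[OF L] clinearD[OF L])
  finally show "cinner (L (M (\<phi> j))) (\<phi> i) = (\<Sum>k<n. cinner (L (\<phi> k)) (\<phi> i) * cinner (M (\<phi> j)) (\<phi> k))"
    by (simp add: cinner_sum_left cinner_scaleC_left mult.commute)
qed

lemma opdet_id: "opdet \<phi> n (\<lambda>x. x) = 1"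
proof -
  have "opdet \<phi> n (\<lambda>x. x) = fdet n (\<lambda>i j. if i = j then 1 else 0)"
    unfolding opdet_def by (rule fdet_cong) (use orthonormalD[OF on] in auto)
  then show ?thesis by (simp add: fdet_one)
qed

lemma opdet_rank_one:
  assumes u: "u \<in> coord_span \<phi> n"
  shows "opdet \<phi> n (\<lambda>x. x + cinner x v *\<^sub>C u) = 1 + cinner u v"
proof -
  have "opdet \<phi> n (\<lambda>x. x + cinner x v *\<^sub>C u) =
      fdet n (\<lambda>i j. (if i = j then 1 else 0) + cinner u (\<phi> i) * cinner (\<phi> j) v)"
    unfolding opdet_def by (rule fdet_cong) (use orthonormalD[OF on] in \<open>auto simp: cinner_simps\<close>)
  also have "\<dots> = 1 + (\<Sum>i<n. cinner u (\<phi> i) * cinner (\<phi> i) v)" by (rule fdet_one_plus_rank_one)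
  also have "(\<Sum>i<n. cinner u (\<phi> i) * cinner (\<phi> i) v) = cinner (\<Sum>i<n. cinner u (\<phi> i) *\<^sub>C \<phi> i) v"
    by (simp add: cinner_sum_left cinner_scaleC_left)
  finally show ?thesis using coord_spanD[OF u] by simp
qed

lemma opdet_adjoint:
  assumes "\<And>i j. i < n \<Longrightarrow> j < n \<Longrightarrow> cinner (L' (\<phi> j)) (\<phi> i) = cinner (\<phi> j) (L (\<phi> i))"
  shows "opdet \<phi> n L' = cnj (opdet \<phi> n L)"
  unfolding opdet_def fdet_adjoint[symmetric]
  by (rule fdet_cong) (use assms cinner_commute in metis)

lemma coord_span_eq_cspan: "coord_span \<phi> n = cspan (\<phi> ` {..<n})"
proof
  show "coord_span \<phi> n \<subseteq> cspan (\<phi> ` {..<n})"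
  proof
    fix x assume "x \<in> coord_span \<phi> n"
    then have "x = (\<Sum>k<n. cinner x (\<phi> k) *\<^sub>C \<phi> k)" by (simp add: coord_span_def)
    also have "\<dots> \<in> cspan (\<phi> ` {..<n})"
      by (intro complex_vector.span_sum complex_vector.span_scale complex_vector.span_base imageI)
    finally show "x \<in> cspan (\<phi> ` {..<n})" .
  qed
  show "cspan (\<phi> ` {..<n}) \<subseteq> coord_span \<phi> n"
    by (rule complex_vector.span_minimal[OF _ subspace_coord_span]) (auto simp: coord_span_base)
qed

text \<open>The images of \<open>\<phi>\<close> are \<open>n\<close> independent vectors in an \<open>n\<close>-dimensional space, hence span it.\<close>

lemma injective_surj_on_coord_span:
  assumes L: "clinear L" and V: "\<And>x. x \<in> coord_span \<phi> n \<Longrightarrow> L x \<in> coord_span \<phi> n"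
    and inj: "\<And>x. x \<in> coord_span \<phi> n \<Longrightarrow> L x = 0 \<Longrightarrow> x = 0"
    and u: "u \<in> coord_span \<phi> n"
  obtains z where "z \<in> coord_span \<phi> n" "L z = u"
proof -
  let ?f = "\<lambda>i. L (\<phi> i)"
  have zero: "\<forall>i<n. c i = 0" if "(\<Sum>i<n. c i *\<^sub>C L (\<phi> i)) = 0" for c
  proof -
    let ?x = "\<Sum>i<n. c i *\<^sub>C \<phi> i"
    have "L ?x = 0" using that by (simp add: clinear_sum[OF L] clinearD[OF L])
    then have "?x = 0" using inj[OF coord_span_sum] by blast
    then have "cinner ?x (\<phi> i) = 0" for i by simp
    then show ?thesis using cinner_orthonormal_sum[OF on finite_lessThan order_refl, of _ c] by simp
  qed
  have injf: "inj_on ?f {..<n}"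
  proof (rule inj_onI)
    fix i j assume ij: "i \<in> {..<n}" "j \<in> {..<n}" "L (\<phi> i) = L (\<phi> j)"
    show "i = j"
    proof (rule ccontr)
      assume ne: "i \<noteq> j"
      define c where "c k = (if k = i then 1 else if k = j then -1 else 0 :: complex)" for k
      have "(\<Sum>k<n. c k *\<^sub>C L (\<phi> k)) = (\<Sum>k<n. (if k = i then L (\<phi> i) else 0) + (if k = j then - L (\<phi> j) else 0))"
        by (rule sum.cong) (use ne in \<open>auto simp: c_def scaleC_one scaleC_minus_one\<close>)
      also have "\<dots> = 0" using ij by (simp add: sum.distrib)
      finally have "c i = 0" using zero[of c] ij(1) by simp
      then show False by (simp add: c_def)
    qed
  qed
  have indep: "\<not> cdependent (?f ` {..<n})"
  proof (rule complex_vector.independent_if_scalars_zero)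
    fix g x assume s: "(\<Sum>x\<in>?f ` {..<n}. g x *\<^sub>C x) = 0" and "x \<in> ?f ` {..<n}"
    then obtain i where i: "i < n" "x = L (\<phi> i)" by auto
    have "(\<Sum>i<n. g (L (\<phi> i)) *\<^sub>C L (\<phi> i)) = 0" using s by (simp add: sum.reindex[OF injf])
    then show "g x = 0" using zero[of "\<lambda>i. g (L (\<phi> i))"] i by simp
  qed simp
  have sub: "?f ` {..<n} \<subseteq> cspan (\<phi> ` {..<n})"
    using V coord_span_base unfolding coord_span_eq_cspan[symmetric] by auto
  have injphi: "inj_on \<phi> {..<n}"
  proof (rule inj_onI)
    fix i j assume ij: "i \<in> {..<n}" "j \<in> {..<n}" "\<phi> i = \<phi> j"
    then have "cinner (\<phi> i) (\<phi> j) = 1" using orthonormalD[OF on, of i i] by simp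
    then show "i = j" using orthonormalD[OF on ij(1,2)] by (simp split: if_splits)
  qed
  have "u \<in> cspan (?f ` {..<n})"
  proof (rule ccontr)
    assume nu: "u \<notin> cspan (?f ` {..<n})"
    have "u \<notin> ?f ` {..<n}"
    proof
      assume "u \<in> ?f ` {..<n}"
      from complex_vector.span_base[OF this] nu show False by contradiction
    qed
    then have card: "card (insert u (?f ` {..<n})) = Suc n" by (simp add: card_image injf)
    have "\<not> cdependent (insert u (?f ` {..<n}))"
      using nu indep \<open>u \<notin> ?f ` {..<n}\<close> by (simp add: complex_vector.independent_insert)
    moreover have "insert u (?f ` {..<n}) \<subseteq> cspan (\<phi> ` {..<n})"
      using sub u unfolding coord_span_eq_cspan by blast
    ultimately have "card (insert u (?f ` {..<n})) \<le> card (\<phi> ` {..<n})"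
      using complex_vector.independent_span_bound[of "\<phi> ` {..<n}" "insert u (?f ` {..<n})"] by simp
    then show False unfolding card by (simp add: card_image injphi)
  qed
  also have "cspan (?f ` {..<n}) \<subseteq> L ` coord_span \<phi> n"
  proof (rule complex_vector.span_minimal)
    show "?f ` {..<n} \<subseteq> L ` coord_span \<phi> n" by (auto simp: coord_span_base)
    show "complex_vector.subspace (L ` coord_span \<phi> n)"
      unfolding complex_vector.subspace_def
    proof (intro conjI ballI allI)
      show "0 \<in> L ` coord_span \<phi> n"
        using clinearD(2)[OF L, of 0 0] coord_span_0 by (metis complex_vector.scale_zero_left image_eqI)
      show "x + y \<in> L ` coord_span \<phi> n" if "x \<in> L ` coord_span \<phi> n" "y \<in> L ` coord_span \<phi> n" for x y
        using that by (auto simp flip: clinearD(1)[OF L] intro!: imageI coord_span_add)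
      show "c *\<^sub>C x \<in> L ` coord_span \<phi> n" if "x \<in> L ` coord_span \<phi> n" for c x
        using that by (auto simp flip: clinearD(2)[OF L] intro!: imageI coord_span_scale)
    qed
  qed
  finally show ?thesis using that by blast
qed

text \<open>Matrix determinant lemma: with \<open>L z = u\<close> the updated operator is \<open>L\<close> composed with a rank one update of
the identity.\<close>

lemma accretive_rank_one:
  assumes L: "accretive \<phi> n L" and u: "u \<in> coord_span \<phi> n"
  obtains z where "z \<in> coord_span \<phi> n" "L z = u"
    "opdet \<phi> n (\<lambda>x. L x + cinner x v *\<^sub>C u) = opdet \<phi> n L * (1 + cinner z v)"
proof -
  have lin: "clinear L" using L by (simp add: accretive_def)
  obtain z where z: "z \<in> coord_span \<phi> n" "L z = u"
  proof (rule injective_surj_on_coord_span[OF lin _ _ u])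
    show "L x \<in> coord_span \<phi> n" if "x \<in> coord_span \<phi> n" for x using L that by (simp add: accretive_def)
    show "x = 0" if "x \<in> coord_span \<phi> n" "L x = 0" for x using L that by (force simp: accretive_def)
  qed
  have "opdet \<phi> n (\<lambda>x. L x + cinner x v *\<^sub>C u) = opdet \<phi> n (\<lambda>x. L (x + cinner x v *\<^sub>C z))"
    by (simp add: clinearD[OF lin] z(2))
  also have "\<dots> = opdet \<phi> n L * (1 + cinner z v)"
    by (subst opdet_comp[OF lin]) (simp_all add: coord_span_add coord_span_scale z(1) opdet_rank_one)
  finally show ?thesis by (rule that[OF z])
qed

lemma accretive_plus_rank_one:
  assumes L: "accretive \<phi> n L" and u: "u \<in> coord_span \<phi> n"
  shows "accretive \<phi> n (\<lambda>x. L x + cinner x u *\<^sub>C u)"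
  unfolding accretive_def
proof (intro conjI ballI)
  have lin: "clinear L" using L by (simp add: accretive_def)
  show "clinear (\<lambda>x. L x + cinner x u *\<^sub>C u)"
    by (simp add: clinear_iff clinearD[OF lin] cinner_simps scaleC_add_left scaleC_add_right scaleC_scaleC)
  fix x assume x: "x \<in> coord_span \<phi> n"
  show "L x + cinner x u *\<^sub>C u \<in> coord_span \<phi> n"
    using L x u by (simp add: accretive_def coord_span_add coord_span_scale)
  have "Re (cinner x u * cinner u x) = (cmod (cinner x u))\<^sup>2"
    by (simp add: cinner_commute[of u x] complex_norm_square[symmetric] flip: of_real_power)
  then show "(norm x)\<^sup>2 \<le> Re (cinner (L x + cinner x u *\<^sub>C u) x)"
    using L x by (simp add: accretive_def cinner_add_left cinner_scaleC_left add_increasing2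
        del: times_complex.sel)
qed

text \<open>The update multiplies the determinant by \<open>1 + cinner z u\<close>, where \<open>L z = u\<close>.  Accretivity gives
\<open>\<parallel>z\<parallel>\<^sup>2 \<le> Re (cinner z u)\<close>; this bounds the factor below by \<open>1\<close>, and it bounds \<open>\<parallel>z\<parallel>\<close> by \<open>\<parallel>u\<parallel>\<close> and therefore
the factor above by \<open>1 + \<parallel>u\<parallel>\<^sup>2\<close>.  If \<open>u\<close> is fixed by \<open>L\<close>, then \<open>z = u\<close> and the upper bound is attained.\<close>

lemma accretive_opdet_rank_one:
  assumes L: "accretive \<phi> n L" and u: "u \<in> coord_span \<phi> n"
  shows "cmod (opdet \<phi> n L) \<le> cmod (opdet \<phi> n (\<lambda>x. L x + cinner x u *\<^sub>C u))"
    and "cmod (opdet \<phi> n (\<lambda>x. L x + cinner x u *\<^sub>C u)) \<le> cmod (opdet \<phi> n L) * (1 + (norm u)\<^sup>2)"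
    and "L u = u \<Longrightarrow> opdet \<phi> n (\<lambda>x. L x + cinner x u *\<^sub>C u) = opdet \<phi> n L * of_real (1 + (norm u)\<^sup>2)"
proof -
  obtain z where z: "z \<in> coord_span \<phi> n" "L z = u"
      and eq: "opdet \<phi> n (\<lambda>x. L x + cinner x u *\<^sub>C u) = opdet \<phi> n L * (1 + cinner z u)"
    by (rule accretive_rank_one[OF L u, of u])
  have ge: "(norm z)\<^sup>2 \<le> Re (cinner z u)"
    using L z by (metis accretive_def cinner_commute cnj.simps(1))
  have "0 \<le> Re (cinner z u)" using ge by (meson order_trans zero_le_power2)
  then have "1 \<le> cmod (1 + cinner z u)"
    using complex_Re_le_cmod[of "1 + cinner z u"] by simp
  then show "cmod (opdet \<phi> n L) \<le> cmod (opdet \<phi> n (\<lambda>x. L x + cinner x u *\<^sub>C u))"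
    unfolding eq norm_mult by (simp add: mult_le_cancel_left1)
  have "(norm z)\<^sup>2 \<le> norm z * norm u"
    using ge complex_Re_le_cmod[of "cinner z u"] cmod_cinner_le[of z u] by linarith
  then have nz: "norm z \<le> norm u" by (cases "z = 0") (auto simp: power2_eq_square)
  have "cmod (1 + cinner z u) \<le> 1 + norm z * norm u"
    using norm_triangle_ineq[of 1 "cinner z u"] cmod_cinner_le[of z u] by simp
  also have "\<dots> \<le> 1 + (norm u)\<^sup>2" using nz by (simp add: power2_eq_square mult_right_mono)
  finally show "cmod (opdet \<phi> n (\<lambda>x. L x + cinner x u *\<^sub>C u)) \<le> cmod (opdet \<phi> n L) * (1 + (norm u)\<^sup>2)"
    unfolding eq norm_mult by (rule mult_left_mono) simp
  assume Lu: "L u = u"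
  have "z = u"
  proof -
    have lin: "clinear L" using L by (simp add: accretive_def)
    have "L (z + (-1) *\<^sub>C u) = L z + (-1) *\<^sub>C L u" by (simp only: clinearD[OF lin])
    then have "L (z + (-1) *\<^sub>C u) = 0" by (simp add: z Lu scaleC_minus_one)
    moreover have "z + (-1) *\<^sub>C u \<in> coord_span \<phi> n" by (intro coord_span_add coord_span_scale z u)
    ultimately have "(norm (z + (-1) *\<^sub>C u))\<^sup>2 \<le> 0" using L by (force simp: accretive_def)
    then show ?thesis by (simp add: scaleC_minus_one)
  qed
  then show "opdet \<phi> n (\<lambda>x. L x + cinner x u *\<^sub>C u) = opdet \<phi> n L * of_real (1 + (norm u)\<^sup>2)"
    using eq by (simp add: cinner_self)
qed

lemma accretive_opdet_sum:
  assumes L: "accretive \<phi> n L" and fin: "finite I" and u: "\<And>k. k \<in> I \<Longrightarrow> u k \<in> coord_span \<phi> n"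
  shows "accretive \<phi> n (\<lambda>x. L x + (\<Sum>k\<in>I. cinner x (u k) *\<^sub>C u k))"
    and "cmod (opdet \<phi> n L) \<le> cmod (opdet \<phi> n (\<lambda>x. L x + (\<Sum>k\<in>I. cinner x (u k) *\<^sub>C u k)))"
    and "cmod (opdet \<phi> n (\<lambda>x. L x + (\<Sum>k\<in>I. cinner x (u k) *\<^sub>C u k))) \<le>
      cmod (opdet \<phi> n L) * exp (\<Sum>k\<in>I. (norm (u k))\<^sup>2)"
proof -
  have "accretive \<phi> n (\<lambda>x. L x + (\<Sum>k\<in>I. cinner x (u k) *\<^sub>C u k)) \<and>
    cmod (opdet \<phi> n L) \<le> cmod (opdet \<phi> n (\<lambda>x. L x + (\<Sum>k\<in>I. cinner x (u k) *\<^sub>C u k))) \<and>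
    cmod (opdet \<phi> n (\<lambda>x. L x + (\<Sum>k\<in>I. cinner x (u k) *\<^sub>C u k))) \<le>
      cmod (opdet \<phi> n L) * exp (\<Sum>k\<in>I. (norm (u k))\<^sup>2)"
    using fin u
  proof (induction I)
    case empty
    then show ?case using L by simp
  next
    case (insert k I)
    define L' where "L' x = L x + (\<Sum>k\<in>I. cinner x (u k) *\<^sub>C u k)" for x
    have IH: "accretive \<phi> n L'" "cmod (opdet \<phi> n L) \<le> cmod (opdet \<phi> n L')"
      "cmod (opdet \<phi> n L') \<le> cmod (opdet \<phi> n L) * exp (\<Sum>k\<in>I. (norm (u k))\<^sup>2)"
      using insert.IH insert.prems unfolding L'_def[abs_def] by blast+
    have uk: "u k \<in> coord_span \<phi> n" using insert.prems by simp
    have eq: "(\<lambda>x. L x + (\<Sum>k\<in>insert k I. cinner x (u k) *\<^sub>C u k)) = (\<lambda>x. L' x + cinner x (u k) *\<^sub>C u k)"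
      using insert.hyps by (simp add: L'_def fun_eq_iff add_ac)
    have "cmod (opdet \<phi> n L) * exp (\<Sum>k\<in>I. (norm (u k))\<^sup>2) * (1 + (norm (u k))\<^sup>2)
        \<le> cmod (opdet \<phi> n L) * exp (\<Sum>k\<in>I. (norm (u k))\<^sup>2) * exp ((norm (u k))\<^sup>2)"
      by (intro mult_left_mono exp_ge_add_one_self) auto
    also have "\<dots> = cmod (opdet \<phi> n L) * exp (\<Sum>k\<in>insert k I. (norm (u k))\<^sup>2)"
      using insert.hyps by (simp add: exp_add)
    finally have "cmod (opdet \<phi> n L) * exp (\<Sum>k\<in>I. (norm (u k))\<^sup>2) * (1 + (norm (u k))\<^sup>2)
        \<le> cmod (opdet \<phi> n L) * exp (\<Sum>k\<in>insert k I. (norm (u k))\<^sup>2)" .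
    moreover have "cmod (opdet \<phi> n (\<lambda>x. L' x + cinner x (u k) *\<^sub>C u k)) \<le> cmod (opdet \<phi> n L') * (1 + (norm (u k))\<^sup>2)"
      by (rule accretive_opdet_rank_one(2)[OF IH(1) uk])
    moreover have "cmod (opdet \<phi> n L') * (1 + (norm (u k))\<^sup>2) \<le> cmod (opdet \<phi> n L) * exp (\<Sum>k\<in>I. (norm (u k))\<^sup>2) * (1 + (norm (u k))\<^sup>2)"
      by (intro mult_right_mono IH(3)) simp
    moreover note accretive_opdet_rank_one(1)[OF IH(1) uk] accretive_plus_rank_one[OF IH(1) uk] IH(2)
    ultimately show ?case unfolding eq by (meson order_trans)
  qed
  then show "accretive \<phi> n (\<lambda>x. L x + (\<Sum>k\<in>I. cinner x (u k) *\<^sub>C u k))"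
    and "cmod (opdet \<phi> n L) \<le> cmod (opdet \<phi> n (\<lambda>x. L x + (\<Sum>k\<in>I. cinner x (u k) *\<^sub>C u k)))"
    and "cmod (opdet \<phi> n (\<lambda>x. L x + (\<Sum>k\<in>I. cinner x (u k) *\<^sub>C u k))) \<le>
      cmod (opdet \<phi> n L) * exp (\<Sum>k\<in>I. (norm (u k))\<^sup>2)" by blast+
qed

lemma accretive_id: "accretive \<phi> n (\<lambda>x. x)"
  by (simp add: accretive_def clinear_iff norm_eq_Re_cinner)

lemma opdet_orthogonal_sum:
  fixes m :: nat
  assumes u: "\<And>k. k < m \<Longrightarrow> u k \<in> coord_span \<phi> n"
    and orth: "\<And>k l. k < m \<Longrightarrow> l < k \<Longrightarrow> cinner (u k) (u l) = 0"
  shows "opdet \<phi> n (\<lambda>x. x + (\<Sum>k<m. cinner x (u k) *\<^sub>C u k)) = of_real (\<Prod>k<m. 1 + (norm (u k))\<^sup>2)"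
  using u orth
proof (induction m)
  case 0
  then show ?case by (simp add: opdet_id)
next
  case (Suc m)
  define L where "L x = x + (\<Sum>k<m. cinner x (u k) *\<^sub>C u k)" for x
  have acc: "accretive \<phi> n L"
    unfolding L_def[abs_def] by (rule accretive_opdet_sum(1)[OF accretive_id]) (use Suc.prems(1) in auto)
  have "L (u m) = u m" unfolding L_def using Suc.prems(2)[of m] by simp
  then have "opdet \<phi> n (\<lambda>x. L x + cinner x (u m) *\<^sub>C u m) = opdet \<phi> n L * of_real (1 + (norm (u m))\<^sup>2)"
    by (intro accretive_opdet_rank_one(3)[OF acc]) (use Suc.prems(1) in auto)
  also have "opdet \<phi> n L = of_real (\<Prod>k<m. 1 + (norm (u k))\<^sup>2)"
    unfolding L_def[abs_def] by (rule Suc.IH) (use Suc.prems in auto)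
  finally show ?case by (simp add: L_def add.assoc)
qed

end

section \<open>The determinant inequality for the Schur multiplier\<close>

lemma compact_operator_add:
  fixes S T :: "'a::complex_inner \<Rightarrow> 'b::complex_inner"
  assumes S: "compact_operator S" and T: "compact_operator T"
  shows "compact_operator (\<lambda>x. S x + T x)"
proof (rule compact_operatorI)
  have "clinear S" "clinear T" using S T by (auto simp: compact_operator_def)
  then show "clinear (\<lambda>x. S x + T x)"
    by (simp add: clinear_iff scaleC_add_right)
  fix x :: "nat \<Rightarrow> 'a" and K assume K: "\<And>n. norm (x n) \<le> K"
  obtain r l where r: "strict_mono (r :: nat \<Rightarrow> nat)" "(\<lambda>n. S (x (r n))) \<longlonglongrightarrow> l"
    by (rule compact_operator_subseq[OF S K])
  obtain q m where q: "strict_mono (q :: nat \<Rightarrow> nat)" "(\<lambda>n. T (x (r (q n)))) \<longlonglongrightarrow> m"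
    by (rule compact_operator_subseq[OF T, of "\<lambda>n. x (r n)" K]) (use K in auto)
  have "(\<lambda>n. S (x (r (q n)))) \<longlonglongrightarrow> l" using LIMSEQ_subseq_LIMSEQ[OF r(2) q(1)] by (simp add: o_def)
  then have "(\<lambda>n. S (x (r (q n))) + T (x (r (q n)))) \<longlonglongrightarrow> l + m" by (intro tendsto_add q)
  moreover have "strict_mono (\<lambda>n. r (q n))" using strict_mono_o[OF r(1) q(1)] by (simp add: o_def)
  ultimately show "\<exists>r l. strict_mono (r :: nat \<Rightarrow> nat) \<and> (\<lambda>n. S (x (r n)) + T (x (r n))) \<longlonglongrightarrow> l"
    by (intro exI[of _ "\<lambda>n. r (q n)"] exI[of _ "l + m"] conjI)
qed

lemma compact_operator_rank_one:
  "compact_operator (\<lambda>x. (c * cinner x (v :: 'a::complex_inner)) *\<^sub>C (u :: 'b::complex_inner))"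
proof (rule compact_operatorI)
  show "clinear (\<lambda>x. (c * cinner x v) *\<^sub>C u)"
    by (simp add: clinear_iff cinner_simps distrib_left scaleC_add_left scaleC_scaleC mult_ac)
  fix x :: "nat \<Rightarrow> 'a" and K assume K: "\<And>n. norm (x n) \<le> K"
  have "bounded (range (\<lambda>n. cinner (x n) v))"
    unfolding bounded_iff
  proof (intro exI[of _ "K * norm v"] ballI)
    fix z assume "z \<in> range (\<lambda>n. cinner (x n) v)"
    then obtain n where "z = cinner (x n) v" by blast
    then show "norm z \<le> K * norm v"
      using order_trans[OF cmod_cinner_le[of "x n" v] mult_right_mono[OF K norm_ge_zero]] by simp
  qed
  then obtain l r where r: "strict_mono (r :: nat \<Rightarrow> nat)" "((\<lambda>n. cinner (x n) v) \<circ> r) \<longlonglongrightarrow> l"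
    using bounded_imp_convergent_subsequence by blast
  have bl: "bounded_linear (\<lambda>z. (c * z) *\<^sub>C u)"
    by (rule bounded_linear_intro[of _ "cmod c * norm u"])
       (auto simp: distrib_left scaleC_add_left scaleR_scaleC scaleC_scaleC scaleR_conv_of_real norm_mult mult_ac)
  have "(\<lambda>n. (c * cinner (x (r n)) v) *\<^sub>C u) \<longlonglongrightarrow> (c * l) *\<^sub>C u"
    using bounded_linear.tendsto[OF bl r(2)] by (simp add: o_def)
  with r(1) show "\<exists>r l. strict_mono (r :: nat \<Rightarrow> nat) \<and> (\<lambda>n. (c * cinner (x (r n)) v) *\<^sub>C u) \<longlonglongrightarrow> l"
    by blast
qed

lemma compact_operator_0: "compact_operator (\<lambda>x :: 'a::complex_inner. 0 :: 'b::complex_inner)"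
  using compact_operator_rank_one[of 0 0 0] by simp

lemma compact_operator_sum:
  "(\<And>i. i \<in> I \<Longrightarrow> compact_operator (T i)) \<Longrightarrow> compact_operator (\<lambda>x. \<Sum>i\<in>I. T i x)"
  by (induction I rule: infinite_finite_induct) (auto simp: compact_operator_0 intro: compact_operator_add)

definition matop :: "(nat \<Rightarrow> 'a::complex_inner) \<Rightarrow> nat \<Rightarrow> (nat \<Rightarrow> nat \<Rightarrow> complex) \<Rightarrow> 'a \<Rightarrow> 'a"
  where "matop \<phi> n M x = (\<Sum>i<n. \<Sum>j<n. (M i j * cinner x (\<phi> j)) *\<^sub>C \<phi> i)"

lemma compact_matop: "compact_operator (matop \<phi> n M)"
  unfolding matop_def[abs_def] by (intro compact_operator_sum compact_operator_rank_one)

lemma matop_eq: "matop \<phi> n M x = (\<Sum>i<n. (\<Sum>j<n. M i j * cinner x (\<phi> j)) *\<^sub>C \<phi> i)"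
  by (simp add: matop_def complex_vector.scale_sum_left)

lemma bounded_clinear_matop: "bounded_clinear (matop \<phi> n M)"
  by (rule compact_operator_bounded_clinear[OF compact_matop])

lemma matop_scale: "matop \<phi> n (\<lambda>i j. c * M i j) x = c *\<^sub>C matop \<phi> n M x"
  by (simp add: matop_def complex_vector.scale_sum_right scaleC_scaleC mult.assoc)

lemma matop_add: "matop \<phi> n (\<lambda>i j. M i j + M' i j) x = matop \<phi> n M x + matop \<phi> n M' x"
  by (simp add: matop_def distrib_right scaleC_add_left sum.distrib)

lemma cinner_matop:
  "cinner (matop \<phi> n M x) y = (\<Sum>i<n. \<Sum>j<n. M i j * cinner x (\<phi> j) * cinner (\<phi> i) y)"
  by (simp add: matop_def cinner_sum_left cinner_scaleC_left)

lemma cinner_matop_adjoint: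
  "cinner (matop \<phi> n M x) y = cinner x (matop \<phi> n (\<lambda>i j. cnj (M j i)) y)"
proof -
  have "cinner x (matop \<phi> n (\<lambda>i j. cnj (M j i)) y) =
      (\<Sum>i<n. \<Sum>j<n. M j i * cinner (\<phi> j) y * cinner x (\<phi> i))"
    by (simp add: matop_def cinner_sum_right cinner_scaleC_right cinner_commute[of y])
  also have "\<dots> = (\<Sum>j<n. \<Sum>i<n. M j i * cinner (\<phi> j) y * cinner x (\<phi> i))" by (rule sum.swap)
  finally show ?thesis by (simp add: cinner_matop mult_ac)
qed

lemma cadjoint_matop:
  fixes \<phi> :: "nat \<Rightarrow> 'a::chilbert_space"
  shows "cadjoint (matop \<phi> n M) = matop \<phi> n (\<lambda>i j. cnj (M j i))"
proof (rule ext, rule cinner_ext)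
  fix y z
  have "cinner z (cadjoint (matop \<phi> n M) y) = cinner z (matop \<phi> n (\<lambda>i j. cnj (M j i)) y)"
    unfolding cinner_cadjoint[OF bounded_clinear_matop, symmetric] by (rule cinner_matop_adjoint)
  then show "cinner (cadjoint (matop \<phi> n M) y) z = cinner (matop \<phi> n (\<lambda>i j. cnj (M j i)) y) z"
    by (simp only: cinner_commute[of _ z])
qed

lemma matop_rank_one_sum:
  assumes "\<And>i j. i < n \<Longrightarrow> j < n \<Longrightarrow> M i j = (\<Sum>k\<in>Q. a k i * cnj (b k j))"
  shows "matop \<phi> n M x = (\<Sum>k\<in>Q. cinner x (\<Sum>i<n. b k i *\<^sub>C \<phi> i) *\<^sub>C (\<Sum>i<n. a k i *\<^sub>C \<phi> i))"
proof -
  have "(\<Sum>k\<in>Q. cinner x (\<Sum>i<n. b k i *\<^sub>C \<phi> i) *\<^sub>C (\<Sum>i<n. a k i *\<^sub>C \<phi> i)) =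
      (\<Sum>k\<in>Q. \<Sum>i<n. (\<Sum>j<n. a k i * cnj (b k j) * cinner x (\<phi> j)) *\<^sub>C \<phi> i)"
    by (simp add: cinner_sum_right cinner_scaleC_right complex_vector.scale_sum_right scaleC_scaleC
        sum_distrib_left sum_distrib_right mult_ac)
  also have "\<dots> = (\<Sum>i<n. \<Sum>k\<in>Q. (\<Sum>j<n. a k i * cnj (b k j) * cinner x (\<phi> j)) *\<^sub>C \<phi> i)"
    by (rule sum.swap)
  also have "\<dots> = (\<Sum>i<n. (\<Sum>k\<in>Q. \<Sum>j<n. a k i * cnj (b k j) * cinner x (\<phi> j)) *\<^sub>C \<phi> i)"
    by (simp add: complex_vector.scale_sum_left)
  also have "\<dots> = (\<Sum>i<n. (\<Sum>j<n. \<Sum>k\<in>Q. a k i * cnj (b k j) * cinner x (\<phi> j)) *\<^sub>C \<phi> i)"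
    by (subst sum.swap) simp
  also have "\<dots> = matop \<phi> n M x"
    unfolding matop_eq by (simp add: assms sum_distrib_right)
  finally show ?thesis ..
qed

text \<open>The Cauchy matrix is positive semidefinite, with an explicit decomposition: subtracting from it the
rank one matrix \<open>2 l\<^sub>n / ((l\<^sub>i + l\<^sub>n) (l\<^sub>j + l\<^sub>n))\<close> kills row and column \<open>n\<close> and leaves
\<open>t\<^sub>i t\<^sub>j / (l\<^sub>i + l\<^sub>j)\<close> with \<open>t\<^sub>i = (l\<^sub>i - l\<^sub>n) / (l\<^sub>i + l\<^sub>n)\<close>, a rescaled Cauchy matrix of smaller size.\<close>

lemma cauchy_matrix_rank_one_sum:
  fixes l :: "nat \<Rightarrow> real"
  assumes "\<And>i. i < n \<Longrightarrow> 0 < l i"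
  shows "\<exists>c :: nat \<Rightarrow> nat \<Rightarrow> real. \<forall>i<n. \<forall>j<n. 1 / (l i + l j) = (\<Sum>m<n. c m i * c m j)"
  using assms
proof (induction n)
  case (Suc n)
  obtain c where c: "\<And>i j. i < n \<Longrightarrow> j < n \<Longrightarrow> 1 / (l i + l j) = (\<Sum>m<n. c m i * c m j)"
  proof -
    have "\<exists>c :: nat \<Rightarrow> nat \<Rightarrow> real. \<forall>i<n. \<forall>j<n. 1 / (l i + l j) = (\<Sum>m<n. c m i * c m j)"
      by (rule Suc.IH) (use Suc.prems in simp)
    then show ?thesis using that by blast
  qed
  define t where "t i = (l i - l n) / (l i + l n)" for i
  define b where "b m i = (if m < n then (if i < n then t i * c m i else 0) else sqrt (2 * l n) / (l i + l n))" for m i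
  have "1 / (l i + l j) = (\<Sum>m<Suc n. b m i * b m j)" if ij: "i < Suc n" "j < Suc n" for i j
  proof -
    have pos: "l i > 0" "l j > 0" "l n > 0" using Suc.prems ij by auto
    have "(\<Sum>m<n. b m i * b m j) = t i * t j / (l i + l j)"
    proof (cases "i < n \<and> j < n")
      case True
      have "(\<Sum>m<n. b m i * b m j) = t i * t j * (\<Sum>m<n. c m i * c m j)"
        using True by (simp add: b_def sum_distrib_left mult_ac)
      also have "(\<Sum>m<n. c m i * c m j) = 1 / (l i + l j)" using c True by simp
      finally show ?thesis by simp
    next
      case False
      then have "t i * t j = 0" using ij by (auto simp: t_def less_Suc_eq)
      moreover have "(\<Sum>m<n. b m i * b m j) = 0" using False by (intro sum.neutral) (auto simp: b_def)
      ultimately show ?thesis by simp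
    qed
    moreover have "b n i * b n j = 2 * l n / ((l i + l n) * (l j + l n))"
      using pos by (simp add: b_def flip: real_sqrt_mult)
    moreover have "1 / (l i + l j) = t i * t j / (l i + l j) + 2 * l n / ((l i + l n) * (l j + l n))"
    proof -
      have ne: "l i + l j \<noteq> 0" "l i + l n \<noteq> 0" "l j + l n \<noteq> 0" using pos by auto
      have "t i * t j / (l i + l j) + 2 * l n / ((l i + l n) * (l j + l n)) =
          ((l i - l n) * (l j - l n) + 2 * l n * (l i + l j)) / ((l i + l n) * (l j + l n) * (l i + l j))"
        using ne by (simp add: t_def divide_simps)
      also have "(l i - l n) * (l j - l n) + 2 * l n * (l i + l j) = (l i + l n) * (l j + l n)"
        by (simp add: algebra_simps)
      finally show ?thesis using ne by simp
    qed
    ultimately show ?thesis by simp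
  qed
  then show ?case by blast
qed simp

lemma schur_multiplier_skew:
  fixes l :: "nat \<Rightarrow> real"
  assumes Y: "\<And>i j. Y i j = of_real ((l i - l j) / (l i + l j)) * D i j"
    and D: "i < n \<Longrightarrow> j < n \<Longrightarrow> D i j = (\<Sum>k\<in>Q. d k i * cnj (d k j))"
      "j < n \<Longrightarrow> i < n \<Longrightarrow> D j i = (\<Sum>k\<in>Q. d k j * cnj (d k i))"
    and ij: "i < n" "j < n"
  shows "cnj (Y j i) = - Y i j"
proof -
  have "(l j - l i) / (l j + l i) = - ((l i - l j) / (l i + l j))"
    by (simp add: add.commute[of "l j"] minus_divide_left)
  then show ?thesis by (simp add: Y D ij mult.commute)
qed

text \<open>The core of the proof.  Adding the positive \<open>D\<close> to \<open>1 + Y\<close> does not decrease the modulus of the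
determinant, because \<open>Y\<close> is skew-adjoint.  The entries of \<open>Y + D\<close> are \<open>2 l\<^sub>i D\<^sub>i\<^sub>j / (l\<^sub>i + l\<^sub>j)\<close>; conjugating
with \<open>l\<^sup>\<onehalf>\<close> turns them into the positive matrix \<open>Z\<^sub>i\<^sub>j = 2 (l\<^sub>i l\<^sub>j)\<^sup>\<onehalf> D\<^sub>i\<^sub>j / (l\<^sub>i + l\<^sub>j)\<close>, which has the same
diagonal as \<open>D\<close>.  Finally \<open>det (1 + Z) \<le> exp (tr Z)\<close>.\<close>

lemma schur_opdet_bound:
  fixes \<phi> :: "nat \<Rightarrow> 'a::complex_inner"
  assumes on: "orthonormal {..<n} \<phi>" and l: "\<And>i. i < n \<Longrightarrow> (0 :: real) < l i"
    and D: "\<And>i j. i < n \<Longrightarrow> j < n \<Longrightarrow> D i j = (\<Sum>k\<in>Q. d k i * cnj (d k j))" and Q: "finite Q"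
    and Y: "\<And>i j. Y i j = of_real ((l i - l j) / (l i + l j)) * D i j"
  shows "cmod (opdet \<phi> n (\<lambda>x. x + matop \<phi> n Y x)) \<le> exp (\<Sum>i<n. \<Sum>k\<in>Q. (cmod (d k i))\<^sup>2)"
proof -
  define u where "u k = (\<Sum>i<n. d k i *\<^sub>C \<phi> i)" for k
  have u: "u k \<in> coord_span \<phi> n" for k unfolding u_def by (rule coord_span_sum[OF on])
  have Yh: "cnj (Y j i) = - Y i j" if "i < n" "j < n" for i j
    by (rule schur_multiplier_skew[where d = d, OF Y D D that])
  have acc: "accretive \<phi> n (\<lambda>x. x + matop \<phi> n Y x)"
    unfolding accretive_def
  proof (intro conjI ballI)
    show "clinear (\<lambda>x. x + matop \<phi> n Y x)"
      by (simp add: clinear_iff bounded_clinearD[OF bounded_clinear_matop] scaleC_add_right)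
    fix x assume x: "x \<in> coord_span \<phi> n"
    show "x + matop \<phi> n Y x \<in> coord_span \<phi> n"
      unfolding matop_eq by (rule coord_span_add[OF on x coord_span_sum[OF on]])
    have "matop \<phi> n (\<lambda>i j. cnj (Y j i)) x = - matop \<phi> n Y x"
    proof -
      have "matop \<phi> n (\<lambda>i j. cnj (Y j i)) x = matop \<phi> n (\<lambda>i j. (-1) * Y i j) x"
        unfolding matop_def by (intro sum.cong refl) (simp add: Yh)
      then show ?thesis by (simp only: matop_scale scaleC_minus_one)
    qed
    then have "cinner (matop \<phi> n Y x) x = - cinner x (matop \<phi> n Y x)"
      by (simp add: cinner_matop_adjoint[of _ _ Y] cinner_minus_right)
    then have "Re (cinner (matop \<phi> n Y x) x) = 0"
      using arg_cong[OF cinner_commute[of x "matop \<phi> n Y x"], of Re] by simp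
    then show "(norm x)\<^sup>2 \<le> Re (cinner (x + matop \<phi> n Y x) x)"
      by (simp add: cinner_add_left norm_eq_Re_cinner)
  qed
  have "cmod (opdet \<phi> n (\<lambda>x. x + matop \<phi> n Y x)) \<le>
      cmod (opdet \<phi> n (\<lambda>x. x + matop \<phi> n Y x + (\<Sum>k\<in>Q. cinner x (u k) *\<^sub>C u k)))"
    by (rule accretive_opdet_sum(2)[OF on acc Q u])
  also have "(\<lambda>x. x + matop \<phi> n Y x + (\<Sum>k\<in>Q. cinner x (u k) *\<^sub>C u k)) =
      (\<lambda>x. x + matop \<phi> n (\<lambda>i j. Y i j + D i j) x)"
    using matop_rank_one_sum[where \<phi> = \<phi>, OF D] by (simp add: fun_eq_iff matop_add u_def add.assoc)
  also have "opdet \<phi> n \<dots> = fdet n (\<lambda>i j. (if i = j then 1 else 0) + (Y i j + D i j))"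
    unfolding opdet_def
  proof (rule fdet_cong)
    fix i j assume ij: "i < n" "j < n"
    have "(\<Sum>a<n. \<Sum>b<n. (Y a b + D a b) * cinner (\<phi> j) (\<phi> b) * cinner (\<phi> a) (\<phi> i)) =
        (\<Sum>a<n. \<Sum>b<n. if b = j then (if a = i then Y i j + D i j else 0) else 0)"
      by (intro sum.cong refl) (use ij orthonormalD[OF on] in auto)
    then show "cinner (\<phi> j + matop \<phi> n (\<lambda>i j. Y i j + D i j) (\<phi> j)) (\<phi> i) =
        (if i = j then 1 else 0) + (Y i j + D i j)"
      using ij orthonormalD[OF on, of j i] by (simp add: cinner_add_left cinner_matop)
  qed
  also have "\<dots> = fdet n (\<lambda>i j. of_real (sqrt (l i)) *
      ((if i = j then 1 else 0) + of_real (2 * sqrt (l i) * sqrt (l j) / (l i + l j)) * D i j) / of_real (sqrt (l j)))"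
  proof (rule fdet_cong)
    fix i j assume ij: "i < n" "j < n"
    have pos: "l i > 0" "l j > 0" using ij l by auto
    have "Y i j + D i j = of_real ((l i - l j) / (l i + l j) + 1) * D i j" by (simp add: Y algebra_simps)
    also have "(l i - l j) / (l i + l j) + 1 = sqrt (l i) * (2 * sqrt (l i) * sqrt (l j) / (l i + l j)) / sqrt (l j)"
    proof -
      have "sqrt (l i) * (2 * sqrt (l i) * sqrt (l j) / (l i + l j)) / sqrt (l j) =
          2 * (sqrt (l i) * sqrt (l i)) / (l i + l j)" using pos by simp
      also have "\<dots> = 2 * l i / (l i + l j)" using pos by simp
      also have "\<dots> = (l i - l j) / (l i + l j) + 1" using pos by (simp add: field_simps)
      finally show ?thesis ..
    qed
    finally have e1: "Y i j + D i j = of_real (sqrt (l i)) * (of_real (2 * sqrt (l i) * sqrt (l j) / (l i + l j)) * D i j) / of_real (sqrt (l j))"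
      by (simp add: mult_ac)
    have e2: "(if i = j then 1 else 0 :: complex) = of_real (sqrt (l i)) * (if i = j then 1 else 0) / of_real (sqrt (l j))"
      using pos by simp
    show "(if i = j then 1 else 0) + (Y i j + D i j) = of_real (sqrt (l i)) *
      ((if i = j then 1 else 0) + of_real (2 * sqrt (l i) * sqrt (l j) / (l i + l j)) * D i j) / of_real (sqrt (l j))"
      unfolding distrib_left add_divide_distrib e1[symmetric] e2[symmetric] ..
  qed
  also have "\<dots> = fdet n (\<lambda>i j. (if i = j then 1 else 0) + of_real (2 * sqrt (l i) * sqrt (l j) / (l i + l j)) * D i j)"
    by (rule fdet_similar) (use l in force)
  also have "\<dots> = opdet \<phi> n (\<lambda>x. x + matop \<phi> n (\<lambda>i j. of_real (2 * sqrt (l i) * sqrt (l j) / (l i + l j)) * D i j) x)"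
    (is "_ = opdet \<phi> n (\<lambda>x. x + matop \<phi> n ?Z x)")
    unfolding opdet_def
  proof (rule fdet_cong)
    fix i j assume ij: "i < n" "j < n"
    have "(\<Sum>a<n. \<Sum>b<n. ?Z a b * cinner (\<phi> j) (\<phi> b) * cinner (\<phi> a) (\<phi> i)) =
        (\<Sum>a<n. \<Sum>b<n. if b = j then (if a = i then ?Z i j else 0) else 0)"
      by (intro sum.cong refl) (use ij orthonormalD[OF on] in auto)
    then show "(if i = j then 1 else 0) + ?Z i j = cinner (\<phi> j + matop \<phi> n ?Z (\<phi> j)) (\<phi> i)"
      using ij orthonormalD[OF on, of j i] by (simp add: cinner_add_left cinner_matop)
  qed
  finally have 1: "cmod (opdet \<phi> n (\<lambda>x. x + matop \<phi> n Y x)) \<le> cmod (opdet \<phi> n (\<lambda>x. x + matop \<phi> n ?Z x))" .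
  obtain c :: "nat \<Rightarrow> nat \<Rightarrow> real" where c: "\<And>i j. i < n \<Longrightarrow> j < n \<Longrightarrow> 1 / (l i + l j) = (\<Sum>m<n. c m i * c m j)"
    using cauchy_matrix_rank_one_sum[of n l] l by blast
  define w where "w p i = of_real (sqrt (2 * l i) * c (snd p) i) * d (fst p) i" for p :: "'b \<times> nat" and i
  define v where "v p = (\<Sum>i<n. w p i *\<^sub>C \<phi> i)" for p
  have v: "v p \<in> coord_span \<phi> n" for p unfolding v_def by (rule coord_span_sum[OF on])
  have Z: "?Z i j = (\<Sum>p\<in>Q \<times> {..<n}. w p i * cnj (w p j))" if "i < n" "j < n" for i j
  proof -
    have "2 * sqrt (l i) * sqrt (l j) / (l i + l j) = sqrt (2 * l i) * sqrt (2 * l j) * (1 / (l i + l j))"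
      by (simp add: real_sqrt_mult)
    also have "\<dots> = (\<Sum>m<n. (sqrt (2 * l i) * c m i) * (sqrt (2 * l j) * c m j))"
      unfolding c[OF that] by (simp add: sum_distrib_left mult_ac)
    finally have "?Z i j = of_real (\<Sum>m<n. (sqrt (2 * l i) * c m i) * (sqrt (2 * l j) * c m j)) * (\<Sum>k\<in>Q. d k i * cnj (d k j))"
      by (simp only: D[OF that])
    also have "\<dots> = (\<Sum>k\<in>Q. \<Sum>m<n. of_real ((sqrt (2 * l i) * c m i) * (sqrt (2 * l j) * c m j)) * (d k i * cnj (d k j)))"
      by (simp only: of_real_sum sum_distrib_left sum_distrib_right)
    also have "\<dots> = (\<Sum>p\<in>Q \<times> {..<n}. w p i * cnj (w p j))"
      unfolding sum.cartesian_product by (rule sum.cong) (auto simp: w_def mult_ac)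
    finally show ?thesis .
  qed
  have "cmod (opdet \<phi> n (\<lambda>x. x + matop \<phi> n ?Z x)) = cmod (opdet \<phi> n (\<lambda>x. x + (\<Sum>p\<in>Q \<times> {..<n}. cinner x (v p) *\<^sub>C v p)))"
    using matop_rank_one_sum[where \<phi> = \<phi>, OF Z] by (simp add: v_def)
  also have "\<dots> \<le> cmod (opdet \<phi> n (\<lambda>x. x)) * exp (\<Sum>p\<in>Q \<times> {..<n}. (norm (v p))\<^sup>2)"
    by (rule accretive_opdet_sum(3)[OF on accretive_id[OF on] _ v]) (use Q in simp)
  also have "(\<Sum>p\<in>Q \<times> {..<n}. (norm (v p))\<^sup>2) = (\<Sum>i<n. \<Sum>k\<in>Q. (cmod (d k i))\<^sup>2)"
  proof -
    have "(\<Sum>p\<in>Q \<times> {..<n}. (norm (v p))\<^sup>2) = (\<Sum>p\<in>Q \<times> {..<n}. \<Sum>i<n. (cmod (w p i))\<^sup>2)"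
      unfolding v_def by (intro sum.cong refl norm_orthonormal_sum[OF on]) simp
    also have "\<dots> = (\<Sum>i<n. \<Sum>p\<in>Q \<times> {..<n}. (cmod (w p i))\<^sup>2)" by (rule sum.swap)
    also have "\<dots> = (\<Sum>i<n. \<Sum>k\<in>Q. (cmod (d k i))\<^sup>2)"
    proof (rule sum.cong[OF refl])
      fix i assume "i \<in> {..<n}"
      then have i: "i < n" by simp
      have "(\<Sum>p\<in>Q \<times> {..<n}. (cmod (w p i))\<^sup>2) = (\<Sum>k\<in>Q. \<Sum>m<n. (cmod (w (k, m) i))\<^sup>2)"
        by (simp add: sum.cartesian_product case_prod_beta')
      also have "\<dots> = (\<Sum>k\<in>Q. (cmod (d k i))\<^sup>2 * (2 * l i * (\<Sum>m<n. c m i * c m i)))"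
        using l[OF i] by (simp add: w_def norm_mult power_mult_distrib sum_distrib_left mult_ac flip: power2_eq_square)
      also have "2 * l i * (\<Sum>m<n. c m i * c m i) = 1"
        unfolding c[OF i i, symmetric] using l[OF i] by simp
      finally show "(\<Sum>p\<in>Q \<times> {..<n}. (cmod (w p i))\<^sup>2) = (\<Sum>k\<in>Q. (cmod (d k i))\<^sup>2)" by simp
    qed
    finally show ?thesis .
  qed
  finally show ?thesis using 1 by (simp add: opdet_id[OF on])
qed

text \<open>\<open>|det (1 + Y)|\<^sup>2 = det ((1 + Y) (1 - Y)) = det (1 + Y\<^sup>* Y)\<close>, and the singular vectors diagonalise
\<open>Y\<^sup>* Y\<close>.  Those with nonzero singular value lie in the span of \<open>\<phi>\<close>, so there are at most \<open>n\<close> of them.\<close>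

lemma schur_singular_bound:
  fixes \<phi> :: "nat \<Rightarrow> 'a::chilbert_space"
  assumes on: "orthonormal {..<n} \<phi>" and l: "\<And>i. i < n \<Longrightarrow> (0 :: real) < l i"
    and D: "\<And>i j. i < n \<Longrightarrow> j < n \<Longrightarrow> D i j = (\<Sum>k\<in>Q. d k i * cnj (d k j))" and Q: "finite Q"
    and Y: "\<And>i j. Y i j = of_real ((l i - l j) / (l i + l j)) * D i j"
    and svd: "svd_basis (matop \<phi> n Y) e"
  shows "(\<Prod>k<n. 1 + (norm (matop \<phi> n Y (e k)))\<^sup>2) \<le> exp (2 * (\<Sum>i<n. \<Sum>k\<in>Q. (cmod (d k i))\<^sup>2))"
    and "k \<ge> n \<Longrightarrow> matop \<phi> n Y (e k) = 0"
proof -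
  let ?T = "matop \<phi> n Y"
  have T: "bounded_clinear ?T" by (rule bounded_clinear_matop)
  note comp = compact_matop[of \<phi> n Y]
  have Yh: "cnj (Y j i) = - Y i j" if "i < n" "j < n" for i j
    by (rule schur_multiplier_skew[where d = d, OF Y D D that])
  have adj: "cadjoint ?T x = - ?T x" for x
  proof -
    have "cadjoint ?T x = matop \<phi> n (\<lambda>i j. (-1) * Y i j) x"
      unfolding cadjoint_matop unfolding matop_def by (intro sum.cong refl) (simp add: Yh)
    then show ?thesis by (simp only: matop_scale scaleC_minus_one)
  qed
  have ran: "?T x \<in> coord_span \<phi> n" for x unfolding matop_eq by (rule coord_span_sum[OF on])
  let ?s = "\<lambda>k. norm (?T (e k))"
  have eig: "?T (?T (e k)) = - ((?s k)\<^sup>2 *\<^sub>R e k)" for k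
    using arg_cong[OF svd_eigen[OF comp svd, of k], of uminus] unfolding adj minus_minus .
  have mem: "e k \<in> coord_span \<phi> n" if "?T (e k) \<noteq> 0" for k
  proof -
    have "e k = of_real (- 1 / (?s k)\<^sup>2) *\<^sub>C ?T (?T (e k))"
      unfolding eig scaleR_scaleC[symmetric] using that by simp
    also have "\<dots> \<in> coord_span \<phi> n" by (intro coord_span_scale[OF on] ran)
    finally show ?thesis .
  qed
  have zero: "?T (e k) = 0" if k: "k \<ge> n" for k
  proof (rule ccontr)
    assume nz: "?T (e k) \<noteq> 0"
    have ek: "e j \<in> coord_span \<phi> n" if "j \<le> n" for j
    proof (rule mem)
      have "?s k \<le> ?s j" using svd_decseq[OF comp svd] k that by (simp add: decseq_def)
      then show "?T (e j) \<noteq> 0" using nz by auto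
    qed
    have "real (Suc n) = (\<Sum>j\<le>n. (norm (e j))\<^sup>2)"
      by (simp add: orthonormal_norm[OF svd_orthonormal[OF comp svd, of UNIV]])
    also have "\<dots> = (\<Sum>j\<le>n. \<Sum>i<n. (cmod (cinner (e j) (\<phi> i)))\<^sup>2)"
      by (intro sum.cong refl coord_span_parseval[OF on, symmetric] ek) simp
    also have "\<dots> = (\<Sum>i<n. \<Sum>j\<le>n. (cmod (cinner (\<phi> i) (e j)))\<^sup>2)"
      by (subst sum.swap) (simp add: cinner_commute[of "\<phi> _" "e _"])
    also have "\<dots> \<le> (\<Sum>i<n. (norm (\<phi> i))\<^sup>2)"
      by (intro sum_mono bessel[OF svd_orthonormal[OF comp svd]]) simp
    also have "\<dots> = real n" by (simp add: orthonormal_norm[OF on])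
    finally show False by simp
  qed
  then show "k \<ge> n \<Longrightarrow> ?T (e k) = 0" .
  define u where "u k = ?s k *\<^sub>R e k" for k
  have u: "u k \<in> coord_span \<phi> n" for k
    unfolding u_def scaleR_scaleC using mem[of k]
    by (cases "?T (e k) = 0") (simp_all add: coord_span_0[OF on] coord_span_scale[OF on])
  have Texp: "?T x = (\<Sum>k<n. cinner x (e k) *\<^sub>C ?T (e k))" for x
  proof (rule LIMSEQ_unique[OF svd_expansion[OF comp svd]])
    have stable: "(\<Sum>k<N. cinner x (e k) *\<^sub>C ?T (e k)) = (\<Sum>k<n. cinner x (e k) *\<^sub>C ?T (e k))" if "N \<ge> n" for N
      by (rule sum.mono_neutral_right) (use that zero in auto)
    show "(\<lambda>N. \<Sum>k<N. cinner x (e k) *\<^sub>C ?T (e k)) \<longlonglongrightarrow> (\<Sum>k<n. cinner x (e k) *\<^sub>C ?T (e k))"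
      by (intro tendsto_eventually eventually_sequentiallyI[of n]) (rule stable)
  qed
  have TT: "- ?T (?T x) = (\<Sum>k<n. cinner x (u k) *\<^sub>C u k)" for x
  proof -
    have "- ?T (?T x) = - (\<Sum>k<n. cinner x (e k) *\<^sub>C ?T (?T (e k)))"
      by (subst Texp[of x]) (simp add: bounded_clinearD[OF T])
    also have "\<dots> = (\<Sum>k<n. cinner x (u k) *\<^sub>C u k)"
      unfolding eig sum_negf[symmetric]
      by (intro sum.cong refl)
         (simp add: u_def cinner_simps scaleR_scaleC scaleC_scaleC power2_eq_square mult_ac)
    finally show ?thesis .
  qed
  let ?p = "opdet \<phi> n (\<lambda>x. x + ?T x)"
  have lin: "clinear (\<lambda>x. x + ?T x)"
    by (simp add: clinear_iff bounded_clinearD[OF T] scaleC_add_right)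
  have "?p * cnj ?p = ?p * opdet \<phi> n (\<lambda>x. x - ?T x)"
  proof -
    have "cinner (x - ?T x) y = cinner x (y + ?T y)" for x y
    proof -
      have "cinner (?T x) y = - cinner x (?T y)"
        by (simp add: cinner_cadjoint[OF T] adj cinner_minus_right)
      then show ?thesis by (simp add: cinner_simps)
    qed
    then have "opdet \<phi> n (\<lambda>x. x - ?T x) = cnj ?p" by (intro opdet_adjoint[OF on])
    then show ?thesis by simp
  qed
  also have "\<dots> = opdet \<phi> n (\<lambda>x. (x - ?T x) + ?T (x - ?T x))"
  proof (rule opdet_comp[OF on lin, symmetric])
    fix x assume x: "x \<in> coord_span \<phi> n"
    have "x + (-1) *\<^sub>C ?T x \<in> coord_span \<phi> n" by (intro coord_span_add[OF on] coord_span_scale[OF on] x ran)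
    then show "x - ?T x \<in> coord_span \<phi> n" by (simp add: scaleC_minus_one)
  qed
  also have "(\<lambda>x. (x - ?T x) + ?T (x - ?T x)) = (\<lambda>x. x + (\<Sum>k<n. cinner x (u k) *\<^sub>C u k))"
    by (simp add: fun_eq_iff bounded_clinearD[OF T] flip: TT)
  also have "opdet \<phi> n \<dots> = of_real (\<Prod>k<n. 1 + (norm (u k))\<^sup>2)"
    by (rule opdet_orthogonal_sum[OF on u])
       (simp add: u_def cinner_simps orthonormalD[OF svd_orthonormal[OF comp svd, of UNIV]])
  also have "(\<Prod>k<n. 1 + (norm (u k))\<^sup>2) = (\<Prod>k<n. 1 + (?s k)\<^sup>2)"
    by (simp add: u_def orthonormal_norm[OF svd_orthonormal[OF comp svd, of UNIV]])
  finally have "of_real ((cmod ?p)\<^sup>2) = (of_real (\<Prod>k<n. 1 + (?s k)\<^sup>2) :: complex)"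
    by (simp only: complex_norm_square)
  then have eq: "(cmod ?p)\<^sup>2 = (\<Prod>k<n. 1 + (?s k)\<^sup>2)" by (simp only: of_real_eq_iff)
  have "(cmod ?p)\<^sup>2 \<le> (exp (\<Sum>i<n. \<Sum>k\<in>Q. (cmod (d k i))\<^sup>2))\<^sup>2"
    by (intro power_mono schur_opdet_bound[OF on l D Q Y]) auto
  then show "(\<Prod>k<n. 1 + (?s k)\<^sup>2) \<le> exp (2 * (\<Sum>i<n. \<Sum>k\<in>Q. (cmod (d k i))\<^sup>2))"
    unfolding eq by (simp add: exp_double)
qed

section \<open>Counting large singular values of finite matrices\<close>

text \<open>\<open>M\<close> is the number of singular values above \<open>\<tau>\<close>.\<close>

lemma svd_threshold:
  fixes T :: "'a::chilbert_space \<Rightarrow> 'b::complex_inner"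
  assumes comp: "compact_operator T" and svd: "svd_basis T e" and \<tau>: "0 < \<tau>"
  obtains M where "\<forall>k<M. \<tau> < norm (T (e k))"
    "\<forall>x. (\<forall>k<M. cinner x (e k) = 0) \<longrightarrow> norm (T x) \<le> \<tau> * norm x"
proof -
  let ?A = "{k. \<tau> < norm (T (e k))}"
  have "\<forall>\<^sub>F k in sequentially. norm (T (e k)) < \<tau>"
    by (rule order_tendstoD(2)[OF svd_tendsto_0[OF comp svd] \<tau>])
  then obtain N where N: "\<And>k. k \<ge> N \<Longrightarrow> norm (T (e k)) < \<tau>" by (auto simp: eventually_sequentially)
  have "?A \<subseteq> {..<N}"
  proof
    fix k assume "k \<in> ?A"
    then show "k \<in> {..<N}" using N[of k] by (cases "k < N") auto
  qed
  then have fin: "finite ?A" by (rule finite_subset) simp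
  have iff: "k \<in> ?A \<longleftrightarrow> k < card ?A" for k
  proof (rule downset_card_iff[OF fin])
    fix j k assume "j \<le> k" "k \<in> ?A"
    then show "j \<in> ?A" using svd_decseq[OF comp svd] by (force simp: decseq_def)
  qed
  show ?thesis
  proof (rule that[of "card ?A"])
    show "\<forall>k<card ?A. \<tau> < norm (T (e k))" using iff by blast
    show "\<forall>x. (\<forall>k<card ?A. cinner x (e k) = 0) \<longrightarrow> norm (T x) \<le> \<tau> * norm x"
    proof (intro allI impI)
    fix x assume "\<forall>k<card ?A. cinner x (e k) = 0"
    then have "norm (T x) \<le> norm (T (e (card ?A))) * norm x" by (intro svd_le[OF comp svd]) simp
    also have "norm (T (e (card ?A))) \<le> \<tau>" using iff[of "card ?A"] by simp
    finally show "norm (T x) \<le> \<tau> * norm x" by (simp add: mult_right_mono)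
    qed
  qed
qed

text \<open>The matrix \<open>G\<close> has norm at most \<open>\<tau>\<close> on the common kernel of \<open>M\<close> linear functionals, that is, its
\<open>M\<close>-th singular value is at most \<open>\<tau>\<close>.  This form involves no Hilbert space, allows arbitrary finite
index sets, and adds up: imposing the functionals of several matrices makes all of them small.\<close>

definition singular_value_le :: "'k set \<Rightarrow> ('k \<Rightarrow> 'k \<Rightarrow> complex) \<Rightarrow> nat \<Rightarrow> real \<Rightarrow> bool"
  where "singular_value_le K G M \<tau> \<longleftrightarrow> (\<exists>v :: nat \<Rightarrow> 'k \<Rightarrow> complex. \<forall>\<xi>. (\<forall>m<M. (\<Sum>i\<in>K. \<xi> i * v m i) = 0) \<longrightarrow>
    (\<Sum>i\<in>K. (cmod (\<Sum>j\<in>K. G i j * \<xi> j))\<^sup>2) \<le> \<tau>\<^sup>2 * (\<Sum>j\<in>K. (cmod (\<xi> j))\<^sup>2))"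

lemma singular_value_le_reindex:
  fixes n :: nat
  assumes b: "bij_betw b {..<n} K" and sv: "singular_value_le {..<n} (\<lambda>i j. G (b i) (b j)) M \<tau>"
  shows "singular_value_le K G M \<tau>"
proof -
  obtain v :: "nat \<Rightarrow> nat \<Rightarrow> complex" where v: "\<And>\<xi>. (\<And>m. m < M \<Longrightarrow> (\<Sum>i<n. \<xi> i * v m i) = 0) \<Longrightarrow>
      (\<Sum>i<n. (cmod (\<Sum>j<n. G (b i) (b j) * \<xi> j))\<^sup>2) \<le> \<tau>\<^sup>2 * (\<Sum>j<n. (cmod (\<xi> j))\<^sup>2)"
    using sv unfolding singular_value_le_def by blast
  have re: "(\<Sum>i\<in>K. h i) = (\<Sum>i<n. h (b i))" for h :: "_ \<Rightarrow> 'z::comm_monoid_add"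
    by (rule sum.reindex_bij_betw[OF b, symmetric])
  let ?c = "the_inv_into {..<n} b"
  have inv: "?c (b i) = i" if "i < n" for i
    by (rule the_inv_into_f_f) (use b that in \<open>auto simp: bij_betw_def\<close>)
  show ?thesis
    unfolding singular_value_le_def
  proof (intro exI[of _ "\<lambda>m i. v m (?c i)"] allI impI)
    fix \<xi> assume \<xi>: "\<forall>m<M. (\<Sum>i\<in>K. \<xi> i * v m (?c i)) = 0"
    have "(\<Sum>i<n. \<xi> (b i) * v m i) = 0" if "m < M" for m
    proof -
      have "(\<Sum>i<n. \<xi> (b i) * v m i) = (\<Sum>i<n. \<xi> (b i) * v m (?c (b i)))"
        by (rule sum.cong) (auto simp: inv)
      also have "\<dots> = (\<Sum>i\<in>K. \<xi> i * v m (?c i))" by (rule re[symmetric])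
      finally show ?thesis using \<xi> that by simp
    qed
    from v[of "\<lambda>i. \<xi> (b i)", OF this]
    show "(\<Sum>i\<in>K. (cmod (\<Sum>j\<in>K. G i j * \<xi> j))\<^sup>2) \<le> \<tau>\<^sup>2 * (\<Sum>j\<in>K. (cmod (\<xi> j))\<^sup>2)"
      unfolding re .
  qed
qed

lemma singular_value_leI_matop:
  fixes \<phi> :: "nat \<Rightarrow> 'a::chilbert_space"
  assumes on: "orthonormal {..<n} \<phi>" and \<tau>: "0 \<le> \<tau>"
    and M: "\<And>x. (\<And>k. k < M \<Longrightarrow> cinner x (e k) = 0) \<Longrightarrow> norm (matop \<phi> n G x) \<le> \<tau> * norm x"
  shows "singular_value_le {..<n} G M \<tau>"
  unfolding singular_value_le_def
proof (intro exI[of _ "\<lambda>m i. cinner (\<phi> i) (e m)"] allI impI)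
  fix \<xi> :: "nat \<Rightarrow> complex" assume \<xi>: "\<forall>m<M. (\<Sum>i<n. \<xi> i * cinner (\<phi> i) (e m)) = 0"
  let ?x = "\<Sum>j<n. \<xi> j *\<^sub>C \<phi> j"
  have c: "cinner ?x (\<phi> j) = \<xi> j" if "j < n" for j
    using cinner_orthonormal_sum[OF on finite_lessThan order_refl, of j \<xi>] that by simp
  have "norm (matop \<phi> n G ?x) \<le> \<tau> * norm ?x"
    by (rule M) (use \<xi> in \<open>simp add: cinner_sum_left cinner_scaleC_left\<close>)
  then have "(norm (matop \<phi> n G ?x))\<^sup>2 \<le> (\<tau> * norm ?x)\<^sup>2" by (rule power_mono) simp
  also have "(norm (matop \<phi> n G ?x))\<^sup>2 = (\<Sum>i<n. (cmod (\<Sum>j<n. G i j * cinner ?x (\<phi> j)))\<^sup>2)"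
    unfolding matop_eq by (rule norm_orthonormal_sum[OF on]) simp
  also have "\<dots> = (\<Sum>i<n. (cmod (\<Sum>j<n. G i j * \<xi> j))\<^sup>2)" by (simp add: c)
  also have "(\<tau> * norm ?x)\<^sup>2 = \<tau>\<^sup>2 * (\<Sum>j<n. (cmod (\<xi> j))\<^sup>2)"
    unfolding power_mult_distrib norm_orthonormal_sum[OF on finite_lessThan] ..
  finally show "(\<Sum>i<n. (cmod (\<Sum>j<n. G i j * \<xi> j))\<^sup>2) \<le> \<tau>\<^sup>2 * (\<Sum>j<n. (cmod (\<xi> j))\<^sup>2)" .
qed

lemma orthonormal_sequence_exists:
  assumes "infinite_dimensional TYPE('a::chilbert_space)"
  obtains \<phi> :: "nat \<Rightarrow> 'a::chilbert_space" where "orthonormal UNIV \<phi>"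
proof -
  obtain e :: "nat \<Rightarrow> 'a" where "svd_basis (\<lambda>x :: 'a. 0 :: 'a) e"
    by (rule svd_basis_exists[OF compact_operator_0 assms])
  then have "orthonormal UNIV e" by (simp add: svd_basis_def)
  then show ?thesis by (rule that)
qed

text \<open>Scaling \<open>D\<close> by \<open>1 / \<tau>\<close> turns the threshold into \<open>1\<close>.  Each of the \<open>M\<close> singular values above \<open>1\<close> contributes
a factor of at least \<open>2\<close> to the product, so \<open>2 ^ M \<le> exp (2 tr D / \<tau>)\<close>; the constant \<open>3\<close> comes from
\<open>ln 2 \<ge> 2 / 3\<close>.  The space \<open>'a\<close> only serves to realise the matrix as an operator.\<close>

lemma schur_singular_value_le_nat:
  fixes n :: nat and l :: "nat \<Rightarrow> real"
  assumes inf: "infinite_dimensional TYPE('a::chilbert_space)"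
    and l: "\<And>i. i < n \<Longrightarrow> 0 < l i" and Q: "finite Q" and \<tau>: "0 < \<tau>"
  shows "\<exists>M. real M * \<tau> \<le> 3 * (\<Sum>i<n. \<Sum>k\<in>Q. (cmod (d k i))\<^sup>2) \<and>
    singular_value_le {..<n} (\<lambda>i j. of_real ((l i - l j) / (l i + l j)) * (\<Sum>k\<in>Q. d k i * cnj (d k j))) M \<tau>"
proof -
  obtain \<phi> :: "nat \<Rightarrow> 'a" where "orthonormal UNIV \<phi>" by (rule orthonormal_sequence_exists[OF inf])
  then have on: "orthonormal {..<n} \<phi>" by (rule orthonormal_subset) simp
  define d' where "d' k i = d k i / of_real (sqrt \<tau>)" for k i
  define D where "D i j = (\<Sum>k\<in>Q. d' k i * cnj (d' k j))" for i j
  define Y where "Y i j = of_real ((l i - l j) / (l i + l j)) * D i j" for i j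
  define S where "S = (\<Sum>i<n. \<Sum>k\<in>Q. (cmod (d k i))\<^sup>2)"
  have S': "(\<Sum>i<n. \<Sum>k\<in>Q. (cmod (d' k i))\<^sup>2) = S / \<tau>"
    using \<tau> by (simp add: S_def d'_def norm_divide power_divide sum_divide_distrib)
  have Dd: "(\<Sum>k\<in>Q. d k i * cnj (d k j)) = of_real \<tau> * D i j" for i j
  proof -
    have "of_real (sqrt \<tau>) * of_real (sqrt \<tau>) = (of_real \<tau> :: complex)"
      using \<tau> by (simp flip: of_real_mult)
    then show ?thesis using \<tau> by (simp add: D_def d'_def sum_distrib_left)
  qed
  obtain e where svd: "svd_basis (matop \<phi> n Y) e" by (rule svd_basis_exists[OF compact_matop inf])
  obtain M where M': "\<forall>k<M. 1 < norm (matop \<phi> n Y (e k))"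
      "\<forall>x. (\<forall>k<M. cinner x (e k) = 0) \<longrightarrow> norm (matop \<phi> n Y x) \<le> 1 * norm x"
    by (rule svd_threshold[OF compact_matop svd, of 1]) simp
  then have M: "k < M \<Longrightarrow> 1 < norm (matop \<phi> n Y (e k))"
      "(\<And>k. k < M \<Longrightarrow> cinner x (e k) = 0) \<Longrightarrow> norm (matop \<phi> n Y x) \<le> norm x" for k x by simp_all
  note sb = schur_singular_bound[OF on l D_def Q Y_def svd]
  have Mn: "M \<le> n"
  proof (rule ccontr)
    assume "\<not> M \<le> n"
    then have "1 < norm (matop \<phi> n Y (e n))" by (intro M(1)) simp
    then show False using sb(2)[of n] by simp
  qed
  have "(2::real) ^ M = (\<Prod>k<M. 2)" by simp
  also have "\<dots> \<le> (\<Prod>k<M. 1 + (norm (matop \<phi> n Y (e k)))\<^sup>2)"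
  proof (rule prod_mono)
    fix k assume "k \<in> {..<M}"
    then have "1\<^sup>2 \<le> (norm (matop \<phi> n Y (e k)))\<^sup>2" using M(1)[of k] by (intro power_mono) auto
    then show "0 \<le> (2::real) \<and> 2 \<le> 1 + (norm (matop \<phi> n Y (e k)))\<^sup>2" by simp
  qed
  also have "\<dots> \<le> (\<Prod>k<n. 1 + (norm (matop \<phi> n Y (e k)))\<^sup>2)"
    by (rule prod_mono2) (use Mn in auto)
  also have "\<dots> \<le> exp (2 * (S / \<tau>))" using sb(1) by (simp add: S')
  finally have "real M * ln 2 \<le> 2 * (S / \<tau>)"
    by (subst (asm) ln_le_cancel_iff[symmetric]) (simp_all add: ln_realpow)
  moreover have "real M * (2 / 3) \<le> real M * ln 2" by (intro mult_left_mono ln2_ge_two_thirds) simp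
  ultimately have "real M \<le> 3 * (S / \<tau>)" by linarith
  then have MS: "real M * \<tau> \<le> 3 * S" using \<tau> by (simp add: field_simps)
  have "singular_value_le {..<n} (\<lambda>i j. of_real \<tau> * Y i j) M \<tau>"
  proof (rule singular_value_leI_matop[OF on])
    show "norm (matop \<phi> n (\<lambda>i j. of_real \<tau> * Y i j) x) \<le> \<tau> * norm x"
      if "\<And>k. k < M \<Longrightarrow> cinner x (e k) = 0" for x
      using M(2)[OF that] \<tau> by (simp add: matop_scale)
  qed (use \<tau> in simp)
  also have "(\<lambda>i j. of_real \<tau> * Y i j) =
      (\<lambda>i j. of_real ((l i - l j) / (l i + l j)) * (\<Sum>k\<in>Q. d k i * cnj (d k j)))"
    by (simp add: fun_eq_iff Dd Y_def)
  finally show ?thesis using MS unfolding S_def by blast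
qed

text \<open>The sum of the \<open>M\<close> largest singular values is \<open>\<Sum> \<langle>T e\<^sub>m, g\<^sub>m\<rangle>\<close> for two orthonormal systems; by
Bessel's inequality each rank one summand of \<open>T\<close> contributes at most the product of the norms of
its two vectors.\<close>

lemma nuclear_singular_value_le_nat:
  fixes n :: nat
  assumes inf: "infinite_dimensional TYPE('a::chilbert_space)" and Q: "finite Q" and \<tau>: "0 < \<tau>"
    and ab: "\<And>k. k \<in> Q \<Longrightarrow> (\<Sum>i<n. (cmod (a k i))\<^sup>2) \<le> c k" "\<And>k. k \<in> Q \<Longrightarrow> (\<Sum>i<n. (cmod (b k i))\<^sup>2) \<le> c k"
  shows "\<exists>M. real M * \<tau> \<le> (\<Sum>k\<in>Q. c k) \<and> singular_value_le {..<n} (\<lambda>i j. \<Sum>k\<in>Q. a k i * cnj (b k j)) M \<tau>"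
proof -
  obtain \<phi> :: "nat \<Rightarrow> 'a" where "orthonormal UNIV \<phi>" by (rule orthonormal_sequence_exists[OF inf])
  then have on: "orthonormal {..<n} \<phi>" by (rule orthonormal_subset) simp
  define G where "G i j = (\<Sum>k\<in>Q. a k i * cnj (b k j))" for i j
  let ?T = "matop \<phi> n G"
  obtain e where svd: "svd_basis ?T e" by (rule svd_basis_exists[OF compact_matop inf])
  obtain M where "\<forall>k<M. \<tau> < norm (?T (e k))"
      "\<forall>x. (\<forall>k<M. cinner x (e k) = 0) \<longrightarrow> norm (?T x) \<le> \<tau> * norm x"
    by (rule svd_threshold[OF compact_matop svd \<tau>])
  then have M: "k < M \<Longrightarrow> \<tau> < norm (?T (e k))"
      "(\<And>k. k < M \<Longrightarrow> cinner x (e k) = 0) \<Longrightarrow> norm (?T x) \<le> \<tau> * norm x" for k x by simp_all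
  have nz: "norm (?T (e k)) \<noteq> 0" if "k < M" for k using M(1)[OF that] \<tau> by linarith
  define g where "g k = (1 / norm (?T (e k))) *\<^sub>R ?T (e k)" for k
  have g: "orthonormal {..<M} g"
    unfolding orthonormal_def g_def
    using nz by (simp add: cinner_simps svd_cinner_image[OF compact_matop svd] power2_eq_square)
  note one = svd_orthonormal[OF compact_matop svd, of "{..<M}"]
  define A where "A k = (\<Sum>i<n. a k i *\<^sub>C \<phi> i)" for k
  define B where "B k = (\<Sum>i<n. b k i *\<^sub>C \<phi> i)" for k
  have T: "?T x = (\<Sum>k\<in>Q. cinner x (B k) *\<^sub>C A k)" for x
    unfolding A_def B_def by (rule matop_rank_one_sum) (simp add: G_def)
  have AB: "norm (A k) * norm (B k) \<le> c k" if "k \<in> Q" for k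
  proof -
    have "(norm (A k))\<^sup>2 \<le> c k" "(norm (B k))\<^sup>2 \<le> c k"
      unfolding A_def B_def norm_orthonormal_sum[OF on finite_lessThan] using ab that by auto
    then show ?thesis using sum_squares_bound[of "norm (A k)" "norm (B k)"] by linarith
  qed
  have "real M * \<tau> = (\<Sum>m<M. \<tau>)" by simp
  also have "\<dots> \<le> (\<Sum>m<M. Re (cinner (?T (e m)) (g m)))"
  proof (rule sum_mono)
    fix m assume "m \<in> {..<M}"
    then have m: "m < M" by simp
    have "cinner (?T (e m)) (g m) = of_real (norm (?T (e m)))"
      using nz[OF m] by (simp add: g_def cinner_scaleR_right cinner_self power2_eq_square)
    then show "\<tau> \<le> Re (cinner (?T (e m)) (g m))" using M(1)[OF m] by simp
  qed
  also have "\<dots> = (\<Sum>k\<in>Q. \<Sum>m<M. Re (cinner (e m) (B k) * cinner (A k) (g m)))"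
    by (subst sum.swap) (simp add: T cinner_sum_left cinner_scaleC_left del: times_complex.sel)
  also have "\<dots> \<le> (\<Sum>k\<in>Q. c k)"
  proof (rule sum_mono)
    fix k assume k: "k \<in> Q"
    have "(\<Sum>m<M. Re (cinner (e m) (B k) * cinner (A k) (g m))) \<le>
        (\<Sum>m<M. \<bar>cmod (cinner (B k) (e m))\<bar> * \<bar>cmod (cinner (A k) (g m))\<bar>)"
    proof (rule sum_mono)
      fix m
      have "Re (cinner (e m) (B k) * cinner (A k) (g m)) \<le> cmod (cinner (e m) (B k) * cinner (A k) (g m))"
        by (rule complex_Re_le_cmod)
      then show "Re (cinner (e m) (B k) * cinner (A k) (g m)) \<le>
          \<bar>cmod (cinner (B k) (e m))\<bar> * \<bar>cmod (cinner (A k) (g m))\<bar>"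
        by (simp only: norm_mult cinner_commute[of "e m"] complex_mod_cnj abs_norm_cancel)
    qed
    also have "\<dots> \<le> L2_set (\<lambda>m. cmod (cinner (B k) (e m))) {..<M} * L2_set (\<lambda>m. cmod (cinner (A k) (g m))) {..<M}"
      by (rule L2_set_mult_ineq)
    also have "\<dots> \<le> norm (B k) * norm (A k)"
    proof (rule mult_mono)
      show "L2_set (\<lambda>m. cmod (cinner (B k) (e m))) {..<M} \<le> norm (B k)"
        unfolding L2_set_def by (rule real_le_lsqrt) (use bessel[OF one] in \<open>auto simp: sum_nonneg\<close>)
      show "L2_set (\<lambda>m. cmod (cinner (A k) (g m))) {..<M} \<le> norm (A k)"
        unfolding L2_set_def by (rule real_le_lsqrt) (use bessel[OF g] in \<open>auto simp: sum_nonneg\<close>)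
    qed auto
    also have "\<dots> \<le> c k" using AB[OF k] by (simp add: mult.commute)
    finally show "(\<Sum>m<M. Re (cinner (e m) (B k) * cinner (A k) (g m))) \<le> c k" .
  qed
  finally have "real M * \<tau> \<le> (\<Sum>k\<in>Q. c k)" .
  moreover have "singular_value_le {..<n} G M \<tau>" by (rule singular_value_leI_matop[OF on _ M(2)]) (use \<tau> in auto)
  ultimately show ?thesis unfolding G_def[abs_def] by blast
qed

lemma schur_singular_value_le:
  fixes l :: "'k \<Rightarrow> real"
  assumes inf: "infinite_dimensional TYPE('a::chilbert_space)" and K: "finite K"
    and l: "\<And>i. i \<in> K \<Longrightarrow> 0 < l i" and Q: "finite Q" and \<tau>: "0 < \<tau>"
  shows "\<exists>M. real M * \<tau> \<le> 3 * (\<Sum>i\<in>K. \<Sum>k\<in>Q. (cmod (d k i))\<^sup>2) \<and>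
    singular_value_le K (\<lambda>i j. of_real ((l i - l j) / (l i + l j)) * (\<Sum>k\<in>Q. d k i * cnj (d k j))) M \<tau>"
proof -
  obtain b where b: "bij_betw b {..<card K} K"
    using ex_bij_betw_nat_finite[OF K] by (auto simp: atLeast0LessThan)
  have "\<exists>M. real M * \<tau> \<le> 3 * (\<Sum>i<card K. \<Sum>k\<in>Q. (cmod (d k (b i)))\<^sup>2) \<and>
    singular_value_le {..<card K} (\<lambda>i j. of_real ((l (b i) - l (b j)) / (l (b i) + l (b j))) *
      (\<Sum>k\<in>Q. d k (b i) * cnj (d k (b j)))) M \<tau>"
    by (rule schur_singular_value_le_nat[OF inf _ Q \<tau>]) (use l b in \<open>auto simp: bij_betw_def\<close>)
  then obtain M where M: "real M * \<tau> \<le> 3 * (\<Sum>i<card K. \<Sum>k\<in>Q. (cmod (d k (b i)))\<^sup>2)"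
    "singular_value_le {..<card K} (\<lambda>i j. of_real ((l (b i) - l (b j)) / (l (b i) + l (b j))) *
      (\<Sum>k\<in>Q. d k (b i) * cnj (d k (b j)))) M \<tau>" by blast
  have "(\<Sum>i<card K. \<Sum>k\<in>Q. (cmod (d k (b i)))\<^sup>2) = (\<Sum>i\<in>K. \<Sum>k\<in>Q. (cmod (d k i))\<^sup>2)"
    by (rule sum.reindex_bij_betw[OF b])
  with M(1) singular_value_le_reindex[OF b M(2)] show ?thesis by auto
qed

lemma nuclear_singular_value_le:
  assumes inf: "infinite_dimensional TYPE('a::chilbert_space)" and K: "finite K"
    and Q: "finite Q" and \<tau>: "0 < \<tau>"
    and ab: "\<And>k. k \<in> Q \<Longrightarrow> (\<Sum>i\<in>K. (cmod (a k i))\<^sup>2) \<le> c k" "\<And>k. k \<in> Q \<Longrightarrow> (\<Sum>i\<in>K. (cmod (b k i))\<^sup>2) \<le> c k"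
  shows "\<exists>M. real M * \<tau> \<le> (\<Sum>k\<in>Q. c k) \<and> singular_value_le K (\<lambda>i j. \<Sum>k\<in>Q. a k i * cnj (b k j)) M \<tau>"
proof -
  obtain f where f: "bij_betw f {..<card K} K"
    using ex_bij_betw_nat_finite[OF K] by (auto simp: atLeast0LessThan)
  have re: "(\<Sum>i<card K. h (f i)) = (\<Sum>i\<in>K. h i)" for h :: "_ \<Rightarrow> real"
    by (rule sum.reindex_bij_betw[OF f])
  have "\<exists>M. real M * \<tau> \<le> (\<Sum>k\<in>Q. c k) \<and> singular_value_le {..<card K} (\<lambda>i j. \<Sum>k\<in>Q. a k (f i) * cnj (b k (f j))) M \<tau>"
    using ab by (intro nuclear_singular_value_le_nat[OF inf Q \<tau>]) (simp_all add: re[of "\<lambda>i. (cmod (_ i))\<^sup>2"])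
  then obtain M where M: "real M * \<tau> \<le> (\<Sum>k\<in>Q. c k)"
    "singular_value_le {..<card K} (\<lambda>i j. \<Sum>k\<in>Q. a k (f i) * cnj (b k (f j))) M \<tau>" by blast
  have "singular_value_le K (\<lambda>i j. \<Sum>k\<in>Q. a k i * cnj (b k j)) M \<tau>"
    by (rule singular_value_le_reindex[OF f M(2)])
  with M(1) show ?thesis by blast
qed

text \<open>Passing from a matrix over \<open>I <+> J\<close> to its upper right block.\<close>

lemma singular_value_le_block:
  fixes I :: "'i set" and J :: "'j set"
  assumes sv: "singular_value_le (I <+> J) H M \<tau>" and fin: "finite I" "finite J" and \<tau>: "0 \<le> \<tau>"
  shows "\<exists>v :: nat \<Rightarrow> 'j \<Rightarrow> complex. \<forall>\<xi>. (\<forall>m<M. (\<Sum>j\<in>J. \<xi> j * v m j) = 0) \<longrightarrow>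
    L2_set (\<lambda>i. cmod (\<Sum>j\<in>J. H (Inl i) (Inr j) * \<xi> j)) I \<le> \<tau> * L2_set (\<lambda>j. cmod (\<xi> j)) J"
proof -
  obtain v :: "nat \<Rightarrow> 'i + 'j \<Rightarrow> complex" where v: "\<forall>\<xi>. (\<forall>m<M. (\<Sum>i\<in>I <+> J. \<xi> i * v m i) = 0) \<longrightarrow>
      (\<Sum>i\<in>I <+> J. (cmod (\<Sum>j\<in>I <+> J. H i j * \<xi> j))\<^sup>2) \<le> \<tau>\<^sup>2 * (\<Sum>j\<in>I <+> J. (cmod (\<xi> j))\<^sup>2)"
    using sv unfolding singular_value_le_def ..
  show ?thesis
  proof (intro exI[of _ "\<lambda>m j. v m (Inr j)"] allI impI)
    fix \<xi> :: "'j \<Rightarrow> complex" assume \<xi>: "\<forall>m<M. (\<Sum>j\<in>J. \<xi> j * v m (Inr j)) = 0"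
    define \<xi>' where "\<xi>' = case_sum (\<lambda>_ :: 'i. 0 :: complex) \<xi>"
    have "\<forall>m<M. (\<Sum>i\<in>I <+> J. \<xi>' i * v m i) = 0"
      using \<xi> by (simp add: sum.Plus fin \<xi>'_def)
    then have "(\<Sum>i\<in>I <+> J. (cmod (\<Sum>j\<in>I <+> J. H i j * \<xi>' j))\<^sup>2) \<le> \<tau>\<^sup>2 * (\<Sum>j\<in>I <+> J. (cmod (\<xi>' j))\<^sup>2)"
      using v by blast
    then have "(\<Sum>i\<in>I. (cmod (\<Sum>j\<in>J. H (Inl i) (Inr j) * \<xi> j))\<^sup>2) +
        (\<Sum>i\<in>J. (cmod (\<Sum>j\<in>J. H (Inr i) (Inr j) * \<xi> j))\<^sup>2) \<le> \<tau>\<^sup>2 * (\<Sum>j\<in>J. (cmod (\<xi> j))\<^sup>2)"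
      by (simp add: sum.Plus fin \<xi>'_def)
    moreover have "0 \<le> (\<Sum>i\<in>J. (cmod (\<Sum>j\<in>J. H (Inr i) (Inr j) * \<xi> j))\<^sup>2)" by (simp add: sum_nonneg)
    ultimately have "(\<Sum>i\<in>I. (cmod (\<Sum>j\<in>J. H (Inl i) (Inr j) * \<xi> j))\<^sup>2) \<le> \<tau>\<^sup>2 * (\<Sum>j\<in>J. (cmod (\<xi> j))\<^sup>2)"
      by linarith
    then have "sqrt (\<Sum>i\<in>I. (cmod (\<Sum>j\<in>J. H (Inl i) (Inr j) * \<xi> j))\<^sup>2) \<le> sqrt (\<tau>\<^sup>2 * (\<Sum>j\<in>J. (cmod (\<xi> j))\<^sup>2))"
      by (rule real_sqrt_le_mono)
    then show "L2_set (\<lambda>i. cmod (\<Sum>j\<in>J. H (Inl i) (Inr j) * \<xi> j)) I \<le> \<tau> * L2_set (\<lambda>j. cmod (\<xi> j)) J"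
      using \<tau> by (simp add: L2_set_def real_sqrt_mult)
  qed
qed

lemma L2_set_triangle3:
  "L2_set (\<lambda>i. cmod (f i + g i + h i)) I \<le> L2_set (\<lambda>i. cmod (f i)) I + L2_set (\<lambda>i. cmod (g i)) I + L2_set (\<lambda>i. cmod (h i)) I"
proof -
  have two: "L2_set (\<lambda>i. cmod (p i + q i)) I \<le> L2_set (\<lambda>i. cmod (p i)) I + L2_set (\<lambda>i. cmod (q i)) I" for p q :: "'a \<Rightarrow> complex"
  proof -
    have "L2_set (\<lambda>i. cmod (p i + q i)) I \<le> L2_set (\<lambda>i. cmod (p i) + cmod (q i)) I"
      by (rule L2_set_mono) (auto intro: norm_triangle_ineq)
    also have "\<dots> \<le> L2_set (\<lambda>i. cmod (p i)) I + L2_set (\<lambda>i. cmod (q i)) I" by (rule L2_set_triangle_ineq)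
    finally show ?thesis .
  qed
  show ?thesis using two[of "\<lambda>i. f i + g i" h] two[of f g] by linarith
qed

text \<open>With \<open>\<sigma>\<^sub>p = 1\<close> or \<open>\<sigma>\<^sub>p = - 1\<close> according to \<open>sg p\<close>, the weight equals
\<open>1/2 + \<sigma>\<^sub>p (lam i - mu j) / (2 (lam i + mu j))\<close>.  So \<open>T\<close> is half a nuclear matrix plus half a Schur multiple
of \<open>\<Sum> \<sigma>\<^sub>p A\<^sub>p B\<^sub>p\<^sup>*\<close>.  The latter is the upper right block of \<open>D\<^sub>+ - D\<^sub>-\<close>, where \<open>D\<^sub>\<plusminus>\<close> is the positive matrix
built from the vectors \<open>(\<sigma>\<^sub>p A\<^sub>p, \<plusminus> B\<^sub>p) / \<surd>2\<close>, whose trace is at most \<open>\<Sum> c\<^sub>p\<close> because \<open>A\<^sub>p\<close> and \<open>B\<^sub>p\<close> are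
balanced to the same bound \<open>c\<^sub>p\<close>.  The three pieces cost \<open>1 + 3 + 3 = 7\<close> times \<open>\<Sum> c\<^sub>p / \<tau>\<close>
functionals, and each has norm at most \<open>\<tau> / 2\<close> off them.\<close>

lemma block_small_off_few:
  fixes lam :: "'i \<Rightarrow> real" and mu :: "'j \<Rightarrow> real" and A :: "'p \<Rightarrow> 'i \<Rightarrow> complex" and B :: "'p \<Rightarrow> 'j \<Rightarrow> complex"
  assumes inf: "infinite_dimensional TYPE('a::chilbert_space)"
    and fin: "finite I" "finite J" "finite Q"
    and pos: "\<And>i. i \<in> I \<Longrightarrow> 0 < lam i" "\<And>j. j \<in> J \<Longrightarrow> 0 < mu j" and \<tau>: "0 < \<tau>"
    and c: "\<And>p. p \<in> Q \<Longrightarrow> (\<Sum>i\<in>I. (cmod (A p i))\<^sup>2) \<le> c p" "\<And>p. p \<in> Q \<Longrightarrow> (\<Sum>j\<in>J. (cmod (B p j))\<^sup>2) \<le> c p"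
    and T: "\<And>i j. i \<in> I \<Longrightarrow> j \<in> J \<Longrightarrow>
      T i j = (\<Sum>p\<in>Q. of_real ((if sg p then lam i else mu j) / (lam i + mu j)) * (A p i * cnj (B p j)))"
  shows "\<exists>M (v :: nat \<Rightarrow> 'j \<Rightarrow> complex). real M * \<tau> \<le> 7 * (\<Sum>p\<in>Q. c p) \<and>
    (\<forall>\<xi>. (\<forall>m<M. (\<Sum>j\<in>J. \<xi> j * v m j) = 0) \<longrightarrow>
      L2_set (\<lambda>i. cmod (\<Sum>j\<in>J. T i j * \<xi> j)) I \<le> 3 / 2 * \<tau> * L2_set (\<lambda>j. cmod (\<xi> j)) J)"
proof -
  let ?K = "I <+> J"
  have finK: "finite ?K" using fin by simp
  define s where "s p = (if sg p then 1 else - 1 :: complex)" for p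
  have s: "cmod (s p) = 1" for p by (simp add: s_def)
  define l where "l = case_sum lam mu"
  have l: "0 < l \<kappa>" if "\<kappa> \<in> ?K" for \<kappa> using that pos by (auto simp: l_def)
  define a where "a p = case_sum (A p) (\<lambda>_ :: 'j. 0)" for p
  define b where "b p = case_sum (\<lambda>_ :: 'i. 0) (B p)" for p
  define G where "G = (\<lambda>i j. \<Sum>p\<in>Q. a p i * cnj (b p j))"
  define d where "d \<sigma> p = case_sum (\<lambda>i. s p * A p i / of_real (sqrt 2)) (\<lambda>j. of_real \<sigma> * B p j / of_real (sqrt 2))" for \<sigma> :: real and p
  define Y where "Y \<sigma> = (\<lambda>i j. of_real ((l i - l j) / (l i + l j)) * (\<Sum>p\<in>Q. d \<sigma> p i * cnj (d \<sigma> p j)))" for \<sigma>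
  have tr: "(\<Sum>\<kappa>\<in>?K. \<Sum>p\<in>Q. (cmod (d \<sigma> p \<kappa>))\<^sup>2) \<le> (\<Sum>p\<in>Q. c p)" if "\<bar>\<sigma>\<bar> = 1" for \<sigma>
  proof -
    have "(\<Sum>\<kappa>\<in>?K. \<Sum>p\<in>Q. (cmod (d \<sigma> p \<kappa>))\<^sup>2) = (\<Sum>p\<in>Q. \<Sum>\<kappa>\<in>?K. (cmod (d \<sigma> p \<kappa>))\<^sup>2)" by (rule sum.swap)
    also have "\<dots> \<le> (\<Sum>p\<in>Q. c p)"
    proof (rule sum_mono)
      fix p assume p: "p \<in> Q"
      have "(\<Sum>\<kappa>\<in>?K. (cmod (d \<sigma> p \<kappa>))\<^sup>2) = (\<Sum>i\<in>I. (cmod (A p i))\<^sup>2) / 2 + (\<Sum>j\<in>J. (cmod (B p j))\<^sup>2) / 2"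
        using that s by (simp add: sum.Plus fin d_def norm_mult norm_divide power_divide sum_divide_distrib)
      then show "(\<Sum>\<kappa>\<in>?K. (cmod (d \<sigma> p \<kappa>))\<^sup>2) \<le> c p" using c[OF p] by linarith
    qed
    finally show ?thesis .
  qed
  have "\<exists>M. real M * \<tau> \<le> (\<Sum>p\<in>Q. c p) \<and> singular_value_le ?K G M \<tau>"
    unfolding G_def
    by (rule nuclear_singular_value_le[OF inf finK fin(3) \<tau>])
       (use c in \<open>auto simp: sum.Plus fin a_def b_def intro: order_trans\<close>)
  then obtain M0 where M0: "real M0 * \<tau> \<le> (\<Sum>p\<in>Q. c p)" "singular_value_le ?K G M0 \<tau>" by blast
  have "\<exists>M. real M * \<tau> \<le> 3 * (\<Sum>p\<in>Q. c p) \<and> singular_value_le ?K (Y \<sigma>) M \<tau>" if "\<bar>\<sigma>\<bar> = 1" for \<sigma>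
  proof -
    obtain M where M: "real M * \<tau> \<le> 3 * (\<Sum>\<kappa>\<in>?K. \<Sum>p\<in>Q. (cmod (d \<sigma> p \<kappa>))\<^sup>2)" "singular_value_le ?K (Y \<sigma>) M \<tau>"
      using schur_singular_value_le[OF inf finK l fin(3) \<tau>, of "\<lambda>x. x" "d \<sigma>"] unfolding Y_def by blast
    then show ?thesis using tr[OF that] by (intro exI[of _ M]) auto
  qed
  from this[of 1] this[of "-1"] obtain M1 M2 where
    M1: "real M1 * \<tau> \<le> 3 * (\<Sum>p\<in>Q. c p)" "singular_value_le ?K (Y 1) M1 \<tau>" and
    M2: "real M2 * \<tau> \<le> 3 * (\<Sum>p\<in>Q. c p)" "singular_value_le ?K (Y (-1)) M2 \<tau>" by auto
  have \<tau>0: "0 \<le> \<tau>" using \<tau> by simp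
  obtain v0 where v0: "\<forall>\<xi>. (\<forall>m<M0. (\<Sum>j\<in>J. \<xi> j * v0 m j) = 0) \<longrightarrow>
      L2_set (\<lambda>i. cmod (\<Sum>j\<in>J. G (Inl i) (Inr j) * \<xi> j)) I \<le> \<tau> * L2_set (\<lambda>j. cmod (\<xi> j)) J"
    using singular_value_le_block[OF M0(2) fin(1,2) \<tau>0] ..
  obtain v1 where v1: "\<forall>\<xi>. (\<forall>m<M1. (\<Sum>j\<in>J. \<xi> j * v1 m j) = 0) \<longrightarrow>
      L2_set (\<lambda>i. cmod (\<Sum>j\<in>J. Y 1 (Inl i) (Inr j) * \<xi> j)) I \<le> \<tau> * L2_set (\<lambda>j. cmod (\<xi> j)) J"
    using singular_value_le_block[OF M1(2) fin(1,2) \<tau>0] ..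
  obtain v2 where v2: "\<forall>\<xi>. (\<forall>m<M2. (\<Sum>j\<in>J. \<xi> j * v2 m j) = 0) \<longrightarrow>
      L2_set (\<lambda>i. cmod (\<Sum>j\<in>J. Y (-1) (Inl i) (Inr j) * \<xi> j)) I \<le> \<tau> * L2_set (\<lambda>j. cmod (\<xi> j)) J"
    using singular_value_le_block[OF M2(2) fin(1,2) \<tau>0] ..
  define v where "v m = (if m < M0 then v0 m else if m < M0 + M1 then v1 (m - M0) else v2 (m - M0 - M1))" for m
  have Teq: "T i j = 1/2 * G (Inl i) (Inr j) + 1/2 * Y 1 (Inl i) (Inr j) + - 1/2 * Y (-1) (Inl i) (Inr j)"
    if ij: "i \<in> I" "j \<in> J" for i j
  proof -
    have lm: "lam i > 0" "mu j > 0" using pos ij by auto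
    define r where "r = (lam i - mu j) / (lam i + mu j)"
    have w: "(if sg p then lam i else mu j) / (lam i + mu j) = 1/2 + 1/2 * ((if sg p then 1 else -1) * r)" for p
      using lm by (auto simp: r_def field_simps)
    have s2: "of_real (sqrt 2) * of_real (sqrt 2) = (2 :: complex)" by (simp flip: of_real_mult)
    have Ys: "Y \<sigma> (Inl i) (Inr j) = of_real r * (\<Sum>p\<in>Q. of_real \<sigma> * s p * (A p i * cnj (B p j)) / 2)" for \<sigma>
      by (simp add: Y_def l_def d_def r_def s2 mult_ac)
    have "T i j = (\<Sum>p\<in>Q. (1/2 + 1/2 * (s p * of_real r)) * (A p i * cnj (B p j)))"
      unfolding T[OF ij] w by (intro sum.cong refl) (simp add: s_def)
    also have "\<dots> = 1/2 * (\<Sum>p\<in>Q. A p i * cnj (B p j)) + 1/2 * (of_real r * (\<Sum>p\<in>Q. s p * (A p i * cnj (B p j))))"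
      unfolding sum_distrib_left sum.distrib[symmetric]
      by (intro sum.cong refl) (simp add: algebra_simps)
    also have "\<dots> = 1/2 * G (Inl i) (Inr j) + 1/2 * Y 1 (Inl i) (Inr j) + - 1/2 * Y (-1) (Inl i) (Inr j)"
      unfolding Ys by (simp add: G_def a_def b_def sum_negf flip: sum_divide_distrib)
    finally show ?thesis .
  qed
  show ?thesis
  proof (intro exI[of _ "M0 + M1 + M2"] exI[of _ v] conjI allI impI)
    show "real (M0 + M1 + M2) * \<tau> \<le> 7 * (\<Sum>p\<in>Q. c p)" using M0(1) M1(1) M2(1) by (simp add: distrib_right)
    fix \<xi> assume \<xi>: "\<forall>m<M0 + M1 + M2. (\<Sum>j\<in>J. \<xi> j * v m j) = 0"
    let ?x = "L2_set (\<lambda>j. cmod (\<xi> j)) J"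
    have z0: "\<forall>m<M0. (\<Sum>j\<in>J. \<xi> j * v0 m j) = 0"
    proof (intro allI impI)
      fix m assume "m < M0" then show "(\<Sum>j\<in>J. \<xi> j * v0 m j) = 0" using \<xi>[rule_format, of m] by (simp add: v_def)
    qed
    have z1: "\<forall>m<M1. (\<Sum>j\<in>J. \<xi> j * v1 m j) = 0"
    proof (intro allI impI)
      fix m assume "m < M1" then show "(\<Sum>j\<in>J. \<xi> j * v1 m j) = 0" using \<xi>[rule_format, of "M0 + m"] by (simp add: v_def)
    qed
    have z2: "\<forall>m<M2. (\<Sum>j\<in>J. \<xi> j * v2 m j) = 0"
    proof (intro allI impI)
      fix m assume "m < M2" then show "(\<Sum>j\<in>J. \<xi> j * v2 m j) = 0" using \<xi>[rule_format, of "M0 + M1 + m"] by (simp add: v_def)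
    qed
    have half: "L2_set (\<lambda>i. cmod (z * (\<Sum>j\<in>J. H i j * \<xi> j))) I \<le> 1/2 * (\<tau> * ?x)"
      if "L2_set (\<lambda>i. cmod (\<Sum>j\<in>J. H i j * \<xi> j)) I \<le> \<tau> * ?x" "cmod z = 1/2" for H z
    proof -
      have "L2_set (\<lambda>i. cmod (z * (\<Sum>j\<in>J. H i j * \<xi> j))) I = 1/2 * L2_set (\<lambda>i. cmod (\<Sum>j\<in>J. H i j * \<xi> j)) I"
        unfolding norm_mult that(2) by (rule L2_set_right_distrib[symmetric]) simp
      then show ?thesis using that(1) by linarith
    qed
    have "L2_set (\<lambda>i. cmod (\<Sum>j\<in>J. T i j * \<xi> j)) I =
        L2_set (\<lambda>i. cmod (1/2 * (\<Sum>j\<in>J. G (Inl i) (Inr j) * \<xi> j) + 1/2 * (\<Sum>j\<in>J. Y 1 (Inl i) (Inr j) * \<xi> j)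
          + - 1/2 * (\<Sum>j\<in>J. Y (-1) (Inl i) (Inr j) * \<xi> j))) I"
    proof (rule L2_set_cong[OF refl])
      fix i assume i: "i \<in> I"
      have "(\<Sum>j\<in>J. T i j * \<xi> j) = (\<Sum>j\<in>J. 1/2 * (G (Inl i) (Inr j) * \<xi> j) + 1/2 * (Y 1 (Inl i) (Inr j) * \<xi> j)
          + - 1/2 * (Y (-1) (Inl i) (Inr j) * \<xi> j))"
        by (intro sum.cong refl) (simp only: Teq[OF i] distrib_right mult.assoc)
      then show "cmod (\<Sum>j\<in>J. T i j * \<xi> j) = cmod (1/2 * (\<Sum>j\<in>J. G (Inl i) (Inr j) * \<xi> j) + 1/2 * (\<Sum>j\<in>J. Y 1 (Inl i) (Inr j) * \<xi> j)
          + - 1/2 * (\<Sum>j\<in>J. Y (-1) (Inl i) (Inr j) * \<xi> j))"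
        by (simp only: sum.distrib sum_distrib_left)
    qed
    also have "\<dots> \<le> 1/2 * (\<tau> * ?x) + 1/2 * (\<tau> * ?x) + 1/2 * (\<tau> * ?x)"
      using v0[rule_format, of \<xi>] z0 v1[rule_format, of \<xi>] z1 v2[rule_format, of \<xi>] z2
      by (intro order_trans[OF L2_set_triangle3] add_mono half) auto
    also have "\<dots> = 3 / 2 * \<tau> * ?x" by simp
    finally show "L2_set (\<lambda>i. cmod (\<Sum>j\<in>J. T i j * \<xi> j)) I \<le> 3 / 2 * \<tau> * ?x" .
  qed
qed

section \<open>Ingredients of the count for the difference of absolute values\<close>

text \<open>Gaussian elimination of one unknown by one equation.\<close>

lemma homogeneous_system_solvable:
  fixes f :: "nat \<Rightarrow> 'l \<Rightarrow> complex"
  assumes "finite L" "M < card L"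
  shows "\<exists>\<gamma>. (\<exists>l\<in>L. \<gamma> l \<noteq> 0) \<and> (\<forall>m<M. (\<Sum>l\<in>L. f m l * \<gamma> l) = 0)"
  using assms
proof (induction M arbitrary: L f)
  case 0
  then obtain l where "l \<in> L" by fastforce
  then show ?case by (intro exI[of _ "\<lambda>_. 1"]) auto
next
  case (Suc M)
  show ?case
  proof (cases "\<forall>l\<in>L. f M l = 0")
    case True
    obtain \<gamma> where \<gamma>: "\<exists>l\<in>L. \<gamma> l \<noteq> 0" "\<forall>m<M. (\<Sum>l\<in>L. f m l * \<gamma> l) = 0"
      using Suc.IH[OF Suc.prems(1), of f] Suc.prems(2) by auto
    then show ?thesis using True by (intro exI[of _ \<gamma>]) (auto simp: less_Suc_eq)
  next
    case False
    then obtain l0 where l0: "l0 \<in> L" "f M l0 \<noteq> 0" by blast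
    let ?L = "L - {l0}"
    have "M < card ?L" using Suc.prems l0 by simp
    then obtain \<gamma> where \<gamma>: "\<exists>l\<in>?L. \<gamma> l \<noteq> 0"
      "\<forall>m<M. (\<Sum>l\<in>?L. (f m l - f m l0 * f M l / f M l0) * \<gamma> l) = 0"
      using Suc.IH[of ?L "\<lambda>m l. f m l - f m l0 * f M l / f M l0"] Suc.prems(1) by auto
    define S where "S = (\<Sum>l\<in>?L. f M l * \<gamma> l)"
    define \<gamma>' where "\<gamma>' = \<gamma>(l0 := - S / f M l0)"
    have sum: "(\<Sum>l\<in>L. f m l * \<gamma>' l) = f m l0 * (- S / f M l0) + (\<Sum>l\<in>?L. f m l * \<gamma> l)" for m
      using Suc.prems(1) l0(1) by (simp add: sum.remove[of L l0] \<gamma>'_def)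
    have "(\<Sum>l\<in>L. f m l * \<gamma>' l) = 0" if "m < Suc M" for m
    proof (cases "m = M")
      case True
      then show ?thesis using l0 sum[of M] by (simp add: S_def)
    next
      case False
      then have "(\<Sum>l\<in>?L. (f m l - f m l0 * f M l / f M l0) * \<gamma> l) = 0" using \<gamma>(2) that by simp
      moreover have "(\<Sum>l\<in>?L. (f m l - f m l0 * f M l / f M l0) * \<gamma> l) =
          (\<Sum>l\<in>?L. f m l * \<gamma> l) - f m l0 / f M l0 * S"
        unfolding S_def sum_distrib_left sum_subtractf[symmetric]
        by (intro sum.cong refl) (simp add: algebra_simps)
      ultimately show ?thesis unfolding sum by simp
    qed
    moreover have "\<exists>l\<in>L. \<gamma>' l \<noteq> 0" using \<gamma>(1) by (auto simp: \<gamma>'_def)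
    ultimately show ?thesis by blast
  qed
qed

text \<open>Take \<open>\<alpha>\<close> with a sum within \<open>\<delta>\<close> of the supremum of all finite sums.\<close>

lemma bounded_sums_small_tail:
  fixes h :: "'i \<Rightarrow> real"
  assumes h: "\<And>i. i \<in> W \<Longrightarrow> 0 \<le> h i" and bd: "\<And>I. finite I \<Longrightarrow> I \<subseteq> W \<Longrightarrow> sum h I \<le> C" and \<delta>: "0 < \<delta>"
  shows "\<exists>\<alpha>. finite \<alpha> \<and> \<alpha> \<subseteq> W \<and> (\<forall>I. finite I \<longrightarrow> I \<subseteq> W \<longrightarrow> I \<inter> \<alpha> = {} \<longrightarrow> sum h I \<le> \<delta>)"
proof -
  let ?S = "sum h ` {I. finite I \<and> I \<subseteq> W}"
  have bdd: "bdd_above ?S" using bd by (intro bdd_aboveI[of _ C]) auto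
  have "sum h {} \<in> ?S" by blast
  then have ne: "?S \<noteq> {}" by blast
  have "Sup ?S - \<delta> < Sup ?S" using \<delta> by simp
  then obtain y where y: "y \<in> ?S" "Sup ?S - \<delta> < y" by (rule less_cSupE[OF _ ne])
  then obtain \<alpha> where \<alpha>: "finite \<alpha>" "\<alpha> \<subseteq> W" "y = sum h \<alpha>" by blast
  have "sum h I \<le> \<delta>" if I: "finite I" "I \<subseteq> W" "I \<inter> \<alpha> = {}" for I
  proof -
    have "sum h (\<alpha> \<union> I) \<le> Sup ?S" by (rule cSup_upper[OF _ bdd]) (use I \<alpha> in auto)
    moreover have "sum h (\<alpha> \<union> I) = sum h \<alpha> + sum h I" by (rule sum.union_disjoint) (use I \<alpha> in auto)
    ultimately show ?thesis using y(2) \<alpha>(3) by linarith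
  qed
  then show ?thesis using \<alpha> by blast
qed

text \<open>The vectors \<open>T w / \<parallel>T w\<parallel>\<close> are orthonormal apart from those with \<open>T w = 0\<close>, which contribute zero since
\<open>1 / 0 = 0\<close>.\<close>

lemma bessel_normalized_image:
  fixes T :: "'a::chilbert_space \<Rightarrow> 'a"
  assumes T: "bounded_clinear T" and on: "orthonormal W (\<lambda>w. w)"
    and eig: "\<And>w. w \<in> W \<Longrightarrow> cadjoint T (T w) = (norm (T w))\<^sup>2 *\<^sub>R w" and I: "finite I" "I \<subseteq> W"
  shows "(\<Sum>w\<in>I. (cmod (cinner x ((1 / norm (T w)) *\<^sub>R T w)))\<^sup>2) \<le> (norm x)\<^sup>2"
proof -
  let ?u = "\<lambda>w. (1 / norm (T w)) *\<^sub>R T w"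
  let ?I = "{w \<in> I. T w \<noteq> 0}"
  have "orthonormal ?I ?u"
    unfolding orthonormal_def
  proof (intro ballI)
    fix v w assume vw: "v \<in> ?I" "w \<in> ?I"
    have "cinner (T v) (T w) = cinner (cadjoint T (T v)) w" by (simp add: cinner_cadjoint'[OF T])
    also have "\<dots> = of_real ((norm (T v))\<^sup>2) * cinner v w"
      using vw I eig[of v] by (simp add: cinner_scaleR_left subset_iff)
    finally have "cinner (T v) (T w) = of_real ((norm (T v))\<^sup>2) * (if v = w then 1 else 0)"
      using orthonormalD[OF on, of v w] vw I(2) by (simp add: subset_iff)
    then show "cinner (?u v) (?u w) = (if v = w then 1 else 0)"
      using vw by (simp add: cinner_simps power2_eq_square)
  qed
  then have "(\<Sum>w\<in>?I. (cmod (cinner x (?u w)))\<^sup>2) \<le> (norm x)\<^sup>2" by (rule bessel) (use I in simp)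
  also have "(\<Sum>w\<in>?I. (cmod (cinner x (?u w)))\<^sup>2) = (\<Sum>w\<in>I. (cmod (cinner x (?u w)))\<^sup>2)"
    by (rule sum.mono_neutral_left) (use I in auto)
  finally show ?thesis .
qed

text \<open>The singular value decomposition of \<open>S\<close>, with \<open>g k\<close> the normalised image of the singular vector \<open>p k\<close>.\<close>

lemma trace_class_nuclear:
  fixes S :: "'a::chilbert_space \<Rightarrow> 'a"
  assumes inf: "infinite_dimensional TYPE('a)" and S: "S \<in> trace_class"
  obtains c :: "nat \<Rightarrow> real" and p g :: "nat \<Rightarrow> 'a" where
    "summable c" "\<forall>k. 0 \<le> c k" "\<forall>k. norm (p k) \<le> 1" "\<forall>k. norm (g k) \<le> 1"
    "\<forall>x. (\<lambda>n. \<Sum>k<n. (of_real (c k) * cinner x (p k)) *\<^sub>C g k) \<longlonglongrightarrow> S x"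
proof -
  have comp: "compact_operator S" and sm: "summable (\<lambda>k. singular_numbers S k)" using S by (auto simp: trace_class_def)
  obtain e where svd: "svd_basis S e" by (rule svd_basis_exists[OF comp inf])
  define c where "c k = norm (S (e k))" for k
  have "summable c" using sm unfolding singular_numbers_eq[OF comp inf svd] by (simp add: c_def[abs_def])
  moreover have "\<forall>x. (\<lambda>n. \<Sum>k<n. (of_real (c k) * cinner x (e k)) *\<^sub>C ((1 / c k) *\<^sub>R S (e k))) \<longlonglongrightarrow> S x"
  proof
    fix x
    have "(of_real (c k) * cinner x (e k)) *\<^sub>C ((1 / c k) *\<^sub>R S (e k)) = cinner x (e k) *\<^sub>C S (e k)" for k
      by (cases "c k = 0") (simp_all add: scaleR_scaleC scaleC_scaleC c_def)
    then show "(\<lambda>n. \<Sum>k<n. (of_real (c k) * cinner x (e k)) *\<^sub>C ((1 / c k) *\<^sub>R S (e k))) \<longlonglongrightarrow> S x"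
      using svd_expansion[OF comp svd] by simp
  qed
  moreover have "\<forall>k. norm ((1 / c k) *\<^sub>R S (e k)) \<le> 1" by (simp add: c_def)
  ultimately show ?thesis
    by (intro that[of c e "\<lambda>k. (1 / c k) *\<^sub>R S (e k)"])
       (simp_all add: c_def orthonormal_norm[OF svd_orthonormal[OF comp svd, of UNIV]])
qed

lemma compact_operator_diff:
  fixes S T :: "'a::complex_inner \<Rightarrow> 'b::complex_inner"
  assumes S: "compact_operator S" and T: "compact_operator T"
  shows "compact_operator (\<lambda>x. S x - T x)"
proof -
  have "compact_operator (\<lambda>x. - T x)"
  proof (rule compact_operatorI)
    have "clinear T" using T by (simp add: compact_operator_def)
    then show "clinear (\<lambda>x. - T x)" by (simp add: clinear_iff)
    fix x :: "nat \<Rightarrow> 'a" and K assume K: "\<And>n. norm (x n) \<le> K"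
    obtain r l where r: "strict_mono (r :: nat \<Rightarrow> nat)" "(\<lambda>n. T (x (r n))) \<longlonglongrightarrow> l"
      by (rule compact_operator_subseq[OF T K])
    then show "\<exists>r l. strict_mono (r :: nat \<Rightarrow> nat) \<and> (\<lambda>n. - T (x (r n))) \<longlonglongrightarrow> l"
      by (intro exI[of _ r] exI[of _ "- l"] conjI tendsto_minus)
  qed
  from compact_operator_add[OF S this] show ?thesis by simp
qed

text \<open>\<open>\<parallel>|T| x\<parallel> = \<parallel>T x\<parallel>\<close> transports Cauchy sequences of images from \<open>T\<close> to \<open>|T|\<close>.\<close>

lemma compact_abs_operator:
  fixes T :: "'a::chilbert_space \<Rightarrow> 'a"
  assumes comp: "compact_operator T" and inf: "infinite_dimensional TYPE('a)"
  shows "compact_operator (abs_operator T)"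
proof (rule compact_operatorI)
  note A = abs_operator[OF comp inf]
  have lin: "bounded_clinear (abs_operator T)" using A(1) by (simp add: positive_operator_def)
  have T: "bounded_clinear T" by (rule compact_operator_bounded_clinear[OF comp])
  show "clinear (abs_operator T)" by (rule bounded_clinear_clinear[OF lin])
  fix x :: "nat \<Rightarrow> 'a" and K assume K: "\<And>n. norm (x n) \<le> K"
  obtain r l where r: "strict_mono (r :: nat \<Rightarrow> nat)" "(\<lambda>n. T (x (r n))) \<longlonglongrightarrow> l"
    by (rule compact_operator_subseq[OF comp K])
  have iso: "norm (abs_operator T y - abs_operator T z) = norm (T y - T z)" for y z
    using positive_sqrt_norm[OF A(1) T A(2), of "y - z"]
    by (simp add: bounded_clinearD(3)[OF lin] bounded_clinearD(3)[OF T])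
  have "Cauchy (\<lambda>n. T (x (r n)))" using r(2) by (rule LIMSEQ_imp_Cauchy)
  then have "Cauchy (\<lambda>n. abs_operator T (x (r n)))"
    unfolding Cauchy_iff iso .
  then obtain m where "(\<lambda>n. abs_operator T (x (r n))) \<longlonglongrightarrow> m" by (auto simp: Cauchy_convergent_iff convergent_def)
  with r(1) show "\<exists>r l. strict_mono (r :: nat \<Rightarrow> nat) \<and> (\<lambda>n. abs_operator T (x (r n))) \<longlonglongrightarrow> l" by blast
qed

lemma projection_error_combination:
  assumes y: "\<And>l. l < N \<Longrightarrow> norm (y l - (\<Sum>w\<in>I. cinner (y l) w *\<^sub>C w)) \<le> \<delta>"
    and \<gamma>: "\<And>l. l < (N :: nat) \<Longrightarrow> cmod (\<gamma> l) \<le> r" and \<delta>: "0 \<le> \<delta>"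
  shows "norm ((\<Sum>l<N. \<gamma> l *\<^sub>C y l) - (\<Sum>w\<in>I. cinner (\<Sum>l<N. \<gamma> l *\<^sub>C y l) w *\<^sub>C (w :: 'a::complex_inner)))
    \<le> real N * (r * \<delta>)"
proof -
  have "(\<Sum>w\<in>I. cinner (\<Sum>l<N. \<gamma> l *\<^sub>C y l) w *\<^sub>C w) = (\<Sum>w\<in>I. \<Sum>l<N. (\<gamma> l * cinner (y l) w) *\<^sub>C w)"
    by (simp add: cinner_sum_left cinner_scaleC_left complex_vector.scale_sum_left)
  also have "\<dots> = (\<Sum>l<N. \<gamma> l *\<^sub>C (\<Sum>w\<in>I. cinner (y l) w *\<^sub>C w))"
    by (subst sum.swap) (simp add: complex_vector.scale_sum_right scaleC_scaleC)
  finally have "(\<Sum>l<N. \<gamma> l *\<^sub>C y l) - (\<Sum>w\<in>I. cinner (\<Sum>l<N. \<gamma> l *\<^sub>C y l) w *\<^sub>C w) =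
      (\<Sum>l<N. \<gamma> l *\<^sub>C (y l - (\<Sum>w\<in>I. cinner (y l) w *\<^sub>C w)))"
    by (simp add: complex_vector.scale_right_diff_distrib sum_subtractf)
  also have "norm \<dots> \<le> (\<Sum>l<N. r * \<delta>)"
  proof (rule sum_norm_le)
    fix l assume "l \<in> {..<N}"
    then have l: "l < N" by simp
    have "cmod (\<gamma> l) * norm (y l - (\<Sum>w\<in>I. cinner (y l) w *\<^sub>C w)) \<le> r * \<delta>"
      by (intro mult_mono y[OF l] \<gamma>[OF l] norm_ge_zero order_trans[OF norm_ge_zero \<gamma>[OF l]])
    then show "norm (\<gamma> l *\<^sub>C (y l - (\<Sum>w\<in>I. cinner (y l) w *\<^sub>C w))) \<le> r * \<delta>" by simp
  qed
  also have "\<dots> = real N * (r * \<delta>)" by simp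
  finally show ?thesis .
qed

lemma total_orthonormal_approx_finite:
  fixes y :: "nat \<Rightarrow> 'a::chilbert_space"
  assumes on: "orthonormal W (\<lambda>w. w)" and tot: "\<forall>x. (\<forall>w\<in>W. cinner x w = 0) \<longrightarrow> x = 0"
    and \<epsilon>: "\<epsilon> > 0"
  shows "\<exists>F. finite F \<and> F \<subseteq> W \<and> (\<forall>l<N. \<forall>G. finite G \<longrightarrow> F \<subseteq> G \<longrightarrow> G \<subseteq> W \<longrightarrow>
    norm (y l - (\<Sum>w\<in>G. cinner (y l) w *\<^sub>C w)) \<le> \<epsilon>)"
proof (induction N)
  case 0
  show ?case by (intro exI[of _ "{}"]) simp
next
  case (Suc N)
  then obtain F where F: "finite F" "F \<subseteq> W" "\<forall>l<N. \<forall>G. finite G \<longrightarrow> F \<subseteq> G \<longrightarrow> G \<subseteq> W \<longrightarrow>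
    norm (y l - (\<Sum>w\<in>G. cinner (y l) w *\<^sub>C w)) \<le> \<epsilon>" by (elim exE conjE)
  have tot': "x = 0" if "\<And>w. w \<in> W \<Longrightarrow> cinner x w = 0" for x using tot that by blast
  have "\<exists>F'. finite F' \<and> F' \<subseteq> W \<and> (\<forall>G. finite G \<longrightarrow> F' \<subseteq> G \<longrightarrow> G \<subseteq> W \<longrightarrow>
      norm (y N - (\<Sum>w\<in>G. cinner (y N) w *\<^sub>C w)) \<le> \<epsilon>)"
  proof -
    obtain F' where "finite F'" "F' \<subseteq> W" "\<And>G. finite G \<Longrightarrow> F' \<subseteq> G \<Longrightarrow> G \<subseteq> W \<Longrightarrow>
      norm (y N - (\<Sum>w\<in>G. cinner (y N) w *\<^sub>C w)) < \<epsilon>"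
      using total_orthonormal_approx[OF on tot' \<epsilon>, of "y N"] by metis
    then show ?thesis by (intro exI[of _ F']) (simp add: less_imp_le)
  qed
  then obtain F' where F': "finite F'" "F' \<subseteq> W" "\<forall>G. finite G \<longrightarrow> F' \<subseteq> G \<longrightarrow> G \<subseteq> W \<longrightarrow>
      norm (y N - (\<Sum>w\<in>G. cinner (y N) w *\<^sub>C w)) \<le> \<epsilon>" by (elim exE conjE)
  show ?case
  proof (intro exI[of _ "F \<union> F'"] conjI allI impI)
    fix l G assume "l < Suc N" "finite G" "F \<union> F' \<subseteq> G" "G \<subseteq> W"
    then show "norm (y l - (\<Sum>w\<in>G. cinner (y l) w *\<^sub>C w)) \<le> \<epsilon>"
      using F(3) F'(3) by (cases "l = N") (simp_all add: less_Suc_eq)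
  qed (use F F' in simp_all)
qed

lemma L2_set_bessel:
  assumes "orthonormal I e" "finite I"
  shows "L2_set (\<lambda>i. cmod (cinner x (e i))) I \<le> norm x"
  unfolding L2_set_def by (rule real_le_lsqrt) (use bessel[OF assms] in \<open>auto simp: sum_nonneg\<close>)

lemma svd_lower_bound:
  fixes T :: "'a::chilbert_space \<Rightarrow> 'b::complex_inner"
  assumes comp: "compact_operator T" and svd: "svd_basis T h"
  shows "norm (T (h k)) * norm (\<Sum>l<Suc k. \<gamma> l *\<^sub>C h l) \<le> norm (T (\<Sum>l<Suc k. \<gamma> l *\<^sub>C h l))"
proof (cases "T (h k) = 0")
  case False
  have T: "bounded_clinear T" by (rule compact_operator_bounded_clinear[OF comp])
  have ge: "norm (T (h k)) \<le> norm (T (h l))" if "l < Suc k" for l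
    using svd_decseq[OF comp svd] that by (simp add: decseq_def)
  have nz: "T (h l) \<noteq> 0" if "l < Suc k" for l using ge[OF that] False by auto
  let ?g = "\<lambda>l. (1 / norm (T (h l))) *\<^sub>R T (h l)"
  have on: "orthonormal {..<Suc k} ?g"
    unfolding orthonormal_def using nz
    by (simp add: cinner_simps svd_cinner_image[OF comp svd] power2_eq_square)
  have "T (\<Sum>l<Suc k. \<gamma> l *\<^sub>C h l) = (\<Sum>l<Suc k. (\<gamma> l * of_real (norm (T (h l)))) *\<^sub>C ?g l)"
    unfolding bounded_clinearD(8)[OF T] bounded_clinearD(2)[OF T]
    by (rule sum.cong) (use nz in \<open>auto simp: scaleR_scaleC scaleC_scaleC\<close>)
  then have eq: "(norm (T (\<Sum>l<Suc k. \<gamma> l *\<^sub>C h l)))\<^sup>2 = (\<Sum>l<Suc k. (cmod (\<gamma> l * of_real (norm (T (h l)))))\<^sup>2)"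
    using norm_orthonormal_sum[OF on, of "\<lambda>l. \<gamma> l * of_real (norm (T (h l)))"] by simp
  show ?thesis
  proof (rule power2_le_imp_le)
    have "(norm (T (h k)) * norm (\<Sum>l<Suc k. \<gamma> l *\<^sub>C h l))\<^sup>2 = (\<Sum>l<Suc k. (norm (T (h k)))\<^sup>2 * (cmod (\<gamma> l))\<^sup>2)"
      unfolding power_mult_distrib norm_orthonormal_sum[OF svd_orthonormal[OF comp svd] finite_lessThan] sum_distrib_left ..
    also have "\<dots> \<le> (\<Sum>l<Suc k. (cmod (\<gamma> l * of_real (norm (T (h l)))))\<^sup>2)"
    proof (rule sum_mono)
      fix l assume "l \<in> {..<Suc k}"
      then have "(norm (T (h k)))\<^sup>2 \<le> (norm (T (h l)))\<^sup>2" using ge by (intro power_mono) auto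
      from mult_right_mono[OF this zero_le_power2[of "cmod (\<gamma> l)"]]
      show "(norm (T (h k)))\<^sup>2 * (cmod (\<gamma> l))\<^sup>2 \<le> (cmod (\<gamma> l * of_real (norm (T (h l)))))\<^sup>2"
        by (simp add: norm_mult power_mult_distrib mult.commute)
    qed
    finally show "(norm (T (h k)) * norm (\<Sum>l<Suc k. \<gamma> l *\<^sub>C h l))\<^sup>2 \<le> (norm (T (\<Sum>l<Suc k. \<gamma> l *\<^sub>C h l)))\<^sup>2"
      unfolding eq .
  qed simp
qed simp

text \<open>The equation \<open>|A| T + T |B| = A\<^sup>* S + S\<^sup>* B\<close> in matrix entries.  Where both eigenvalues vanish it is void, but
then the entry of \<open>T = |A| - |B|\<close> is zero.\<close>

lemma abs_difference_entry:
  fixes A B :: "'a::chilbert_space \<Rightarrow> 'a"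
  assumes inf: "infinite_dimensional TYPE('a)" and A: "compact_operator A" and B: "compact_operator B"
    and wa: "cadjoint A (A w) = (norm (A w))\<^sup>2 *\<^sub>R w" and vb: "cadjoint B (B v) = (norm (B v))\<^sup>2 *\<^sub>R v"
  defines "u \<equiv> (1 / norm (A w)) *\<^sub>R A w" and "z \<equiv> (1 / norm (B v)) *\<^sub>R B v"
  shows "of_real (norm (A w) + norm (B v)) * cinner (abs_operator A v - abs_operator B v) w =
      of_real (norm (A w)) * cinner (A v - B v) u + of_real (norm (B v)) * cinner z (A w - B w)"
    and "norm (A w) = 0 \<Longrightarrow> norm (B v) = 0 \<Longrightarrow> cinner (abs_operator A v - abs_operator B v) w = 0"
proof -
  have linA: "bounded_clinear A" and linB: "bounded_clinear B"
    by (rule compact_operator_bounded_clinear[OF A], rule compact_operator_bounded_clinear[OF B])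
  note absA = abs_operator[OF A inf] and absB = abs_operator[OF B inf]
  have "abs_operator A (abs_operator A w) = (norm (A w))\<^sup>2 *\<^sub>R w" using fun_cong[OF absA(2), of w] wa by simp
  then have Aw: "abs_operator A w = norm (A w) *\<^sub>R w" by (rule positive_sqrt_eigenvector[OF absA(1)]) simp
  have "abs_operator B (abs_operator B v) = (norm (B v))\<^sup>2 *\<^sub>R v" using fun_cong[OF absB(2), of v] vb by simp
  then have Bv: "abs_operator B v = norm (B v) *\<^sub>R v" by (rule positive_sqrt_eigenvector[OF absB(1)]) simp
  have T: "cinner (abs_operator A v - abs_operator B v) w = of_real (norm (A w) - norm (B v)) * cinner v w"
    by (simp add: cinner_diff_left positive_operator_hermitian[OF absA(1)] Aw Bv cinner_simps left_diff_distrib)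
  then show "norm (A w) = 0 \<Longrightarrow> norm (B v) = 0 \<Longrightarrow> cinner (abs_operator A v - abs_operator B v) w = 0" by simp
  have u: "of_real (norm (A w)) * cinner x u = cinner x (A w)" for x
    by (cases "A w = 0") (simp_all add: u_def cinner_scaleR_right)
  have z: "of_real (norm (B v)) * cinner z x = cinner (B v) x" for x
    by (cases "B v = 0") (simp_all add: z_def cinner_scaleR_left)
  have AA: "cinner (A v) (A w) = of_real ((norm (A w))\<^sup>2) * cinner v w"
    by (simp add: cinner_cadjoint[OF linA] wa cinner_scaleR_right)
  have BB: "cinner (B v) (B w) = of_real ((norm (B v))\<^sup>2) * cinner v w"
    by (simp add: cinner_cadjoint'[OF linB, symmetric] vb cinner_scaleR_left)
  show "of_real (norm (A w) + norm (B v)) * cinner (abs_operator A v - abs_operator B v) w =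
      of_real (norm (A w)) * cinner (A v - B v) u + of_real (norm (B v)) * cinner z (A w - B w)"
    unfolding T u z unfolding cinner_diff_left cinner_diff_right AA BB
    by (simp add: algebra_simps power2_eq_square)
qed

text \<open>The Schur multiplier bound requires strictly positive eigenvalues.  Shifting both eigenvalues by
\<open>1 / (n + 1)\<close> achieves this, and the entries still converge to those of \<open>T\<close>.  If \<open>l = m = 0\<close>, the
weights are \<open>1/2\<close> throughout, which does no harm as \<open>e = f = 0\<close> then.\<close>

lemma weighted_mean_tendsto:
  fixes l m :: real and E F :: "nat \<Rightarrow> complex"
  assumes l: "0 \<le> l" and m: "0 \<le> m" and E: "E \<longlonglongrightarrow> e" and F: "F \<longlonglongrightarrow> f"
    and t: "of_real (l + m) * t = of_real l * e + of_real m * f"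
    and zero: "l = 0 \<Longrightarrow> m = 0 \<Longrightarrow> t = 0 \<and> e = 0 \<and> f = 0"
  shows "(\<lambda>n. of_real ((l + inverse (real (Suc n))) / ((l + inverse (real (Suc n))) + (m + inverse (real (Suc n))))) * E n +
    of_real ((m + inverse (real (Suc n))) / ((l + inverse (real (Suc n))) + (m + inverse (real (Suc n))))) * F n) \<longlonglongrightarrow> t"
proof (cases "l + m = 0")
  case True
  then have z: "l = 0" "m = 0" using l m by auto
  have "(\<lambda>n. of_real (1/2) * E n + of_real (1/2) * F n) \<longlonglongrightarrow> of_real (1/2) * e + of_real (1/2) * f"
    by (intro tendsto_intros E F)
  moreover have "inverse (real (Suc n)) / (inverse (real (Suc n)) + inverse (real (Suc n))) = 1/2" for n
    by (simp add: field_simps)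
  ultimately show ?thesis using zero[OF z] by (simp only: z add_0) simp
next
  case False
  let ?\<eta> = "\<lambda>n. inverse (real (Suc n))"
  have \<eta>: "?\<eta> \<longlonglongrightarrow> 0" by (rule LIMSEQ_inverse_real_of_nat)
  have "(\<lambda>n. of_real ((l + ?\<eta> n) / ((l + ?\<eta> n) + (m + ?\<eta> n))) * E n +
    of_real ((m + ?\<eta> n) / ((l + ?\<eta> n) + (m + ?\<eta> n))) * F n)
    \<longlonglongrightarrow> of_real ((l + 0) / ((l + 0) + (m + 0))) * e + of_real ((m + 0) / ((l + 0) + (m + 0))) * f"
    by (intro tendsto_intros E F \<eta>) (use False in simp_all)
  also have "of_real ((l + 0) / ((l + 0) + (m + 0))) * e + of_real ((m + 0) / ((l + 0) + (m + 0))) * f =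
      (of_real l * e + of_real m * f) / of_real (l + m)"
    by (simp add: add_divide_distrib)
  also have "\<dots> = t" unfolding t[symmetric] using False by (simp del: of_real_add)
  finally show ?thesis .
qed

section \<open>The difference of absolute values\<close>

text \<open>\<open>R\<close> is the number of exceptional rows, and must not depend on \<open>k\<close>.  The argument is a dimension count.
Suppose that the span of the singular vectors \<open>h 0, \<dots>, h k\<close> has dimension larger than \<open>R\<close> plus the
number \<open>M\<close> of functionals provided by \<open>block_small_off_few\<close> with \<open>\<tau> = t / 2\<close>, where
\<open>t = \<parallel>T (h k)\<parallel>\<close>.  Then it contains \<open>x \<noteq> 0\<close> such that \<open>T x\<close> has no component in the exceptional rows and the
functionals vanish on the coordinates of \<open>x\<close>.  On the one hand \<open>\<parallel>T x\<parallel> \<ge> t \<parallel>x\<parallel>\<close>, on the other hand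
\<open>\<parallel>T x\<parallel> \<le> 3/4 t \<parallel>x\<parallel>\<close> up to three errors of size \<open>t \<parallel>x\<parallel> / 16\<close>, which come from truncating the two
eigenbases to finite sets and from replacing the entries of \<open>T\<close> by shifted and truncated ones.
The constant is \<open>56 = 7 \<cdot> 4 \<cdot> 2\<close>: seven from \<open>block_small_off_few\<close>, \<open>4 \<epsilon>\<close> for the two nuclear sums, and
two from \<open>\<tau> = t / 2\<close>.\<close>

lemma singular_value_count:
  fixes A B :: "'h::chilbert_space \<Rightarrow> 'h"
  assumes inf: "infinite_dimensional TYPE('h)" and A: "compact_operator A" and B: "compact_operator B"
    and S: "(\<lambda>x. A x - B x) \<in> trace_class" and \<epsilon>: "0 < \<epsilon>"
    and svd: "svd_basis (\<lambda>x. abs_operator A x - abs_operator B x) h"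
  defines "T \<equiv> \<lambda>x. abs_operator A x - abs_operator B x"
  shows "\<exists>R :: nat. \<forall>k. real (Suc k) * norm (T (h k)) \<le> real R * norm (T (h k)) + 56 * \<epsilon>"
proof -
  have compT: "compact_operator T"
    unfolding T_def by (intro compact_operator_diff compact_abs_operator A B inf)
  have svdT: "svd_basis T h" using svd unfolding T_def .
  have T: "bounded_clinear T" by (rule compact_operator_bounded_clinear[OF compT])
  have linA: "bounded_clinear A" and linB: "bounded_clinear B"
    by (rule compact_operator_bounded_clinear[OF A], rule compact_operator_bounded_clinear[OF B])
  obtain \<kappa> where \<kappa>: "\<kappa> > 0" "\<And>x. norm (T x) \<le> \<kappa> * norm x" using bounded_clinear_bound[OF T] by blast
  obtain c p g where cpg: "summable c" "\<forall>k :: nat. (0 :: real) \<le> c k" "\<forall>k. norm (p k) \<le> 1" "\<forall>k. norm (g k) \<le> 1"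
    "\<forall>x. (\<lambda>n. \<Sum>k<n. (of_real (c k) * cinner x (p k)) *\<^sub>C g k) \<longlonglongrightarrow> A x - B x"
    by (rule trace_class_nuclear[OF inf S])
  obtain V where V: "orthonormal V (\<lambda>w. w)" "\<And>w. w \<in> V \<Longrightarrow> cadjoint A (A w) = (norm (A w))\<^sup>2 *\<^sub>R w"
    "\<And>x. (\<And>w. w \<in> V \<Longrightarrow> cinner x w = 0) \<Longrightarrow> x = 0"
    using abs_eigenbasis_exists[OF A] by metis
  obtain W where W: "orthonormal W (\<lambda>w. w)" "\<And>w. w \<in> W \<Longrightarrow> cadjoint B (B w) = (norm (B w))\<^sup>2 *\<^sub>R w"
    "\<And>x. (\<And>w. w \<in> W \<Longrightarrow> cinner x w = 0) \<Longrightarrow> x = 0"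
    using abs_eigenbasis_exists[OF B] by metis
  have V3: "\<forall>x. (\<forall>w\<in>V. cinner x w = 0) \<longrightarrow> x = 0" and W3: "\<forall>x. (\<forall>w\<in>W. cinner x w = 0) \<longrightarrow> x = 0"
    using V(3) W(3) by blast+
  define u where "u w = (1 / norm (A w)) *\<^sub>R A w" for w
  define z where "z v = (1 / norm (B v)) *\<^sub>R B v" for v
  have bu: "(\<Sum>w\<in>I. (cmod (cinner x (u w)))\<^sup>2) \<le> (norm x)\<^sup>2" if "finite I" "I \<subseteq> V" for I x
    unfolding u_def by (rule bessel_normalized_image[OF linA V(1,2) that])
  have bz: "(\<Sum>w\<in>I. (cmod (cinner x (z w)))\<^sup>2) \<le> (norm x)\<^sup>2" if "finite I" "I \<subseteq> W" for I x
    unfolding z_def by (rule bessel_normalized_image[OF linB W(1,2) that])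
  have bV: "(\<Sum>w\<in>I. (cmod (cinner x w))\<^sup>2) \<le> (norm x)\<^sup>2" if "finite I" "I \<subseteq> V" for I x
    by (rule bessel[OF orthonormal_subset[OF V(1) that(2)] that(1)])
  have bW: "(\<Sum>w\<in>I. (cmod (cinner x w))\<^sup>2) \<le> (norm x)\<^sup>2" if "finite I" "I \<subseteq> W" for I x
    by (rule bessel[OF orthonormal_subset[OF W(1) that(2)] that(1)])
  have g1: "(norm (g k))\<^sup>2 \<le> 1" and p1: "(norm (p k))\<^sup>2 \<le> 1" for k
    using cpg(3,4) by (simp_all add: power_le_one)

  \<comment> \<open>Rows outside the finite set \<open>\<alpha>\<close> below meet the \<open>k\<close>-th summands of \<open>E\<close> and \<open>F\<close> in vectors of norm at most
    \<open>\<theta> k\<close>.  For \<open>k \<ge> K\<close> the sum of \<open>c k\<close> is small, for \<open>k < K\<close> the factor \<open>\<theta> k = \<delta>\<close> is.\<close>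
  define C where "C = suminf c"
  have Cn: "(\<Sum>k<n. c k) \<le> C" for n unfolding C_def by (rule sum_le_suminf[OF cpg(1)]) (use cpg(2) in auto)
  have C0: "0 \<le> C" using Cn[of 0] by simp
  obtain K where K: "C - \<epsilon> < (\<Sum>k<K. c k)"
  proof -
    have "\<forall>\<^sub>F n in sequentially. C - \<epsilon> < (\<Sum>k<n. c k)"
      by (rule order_tendstoD(1)[OF summable_LIMSEQ[OF cpg(1)]]) (use \<epsilon> in \<open>simp add: C_def\<close>)
    then show ?thesis using that by (auto simp: eventually_sequentially)
  qed
  define \<delta> where "\<delta> = \<epsilon> / (C + 1)"
  have \<delta>: "0 < \<delta>" "\<delta> * C \<le> \<epsilon>" using \<epsilon> C0 by (simp_all add: \<delta>_def field_simps)
  define \<theta> where "\<theta> k = (if k < K then \<delta> else 1)" for k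
  have \<theta>: "0 < \<theta> k" for k using \<delta> by (simp add: \<theta>_def)
  have tail: "(\<Sum>k<n. c k * \<theta> k) \<le> 2 * \<epsilon>" for n
  proof -
    have "(\<Sum>k<n. c k * \<theta> k) \<le> (\<Sum>k<n. \<delta> * c k + (if k < K then 0 else c k))"
      by (rule sum_mono) (use cpg(2) \<delta> in \<open>auto simp: \<theta>_def\<close>)
    also have "\<dots> = \<delta> * (\<Sum>k<n. c k) + (\<Sum>k<n. if k < K then 0 else c k)"
      by (simp add: sum.distrib sum_distrib_left)
    also have "\<delta> * (\<Sum>k<n. c k) \<le> \<epsilon>"
      using mult_left_mono[OF Cn[of n], of \<delta>] \<delta> by linarith
    also have "(\<Sum>k<n. if k < K then 0 else c k) \<le> \<epsilon>"
    proof -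
      let ?N = "max n K"
      have "(\<Sum>k<n. if k < K then 0 else c k) \<le> (\<Sum>k<?N. if k < K then 0 else c k)"
        by (rule sum_mono2) (use cpg(2) in auto)
      moreover have "(\<Sum>k<?N. c k) = (\<Sum>k<?N. (if k < K then c k else 0)) + (\<Sum>k<?N. if k < K then 0 else c k)"
        unfolding sum.distrib[symmetric] by (rule sum.cong) auto
      moreover have "(\<Sum>k<?N. (if k < K then c k else 0)) = (\<Sum>k<K. c k)"
        by (rule sum.mono_neutral_cong_right) auto
      ultimately show ?thesis using Cn[of ?N] K by linarith
    qed
    finally show ?thesis by simp
  qed

  have "\<forall>k. \<exists>\<alpha>. finite \<alpha> \<and> \<alpha> \<subseteq> V \<and> (\<forall>I. finite I \<longrightarrow> I \<subseteq> V \<longrightarrow> I \<inter> \<alpha> = {} \<longrightarrow>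
      (\<Sum>w\<in>I. (cmod (cinner (g k) (u w)))\<^sup>2 + (cmod (cinner (p k) w))\<^sup>2) \<le> \<delta>\<^sup>2)"
  proof
    fix k
    show "\<exists>\<alpha>. finite \<alpha> \<and> \<alpha> \<subseteq> V \<and> (\<forall>I. finite I \<longrightarrow> I \<subseteq> V \<longrightarrow> I \<inter> \<alpha> = {} \<longrightarrow>
      (\<Sum>w\<in>I. (cmod (cinner (g k) (u w)))\<^sup>2 + (cmod (cinner (p k) w))\<^sup>2) \<le> \<delta>\<^sup>2)"
    proof (rule bounded_sums_small_tail)
      fix I assume "finite I" "I \<subseteq> V"
      then show "(\<Sum>w\<in>I. (cmod (cinner (g k) (u w)))\<^sup>2 + (cmod (cinner (p k) w))\<^sup>2) \<le> (norm (g k))\<^sup>2 + (norm (p k))\<^sup>2"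
        unfolding sum.distrib by (intro add_mono bu bV)
    qed (use \<delta> in auto)
  qed
  from choice[OF this] obtain \<alpha>' where \<alpha>': "\<forall>k. finite (\<alpha>' k) \<and> \<alpha>' k \<subseteq> V \<and> (\<forall>I. finite I \<longrightarrow> I \<subseteq> V \<longrightarrow> I \<inter> \<alpha>' k = {} \<longrightarrow>
      (\<Sum>w\<in>I. (cmod (cinner (g k) (u w)))\<^sup>2 + (cmod (cinner (p k) w))\<^sup>2) \<le> \<delta>\<^sup>2)" ..
  define \<alpha> where "\<alpha> = (\<Union>k<K. \<alpha>' k)"
  have \<alpha>: "finite \<alpha>" "\<alpha> \<subseteq> V" using \<alpha>' by (auto simp: \<alpha>_def)
  have small: "(\<Sum>w\<in>I. (cmod (cinner (g k) (u w)))\<^sup>2) \<le> (\<theta> k)\<^sup>2 \<and> (\<Sum>w\<in>I. (cmod (cinner (p k) w))\<^sup>2) \<le> (\<theta> k)\<^sup>2"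
    if I: "finite I" "I \<subseteq> V" "I \<inter> \<alpha> = {}" for I k
  proof (cases "k < K")
    case True
    have "I \<inter> \<alpha>' k = {}" using I(3) True by (auto simp: \<alpha>_def)
    then have "(\<Sum>w\<in>I. (cmod (cinner (g k) (u w)))\<^sup>2) + (\<Sum>w\<in>I. (cmod (cinner (p k) w))\<^sup>2) \<le> \<delta>\<^sup>2"
      using \<alpha>' I unfolding sum.distrib by blast
    moreover have "0 \<le> (\<Sum>w\<in>I. (cmod (cinner (g k) (u w)))\<^sup>2)" "0 \<le> (\<Sum>w\<in>I. (cmod (cinner (p k) w))\<^sup>2)"
      by (simp_all add: sum_nonneg)
    ultimately show ?thesis using True by (simp add: \<theta>_def)
  next
    case False
    then show ?thesis using order_trans[OF bu[OF I(1,2)] g1] order_trans[OF bV[OF I(1,2)] p1] by (simp add: \<theta>_def)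
  qed

  \<comment> \<open>Truncating the nuclear series leaves finite sums, as the determinant argument requires.\<close>
  define E where "E n w v = (\<Sum>k<n. of_real (c k) * cinner v (p k) * cinner (g k) (u w))" for n w v
  define F where "F n w v = (\<Sum>k<n. of_real (c k) * cinner (p k) w * cinner (z v) (g k))" for n w v
  have Elim: "(\<lambda>n. E n w v) \<longlonglongrightarrow> cinner (A v - B v) (u w)" for w v
    using tendsto_cinner_left[OF cpg(5)[rule_format, of v], of "u w"]
    by (simp add: E_def cinner_sum_left cinner_scaleC_left)
  have Flim: "(\<lambda>n. F n w v) \<longlonglongrightarrow> cinner (z v) (A w - B w)" for w v
    using tendsto_cinner_right[OF cpg(5)[rule_format, of w], of "z v"]
    by (simp add: F_def cinner_sum_right cinner_scaleC_right cinner_commute[of "p _" w])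
  define \<eta> where "\<eta> n = inverse (real (Suc n))" for n
  have \<eta>: "0 < \<eta> n" for n by (simp add: \<eta>_def)
  define T' where "T' n w v = of_real ((norm (A w) + \<eta> n) / ((norm (A w) + \<eta> n) + (norm (B v) + \<eta> n))) * E n w v +
    of_real ((norm (B v) + \<eta> n) / ((norm (A w) + \<eta> n) + (norm (B v) + \<eta> n))) * F n w v" for n w v
  have T'lim: "(\<lambda>n. T' n w v) \<longlonglongrightarrow> cinner (T v) w" if "w \<in> V" "v \<in> W" for w v
    unfolding T'_def \<eta>_def
  proof (rule weighted_mean_tendsto[OF norm_ge_zero norm_ge_zero Elim Flim])
    show "of_real (norm (A w) + norm (B v)) * cinner (T v) w =
      of_real (norm (A w)) * cinner (A v - B v) (u w) + of_real (norm (B v)) * cinner (z v) (A w - B w)"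
      unfolding T_def u_def z_def by (rule abs_difference_entry(1)[OF inf A B V(2)[OF that(1)] W(2)[OF that(2)]])
    assume "norm (A w) = 0" "norm (B v) = 0"
    then show "cinner (T v) w = 0 \<and> cinner (A v - B v) (u w) = 0 \<and> cinner (z v) (A w - B w) = 0"
      using abs_difference_entry(2)[OF inf A B V(2)[OF that(1)] W(2)[OF that(2)]]
      by (simp add: T_def u_def z_def)
  qed

  have main: "real (Suc k) * norm (T (h k)) \<le> real (card \<alpha>) * norm (T (h k)) + 56 * \<epsilon>" for k
  proof (cases "T (h k) = 0")
    case True
    then show ?thesis using \<epsilon> by simp
  next
    case False
    define t where "t = norm (T (h k))"
    have t: "0 < t" using False by (simp add: t_def)
    define N where "N = Suc k"
    have N: "0 < real N" by (simp add: N_def)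
    define \<delta>1 where "\<delta>1 = t / (16 * \<kappa> * real N)"
    define \<delta>2 where "\<delta>2 = t / (16 * real N)"
    have \<delta>12: "0 < \<delta>1" "0 < \<delta>2" using t \<kappa>(1) N by (simp_all add: \<delta>1_def \<delta>2_def)
    obtain J where J: "finite J" "J \<subseteq> W" "\<forall>l<N. \<forall>G. finite G \<longrightarrow> J \<subseteq> G \<longrightarrow> G \<subseteq> W \<longrightarrow>
        norm (h l - (\<Sum>w\<in>G. cinner (h l) w *\<^sub>C w)) \<le> \<delta>1"
      using total_orthonormal_approx_finite[OF W(1) W3 \<delta>12(1), of N h] by (elim exE conjE)
    obtain I' where I': "finite I'" "I' \<subseteq> V" "\<forall>l<N. \<forall>G. finite G \<longrightarrow> I' \<subseteq> G \<longrightarrow> G \<subseteq> V \<longrightarrow>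
        norm (T (h l) - (\<Sum>w\<in>G. cinner (T (h l)) w *\<^sub>C w)) \<le> \<delta>2"
      using total_orthonormal_approx_finite[OF V(1) V3 \<delta>12(2), of N "\<lambda>l. T (h l)"] by (elim exE conjE)
    define I where "I = I' - \<alpha>"
    have I: "finite I" "I \<subseteq> V" "I \<inter> \<alpha> = {}" using I' by (auto simp: I_def)
    define \<rho> where "\<rho> = t / (16 * (real (card I) * real (card J) + 1))"
    have \<rho>: "0 < \<rho>" "real (card I) * (real (card J) * \<rho>) \<le> t / 16"
    proof -
      have "0 \<le> real (card I) * real (card J)" by simp
      then have pos: "0 < real (card I) * real (card J) + 1" by linarith
      then show "0 < \<rho>" unfolding \<rho>_def by (intro divide_pos_pos mult_pos_pos t) simp
      have "real (card I) * (real (card J) * \<rho>) = t / 16 * (real (card I) * real (card J) / (real (card I) * real (card J) + 1))"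
        by (simp add: \<rho>_def)
      also have "\<dots> \<le> t / 16 * 1"
        using t by (intro mult_left_mono) (simp_all add: divide_le_eq_1_pos[OF pos])
      finally show "real (card I) * (real (card J) * \<rho>) \<le> t / 16" by simp
    qed
    obtain n where n: "\<And>w v. w \<in> I \<Longrightarrow> v \<in> J \<Longrightarrow> cmod (T' n w v - cinner (T v) w) \<le> \<rho>"
    proof -
      have "\<forall>\<^sub>F n in sequentially. \<forall>w\<in>I. \<forall>v\<in>J. cmod (T' n w v - cinner (T v) w) \<le> \<rho>"
      proof (intro eventually_ball_finite ballI I(1) J(1))
        fix w v assume "w \<in> I" "v \<in> J"
        then have "(\<lambda>n. T' n w v) \<longlonglongrightarrow> cinner (T v) w" using I(2) J(2) by (intro T'lim) auto
        then have "\<forall>\<^sub>F n in sequentially. dist (T' n w v) (cinner (T v) w) < \<rho>" using \<rho>(1) by (rule tendstoD)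
        then show "\<forall>\<^sub>F n in sequentially. cmod (T' n w v - cinner (T v) w) \<le> \<rho>"
          by (rule eventually_mono) (simp add: dist_norm)
      qed
      then have "\<exists>n. \<forall>w\<in>I. \<forall>v\<in>J. cmod (T' n w v - cinner (T v) w) \<le> \<rho>"
        unfolding eventually_sequentially by blast
      then show ?thesis using that by blast
    qed

    define Q where "Q = {..<n} \<times> (UNIV :: bool set)"
    \<comment> \<open>The pair \<open>(k, True)\<close> stands for the \<open>k\<close>-th summand of \<open>E\<close> and \<open>(k, False)\<close> for that of \<open>F\<close>.  The square
      roots balance the two factors, so that both have squared norm at most \<open>c k * \<theta> k\<close>.\<close>
    define a where "a q w = of_real (sqrt (c (fst q) / \<theta> (fst q))) * (if snd q then cinner (g (fst q)) (u w) else cinner (p (fst q)) w)"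
      for q :: "nat \<times> bool" and w
    define b where "b q v = of_real (sqrt (c (fst q) * \<theta> (fst q))) * (if snd q then cinner (p (fst q)) v else cinner (g (fst q)) (z v))"
      for q :: "nat \<times> bool" and v
    have cth: "sqrt (c k / \<theta> k) * sqrt (c k * \<theta> k) = c k" for k
      using \<theta>[of k] cpg(2) by (simp flip: real_sqrt_mult)
    have "\<exists>M (v :: nat \<Rightarrow> 'h \<Rightarrow> complex). real M * (t / 2) \<le> 7 * (\<Sum>q\<in>Q. c (fst q) * \<theta> (fst q)) \<and>
        (\<forall>\<xi>. (\<forall>m<M. (\<Sum>j\<in>J. \<xi> j * v m j) = 0) \<longrightarrow>
          L2_set (\<lambda>i. cmod (\<Sum>j\<in>J. T' n i j * \<xi> j)) I \<le> 3 / 2 * (t / 2) * L2_set (\<lambda>j. cmod (\<xi> j)) J)"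
    proof (rule block_small_off_few[OF inf I(1) J(1), where lam = "\<lambda>w. norm (A w) + \<eta> n" and mu = "\<lambda>v. norm (B v) + \<eta> n"
          and A = a and B = b and sg = snd])
      show "finite Q" by (simp add: Q_def)
      show "0 < norm (A i) + \<eta> n" "0 < norm (B i) + \<eta> n" for i using \<eta>[of n] by (simp_all add: add_nonneg_pos)
      show "0 < t / 2" using t by simp
      fix q :: "nat \<times> bool"
      have ck: "0 \<le> c (fst q)" "0 < \<theta> (fst q)" using cpg(2) \<theta> by auto
      have "(\<Sum>i\<in>I. (cmod (a q i))\<^sup>2) = c (fst q) / \<theta> (fst q) * (\<Sum>i\<in>I. (cmod (if snd q then cinner (g (fst q)) (u i) else cinner (p (fst q)) i))\<^sup>2)"
        using ck by (simp add: a_def norm_mult power_mult_distrib sum_distrib_left)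
      also have "\<dots> \<le> c (fst q) / \<theta> (fst q) * (\<theta> (fst q))\<^sup>2"
        using ck small[OF I, of "fst q"] by (intro mult_left_mono) (cases "snd q", simp_all)
      also have "\<dots> = c (fst q) * \<theta> (fst q)" using ck by (simp add: power2_eq_square)
      finally show "(\<Sum>i\<in>I. (cmod (a q i))\<^sup>2) \<le> c (fst q) * \<theta> (fst q)" .
      have "(\<Sum>j\<in>J. (cmod (b q j))\<^sup>2) = c (fst q) * \<theta> (fst q) * (\<Sum>j\<in>J. (cmod (if snd q then cinner (p (fst q)) j else cinner (g (fst q)) (z j)))\<^sup>2)"
        using ck by (simp add: b_def norm_mult power_mult_distrib sum_distrib_left)
      also have "\<dots> \<le> c (fst q) * \<theta> (fst q) * 1"
        using ck order_trans[OF bW[OF J(1,2)] p1] order_trans[OF bz[OF J(1,2)] g1]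
        by (intro mult_left_mono) (cases "snd q", simp_all)
      finally show "(\<Sum>j\<in>J. (cmod (b q j))\<^sup>2) \<le> c (fst q) * \<theta> (fst q)" by simp
    next
      fix i j
      let ?l = "norm (A i) + \<eta> n" and ?m = "norm (B j) + \<eta> n"
      have prodT: "a (k, True) i * cnj (b (k, True) j) = of_real (c k) * cinner j (p k) * cinner (g k) (u i)" for k
      proof -
        have "a (k, True) i * cnj (b (k, True) j) = of_real (sqrt (c k / \<theta> k) * sqrt (c k * \<theta> k)) * cinner j (p k) * cinner (g k) (u i)"
          by (simp only: a_def b_def fst_conv snd_conv if_True complex_cnj_mult complex_cnj_complex_of_real
              cinner_commute[of j "p k", symmetric] of_real_mult mult_ac)
        then show ?thesis by (simp only: cth)
      qed
      have prodF: "a (k, False) i * cnj (b (k, False) j) = of_real (c k) * cinner (p k) i * cinner (z j) (g k)" for k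
      proof -
        have "a (k, False) i * cnj (b (k, False) j) = of_real (sqrt (c k / \<theta> k) * sqrt (c k * \<theta> k)) * cinner (p k) i * cinner (z j) (g k)"
          by (simp only: a_def b_def fst_conv snd_conv if_False complex_cnj_mult complex_cnj_complex_of_real
              cinner_commute[of "z j" "g k", symmetric] of_real_mult mult_ac)
        then show ?thesis by (simp only: cth)
      qed
      have sum_bool: "(\<Sum>s\<in>UNIV. G s) = G True + G False" for G :: "bool \<Rightarrow> complex"
        by (simp add: UNIV_bool add.commute)
      have "(\<Sum>q\<in>Q. of_real ((if snd q then ?l else ?m) / (?l + ?m)) * (a q i * cnj (b q j))) =
          (\<Sum>k<n. \<Sum>s\<in>UNIV. of_real ((if s then ?l else ?m) / (?l + ?m)) * (a (k, s) i * cnj (b (k, s) j)))"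
        unfolding Q_def sum.cartesian_product by (rule sum.cong) auto
      also have "\<dots> = (\<Sum>k<n. of_real (?l / (?l + ?m)) * (of_real (c k) * cinner j (p k) * cinner (g k) (u i)) +
          of_real (?m / (?l + ?m)) * (of_real (c k) * cinner (p k) i * cinner (z j) (g k)))"
        by (intro sum.cong refl) (simp only: sum_bool prodT prodF if_True if_False)
      also have "\<dots> = T' n i j"
        unfolding T'_def E_def F_def sum.distrib sum_distrib_left ..
      finally show "T' n i j = (\<Sum>q\<in>Q. of_real ((if snd q then ?l else ?m) / (?l + ?m)) * (a q i * cnj (b q j)))" ..
    qed
    then obtain M v where M: "real M * (t / 2) \<le> 7 * (\<Sum>q\<in>Q. c (fst q) * \<theta> (fst q))"
      and v: "\<forall>\<xi>. (\<forall>m<M. (\<Sum>j\<in>J. \<xi> j * v m j) = 0) \<longrightarrow>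
          L2_set (\<lambda>i. cmod (\<Sum>j\<in>J. T' n i j * \<xi> j)) I \<le> 3 / 2 * (t / 2) * L2_set (\<lambda>j. cmod (\<xi> j)) J"
      by (elim exE conjE)
    have "(\<Sum>q\<in>Q. c (fst q) * \<theta> (fst q)) = 2 * (\<Sum>k<n. c k * \<theta> k)"
    proof -
      have "(\<Sum>q\<in>Q. c (fst q) * \<theta> (fst q)) = (\<Sum>k<n. \<Sum>s\<in>(UNIV :: bool set). c k * \<theta> k)"
        unfolding Q_def sum.cartesian_product by (rule sum.cong) auto
      then show ?thesis by (simp add: sum_distrib_left)
    qed
    then have Mt: "real M * t \<le> 56 * \<epsilon>" using M tail[of n] by linarith

    have "N \<le> card \<alpha> + M"
    proof (rule ccontr)
      assume "\<not> N \<le> card \<alpha> + M"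
      then have lt: "card \<alpha> + M < card {..<N}" by simp
      obtain e where e: "bij_betw e {..<card \<alpha>} \<alpha>"
        using ex_bij_betw_nat_finite[OF \<alpha>(1)] by (auto simp: atLeast0LessThan)
      \<comment> \<open>The first \<open>card \<alpha>\<close> equations remove the exceptional rows of \<open>T x\<close>, the others are the
        functionals applied to the coordinates of \<open>x\<close>.\<close>
      define f where "f m l = (if m < card \<alpha> then cinner (T (h l)) (e m) else (\<Sum>j\<in>J. cinner (h l) j * v (m - card \<alpha>) j))" for m l
      obtain \<gamma> where \<gamma>: "\<exists>l\<in>{..<N}. \<gamma> l \<noteq> 0" "\<forall>m<card \<alpha> + M. (\<Sum>l<N. f m l * \<gamma> l) = 0"
        using homogeneous_system_solvable[OF finite_lessThan lt, of f] by (elim exE conjE)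
      define x where "x = (\<Sum>l<N. \<gamma> l *\<^sub>C h l)"
      define r where "r = norm x"
      have onh: "orthonormal {..<N} h" by (rule svd_orthonormal[OF compT svdT])
      have x2: "r\<^sup>2 = (\<Sum>l<N. (cmod (\<gamma> l))\<^sup>2)"
        unfolding r_def x_def by (rule norm_orthonormal_sum[OF onh]) simp
      have \<gamma>r: "cmod (\<gamma> l) \<le> r" if "l < N" for l
      proof (rule power2_le_imp_le)
        show "(cmod (\<gamma> l))\<^sup>2 \<le> r\<^sup>2" unfolding x2 by (rule member_le_sum) (use that in auto)
      qed (simp add: r_def)
      obtain l where "l < N" "\<gamma> l \<noteq> 0" using \<gamma>(1) by auto
      then have r: "0 < r" using \<gamma>r[of l] by (metis less_le_trans zero_less_norm_iff)
      have Tx: "T x = (\<Sum>l<N. \<gamma> l *\<^sub>C T (h l))"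
        unfolding x_def bounded_clinearD(8)[OF T] bounded_clinearD(2)[OF T] ..
      have Tx\<alpha>: "cinner (T x) w = 0" if "w \<in> \<alpha>" for w
      proof -
        have "w \<in> e ` {..<card \<alpha>}" using e that by (simp add: bij_betw_def)
        then obtain m where m: "m < card \<alpha>" "w = e m" by blast
        have "(\<Sum>l<N. f m l * \<gamma> l) = 0" using \<gamma>(2) m(1) by simp
        then show ?thesis unfolding Tx cinner_sum_left using m by (simp add: f_def cinner_scaleC_left mult.commute)
      qed
      define \<xi> where "\<xi> j = cinner x j" for j
      have \<xi>0: "\<forall>m<M. (\<Sum>j\<in>J. \<xi> j * v m j) = 0"
      proof (intro allI impI)
        fix m assume "m < M"
        then have "0 = (\<Sum>l<N. f (card \<alpha> + m) l * \<gamma> l)" using \<gamma>(2) by simp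
        also have "\<dots> = (\<Sum>l<N. \<Sum>j\<in>J. \<gamma> l * cinner (h l) j * v m j)"
          by (simp add: f_def sum_distrib_left sum_distrib_right mult_ac)
        also have "\<dots> = (\<Sum>j\<in>J. \<Sum>l<N. \<gamma> l * cinner (h l) j * v m j)" by (rule sum.swap)
        also have "\<dots> = (\<Sum>j\<in>J. \<xi> j * v m j)"
          by (simp add: \<xi>_def x_def cinner_sum_left cinner_scaleC_left sum_distrib_right)
        finally show "(\<Sum>j\<in>J. \<xi> j * v m j) = 0" by simp
      qed
      have \<xi>r: "L2_set (\<lambda>j. cmod (\<xi> j)) J \<le> r"
        unfolding \<xi>_def r_def by (rule L2_set_bessel[OF orthonormal_subset[OF W(1) J(2)] J(1)])
      have \<xi>j: "cmod (\<xi> j) \<le> r" if "j \<in> J" for j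
        using member_le_L2_set[OF J(1) that, of "\<lambda>j. cmod (\<xi> j)"] \<xi>r by simp

      \<comment> \<open>As \<open>x\<close> lies in the span of the first \<open>N\<close> singular vectors, \<open>T x\<close> is large; almost all of it
        is seen by the rows in \<open>I\<close>.\<close>
      have low: "t * r \<le> norm (T x)"
        unfolding t_def r_def x_def N_def by (rule svd_lower_bound[OF compT svdT])
      let ?I = "I' \<union> \<alpha>"
      have finI: "finite ?I" "?I \<subseteq> V" using I' \<alpha> by auto
      have err2: "norm (T x - (\<Sum>w\<in>?I. cinner (T x) w *\<^sub>C w)) \<le> real N * (r * \<delta>2)"
        unfolding Tx
        by (rule projection_error_combination) (use I'(3) finI \<gamma>r \<delta>12 in auto)
      have "(\<Sum>w\<in>?I. cinner (T x) w *\<^sub>C w) = (\<Sum>w\<in>I. cinner (T x) w *\<^sub>C w)"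
        by (rule sum.mono_neutral_right[OF finI(1)]) (use Tx\<alpha> in \<open>auto simp: I_def\<close>)
      moreover have "norm (\<Sum>w\<in>I. cinner (T x) w *\<^sub>C w) = L2_set (\<lambda>w. cmod (cinner (T x) w)) I"
        unfolding L2_set_def norm_orthonormal_sum[OF orthonormal_subset[OF V(1) I(2)] I(1), symmetric] by simp
      ultimately have "norm (T x) \<le> real N * (r * \<delta>2) + L2_set (\<lambda>w. cmod (cinner (T x) w)) I"
        using err2 norm_triangle_ineq[of "T x - (\<Sum>w\<in>I. cinner (T x) w *\<^sub>C w)" "\<Sum>w\<in>I. cinner (T x) w *\<^sub>C w"]
        by simp
      moreover have "real N * (r * \<delta>2) = t * r / 16" using N by (simp add: \<delta>2_def)
      ultimately have A1: "t * r \<le> t * r / 16 + L2_set (\<lambda>w. cmod (cinner (T x) w)) I" using low by linarith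

      \<comment> \<open>The rows in \<open>I\<close> are small: replace \<open>x\<close> by its projection \<open>y\<close>, whose coordinates are \<open>\<xi>\<close>, and the
        entries of \<open>T\<close> by those of \<open>T' n\<close>.\<close>
      define y where "y = (\<Sum>j\<in>J. cinner x j *\<^sub>C j)"
      have err1: "norm (x - y) \<le> real N * (r * \<delta>1)"
        unfolding x_def y_def
        by (rule projection_error_combination) (use J \<gamma>r \<delta>12 in auto)
      have "norm (T (x - y)) \<le> \<kappa> * (real N * (r * \<delta>1))"
        by (rule order_trans[OF \<kappa>(2)]) (use err1 \<kappa>(1) in \<open>intro mult_left_mono, auto\<close>)
      also have "\<dots> = t * r / 16" using N \<kappa>(1) by (simp add: \<delta>1_def)
      finally have e1: "L2_set (\<lambda>w. cmod (cinner (T (x - y)) w)) I \<le> t * r / 16"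
        by (rule order_trans[OF L2_set_bessel[OF orthonormal_subset[OF V(1) I(2)] I(1)]])
      have "3 / 2 * (t / 2) * L2_set (\<lambda>j. cmod (\<xi> j)) J \<le> 3 / 2 * (t / 2) * r"
        using \<xi>r t by (intro mult_left_mono) auto
      then have e2: "L2_set (\<lambda>w. cmod (\<Sum>j\<in>J. T' n w j * \<xi> j)) I \<le> 3 / 4 * (t * r)"
        using v[rule_format, OF \<xi>0[rule_format]] by simp
      have "L2_set (\<lambda>w. cmod (\<Sum>j\<in>J. (cinner (T j) w - T' n w j) * \<xi> j)) I \<le>
          (\<Sum>w\<in>I. cmod (\<Sum>j\<in>J. (cinner (T j) w - T' n w j) * \<xi> j))"
        by (rule L2_set_le_sum) simp
      also have "\<dots> \<le> (\<Sum>w\<in>I. \<Sum>j\<in>J. \<rho> * r)"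
      proof (intro sum_mono order_trans[OF norm_sum])
        fix w j assume "w \<in> I" "j \<in> J"
        then have "cmod (cinner (T j) w - T' n w j) * cmod (\<xi> j) \<le> \<rho> * r"
          using n[of w j] \<xi>j[of j] \<rho>(1) by (intro mult_mono) (auto simp: norm_minus_commute)
        then show "cmod ((cinner (T j) w - T' n w j) * \<xi> j) \<le> \<rho> * r" by (simp add: norm_mult)
      qed
      also have "\<dots> = real (card I) * (real (card J) * \<rho>) * r" by simp
      also have "\<dots> \<le> t / 16 * r" using \<rho>(2) r by (intro mult_right_mono) auto
      finally have e3: "L2_set (\<lambda>w. cmod (\<Sum>j\<in>J. (cinner (T j) w - T' n w j) * \<xi> j)) I \<le> t * r / 16" by simp
      have "cinner (T x) w = cinner (T (x - y)) w + (\<Sum>j\<in>J. T' n w j * \<xi> j) + (\<Sum>j\<in>J. (cinner (T j) w - T' n w j) * \<xi> j)" for w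
      proof -
        have "(\<Sum>j\<in>J. T' n w j * \<xi> j) + (\<Sum>j\<in>J. (cinner (T j) w - T' n w j) * \<xi> j) = (\<Sum>j\<in>J. \<xi> j * cinner (T j) w)"
          unfolding sum.distrib[symmetric] by (intro sum.cong refl) (simp add: algebra_simps)
        also have "\<dots> = cinner (T y) w"
          unfolding y_def bounded_clinearD(8)[OF T] bounded_clinearD(2)[OF T] cinner_sum_left cinner_scaleC_left \<xi>_def ..
        finally show ?thesis by (simp add: bounded_clinearD(3)[OF T] cinner_diff_left)
      qed
      then have "L2_set (\<lambda>w. cmod (cinner (T x) w)) I \<le> t * r / 16 + 3 / 4 * (t * r) + t * r / 16"
        using order_trans[OF L2_set_triangle3 add_mono[OF add_mono[OF e1 e2] e3]] by simp
      then have "t * r \<le> 15 / 16 * (t * r)" using A1 by linarith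
      moreover have "0 < t * r" using t r by simp
      ultimately show False by linarith
    qed
    then have "real N * t \<le> real (card \<alpha> + M) * t" using t by (intro mult_right_mono) auto
    then show ?thesis using Mt by (simp add: N_def t_def distrib_right)
  qed
  then show ?thesis by blast
qed

theorem theorem4p3:
  fixes A B :: "'h::chilbert_space \<Rightarrow> 'h"
  assumes "separable_space (euclidean :: 'h topology)"
    and "infinite_dimensional TYPE('h)"
    and "compact_operator A"
    and "compact_operator B"
    and "(\<lambda>x. A x - B x) \<in> trace_class"
  shows "(\<lambda>x. abs_operator A x - abs_operator B x) \<in> weak_trace_class_0"
proof -
  let ?T = "\<lambda>x. abs_operator A x - abs_operator B x"
  note inf = assms(2)
  have comp: "compact_operator ?T"
    by (intro compact_operator_diff compact_abs_operator assms)
  obtain h where svd: "svd_basis ?T h" by (rule svd_basis_exists[OF comp inf])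
  define s where "s k = norm (?T (h k))" for k
  have s0: "s \<longlonglongrightarrow> 0" using svd_tendsto_0[OF comp svd] by (simp add: s_def[abs_def])
  have "(\<lambda>k. real k * s k) \<longlonglongrightarrow> 0"
  proof (rule LIMSEQ_I)
    fix \<epsilon> :: real assume \<epsilon>: "0 < \<epsilon>"
    obtain R :: nat where R: "\<forall>k. real (Suc k) * s k \<le> real R * s k + 56 * (\<epsilon> / 112)"
      using singular_value_count[OF inf assms(3-5) _ svd, of "\<epsilon> / 112"] \<epsilon> unfolding s_def by auto
    have "(\<lambda>k. real R * s k) \<longlonglongrightarrow> real R * 0" by (intro tendsto_intros s0)
    then have "\<forall>\<^sub>F k in sequentially. real R * s k < \<epsilon> / 2"
      by (rule order_tendstoD(2)) (use \<epsilon> in simp)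
    then obtain K where K: "\<And>k. k \<ge> K \<Longrightarrow> real R * s k < \<epsilon> / 2" by (auto simp: eventually_sequentially)
    show "\<exists>K. \<forall>k\<ge>K. norm (real k * s k - 0) < \<epsilon>"
    proof (intro exI[of _ K] allI impI)
      fix k assume "K \<le> k"
      have nn: "0 \<le> s k" by (simp add: s_def)
      have "real k * s k \<le> real (Suc k) * s k" using nn by (intro mult_right_mono) auto
      also have "\<dots> \<le> real R * s k + 56 * (\<epsilon> / 112)" using R by blast
      also have "\<dots> < \<epsilon>" using K[OF \<open>K \<le> k\<close>] by simp
      finally show "norm (real k * s k - 0) < \<epsilon>" using nn by simp
    qed
  qed
  then have "(\<lambda>k. real k * singular_numbers ?T k) \<longlonglongrightarrow> 0"
    unfolding singular_numbers_eq[OF comp inf svd] s_def .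
  with comp show ?thesis by (simp add: weak_trace_class_0_def)
qed

end
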